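(* Let $n\ge 3$, let $S\subset\mathbb{S}^n$ be an isoparametric hypersurface of the round sphere $(\mathbb{S}^n,g_0)$, with focal submanifolds $M_-$ and $M_+$, and let $n_-\le n_+$ be the dimensions of these focal submanifolds. Let $\lambda>0$ be a constant and let $p\in\left(1,\frac{n-n_-+2}{n-n_--2}\right)$. Then for every $k\in\mathbb{N}$ the equation $$-\Delta_{g_0}u+\lambda u=\lambda|u|^{p-1}u\qquad\text{on }\mathbb{S}^n$$ admits a nodal (i.e. sign-changing) solution $u_k$ such that its nodal set $\{u_k=0\}$ has at least $k$ connected components, each of them being an isoparametric hypersurface diffeomorphic to $S$, and its critical set $\{\nabla u_k=0\}$ consists of the focal submanifolds $M_-$ and $M_+$ together with at least $k-1$ isoparametric hypersurfaces diffeomorphic to $S$. Moreover, the solutions $u_k$ satisfy $$\lim_{k\to\infty}|u_k(x)|=\infty$$ for every $x\in M_-$ or for every $x\in M_+$.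
   Context: A smooth function $f:(M,g)\to\mathbb{R}$ on a Riemannian manifold is isoparametric if there are smooth functions $a,b:\mathbb{R}\to\mathbb{R}$ with $|\nabla f|_g^2=b(f)$ and $\Delta f=a(f)$; its regular level sets are called isoparametric hypersurfaces. On $\mathbb{S}^n$, isoparametric hypersurfaces are taken to be connected. Each isoparametric hypersurface $S$ of $\mathbb{S}^n$ is a regular level set of the restriction $f:\mathbb{S}^n\to[-1,1]$ to $\mathbb{S}^n$ of a Cartan–Münzner polynomial, that is, a homogeneous polynomial $F$ on $\mathbb{R}^{n+1}$ of degree $\ell$ with $|\nabla F|^2=\ell^2|x|^{2\ell-2}$ and $\Delta F=c|x|^{\ell-2}$ for some constant $c$, whose restriction to the sphere is nonconstant. All regular level sets of $f$ are connected, and the only critical values of $f$ are $\pm1$. The focal submanifolds of $S$ are the smooth submanifolds $f^{-1}(1)$ and $f^{-1}(-1)$, which are denoted $M_-$ and $M_+$ in some order. The fraction $\frac{n-n_-+2}{n-n_--2}$ is understood as $+\infty$ when $n-n_--2=0$. *)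

theory Defs
  imports "HOL-Analysis.Analysis"
begin

section \<open>Differentiability classes\<close>

text \<open>
  For open \<open>U\<close> in a finite-dimensional space. Continuity of \<open>x \<mapsto> f' x v\<close> for each fixed
  \<open>v\<close> is then the same as continuity of \<open>f'\<close> in the operator norm.
\<close>
primrec Ck_open :: "nat \<Rightarrow> 'a::euclidean_space set \<Rightarrow> ('a \<Rightarrow> 'b::real_normed_vector) \<Rightarrow> bool" where
  "Ck_open 0 U f \<longleftrightarrow> continuous_on U f"
| "Ck_open (Suc k) U f \<longleftrightarrow>
     (\<exists>f'. (\<forall>x\<in>U. (f has_derivative f' x) (at x)) \<and> (\<forall>v. Ck_open k U (\<lambda>x. f' x v)))"

definition smooth_open :: "'a::euclidean_space set \<Rightarrow> ('a \<Rightarrow> 'b::real_normed_vector) \<Rightarrow> bool" where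
  "smooth_open U f \<longleftrightarrow> (\<forall>k. Ck_open k U f)"

text \<open>
  On an arbitrary subset \<open>X\<close>: local extendability to an open subset of the ambient space. When
  \<open>X\<close> is an embedded submanifold this is the intrinsic notion.
\<close>
definition Ck_on :: "nat \<Rightarrow> 'a::euclidean_space set \<Rightarrow> ('a \<Rightarrow> 'b::real_normed_vector) \<Rightarrow> bool" where
  "Ck_on k X f \<longleftrightarrow>
     (\<forall>x\<in>X. \<exists>U g. open U \<and> x \<in> U \<and> Ck_open k U g \<and> (\<forall>y\<in>X \<inter> U. g y = f y))"

definition smooth_on :: "'a::euclidean_space set \<Rightarrow> ('a \<Rightarrow> 'b::real_normed_vector) \<Rightarrow> bool" where
  "smooth_on X f \<longleftrightarrow>
     (\<forall>x\<in>X. \<exists>U g. open U \<and> x \<in> U \<and> smooth_open U g \<and> (\<forall>y\<in>X \<inter> U. g y = f y))"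

definition diffeomorphic :: "'a::euclidean_space set \<Rightarrow> 'b::euclidean_space set \<Rightarrow> bool" where
  "diffeomorphic X Y \<longleftrightarrow>
     (\<exists>\<phi> \<psi>. homeomorphism X Y \<phi> \<psi> \<and> smooth_on X \<phi> \<and> smooth_on Y \<psi>)"

text \<open>Smooth embedded submanifold of dimension \<open>d\<close>, given by local flattening charts.\<close>
definition smooth_submanifold :: "nat \<Rightarrow> 'a::euclidean_space set \<Rightarrow> bool" where
  "smooth_submanifold d M \<longleftrightarrow>
     (\<forall>x\<in>M. \<exists>U (V :: 'a set) W \<phi> \<psi>. open U \<and> open V \<and> x \<in> U \<and>
        homeomorphism U V \<phi> \<psi> \<and> smooth_open U \<phi> \<and> smooth_open V \<psi> \<and>
        subspace W \<and> dim W = d \<and> \<phi> ` (M \<inter> U) = W \<inter> V)"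


section \<open>Gradient and Laplacian on Euclidean space\<close>

definition euclidean_gradient :: "('a::euclidean_space \<Rightarrow> real) \<Rightarrow> 'a \<Rightarrow> 'a" where
  "euclidean_gradient f x = (THE D. GDERIV f x :> D)"

definition euclidean_laplacian :: "('a::euclidean_space \<Rightarrow> real) \<Rightarrow> 'a \<Rightarrow> real" where
  "euclidean_laplacian f x =
     (\<Sum>b\<in>Basis. frechet_derivative (\<lambda>y. frechet_derivative f (at y) b) (at x) b)"


section \<open>Gradient and Laplace-Beltrami operator of the round unit sphere\<close>

abbreviation unit_sphere :: "'a::euclidean_space set" where
  "unit_sphere \<equiv> sphere 0 1"

definition sphere_tangent :: "'a::euclidean_space \<Rightarrow> 'a set" where
  "sphere_tangent x = {v. v \<bullet> x = 0}"

text \<open>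
  The derivative within the sphere depends only on the values on the sphere. As a linear map on the
  ambient space it is not unique, but its restriction to the tangent space is; hence at most one
  tangent vector represents it.
\<close>
definition sphere_gradient :: "('a::euclidean_space \<Rightarrow> real) \<Rightarrow> 'a \<Rightarrow> 'a" where
  "sphere_gradient f x =
     (THE v. v \<in> sphere_tangent x \<and>
        (f has_derivative (\<lambda>h. v \<bullet> h)) (at x within unit_sphere))"

definition orthonormal_basis :: "'a::euclidean_space set \<Rightarrow> 'a set \<Rightarrow> bool" where
  "orthonormal_basis W B \<longleftrightarrow>
     B \<subseteq> W \<and> pairwise orthogonal B \<and> (\<forall>e\<in>B. norm e = 1) \<and> span B = W"

text \<open>
  The Levi-Civita connection of the round metric is the tangential part of the ambient derivative,
  so the divergence of a tangent field \<open>X\<close>, i.e. the trace of \<open>v \<mapsto> \<nabla>\<^sub>v X\<close> on the tangent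
  space, is the sum of \<open>D X(e) \<bullet> e\<close> over any orthonormal basis of the tangent space.
\<close>
definition sphere_divergence :: "('a::euclidean_space \<Rightarrow> 'a) \<Rightarrow> 'a \<Rightarrow> real" where
  "sphere_divergence X x =
     (\<Sum>e\<in>(SOME B. orthonormal_basis (sphere_tangent x) B).
        frechet_derivative X (at x within unit_sphere) e \<bullet> e)"

definition sphere_laplacian :: "('a::euclidean_space \<Rightarrow> real) \<Rightarrow> 'a \<Rightarrow> real" where
  "sphere_laplacian f = sphere_divergence (sphere_gradient f)"

definition sphere_critical_set :: "('a::euclidean_space \<Rightarrow> real) \<Rightarrow> 'a set" where
  "sphere_critical_set f = {x \<in> unit_sphere. sphere_gradient f x = 0}"


section \<open>Isoparametric hypersurfaces and their focal submanifolds\<close>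

definition sphere_level :: "('a::euclidean_space \<Rightarrow> real) \<Rightarrow> real \<Rightarrow> 'a set" where
  "sphere_level f t = {x \<in> unit_sphere. f x = t}"

definition regular_level_set :: "('a::euclidean_space \<Rightarrow> real) \<Rightarrow> 'a set \<Rightarrow> bool" where
  "regular_level_set f S \<longleftrightarrow>
     S \<noteq> {} \<and> S \<inter> sphere_critical_set f = {} \<and> (\<exists>t. S = sphere_level f t)"

definition isoparametric_function :: "('a::euclidean_space \<Rightarrow> real) \<Rightarrow> bool" where
  "isoparametric_function f \<longleftrightarrow>
     smooth_on unit_sphere f \<and>
     (\<exists>a b :: real \<Rightarrow> real. smooth_open UNIV a \<and> smooth_open UNIV b \<and>
        (\<forall>x\<in>unit_sphere. (norm (sphere_gradient f x))\<^sup>2 = b (f x) \<and>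
                          sphere_laplacian f x = a (f x)))"

definition isoparametric_hypersurface :: "'a::euclidean_space set \<Rightarrow> bool" where
  "isoparametric_hypersurface S \<longleftrightarrow>
     connected S \<and> (\<exists>f. isoparametric_function f \<and> regular_level_set f S)"

text \<open>
  The exponent \<open>l - 2\<close> is an integer because \<open>l = 1\<close> (linear \<open>F\<close>, \<open>c = 0\<close>) is allowed. The case
  \<open>l = 0\<close> is excluded by non-constancy.
\<close>
definition cartan_muenzner :: "('a::euclidean_space \<Rightarrow> real) \<Rightarrow> nat \<Rightarrow> bool" where
  "cartan_muenzner F l \<longleftrightarrow>
     real_polynomial_function F \<and> (\<forall>r x. F (r *\<^sub>R x) = r ^ l * F x) \<and>
     (\<forall>x. (norm (euclidean_gradient F x))\<^sup>2 = (real l)\<^sup>2 * norm x ^ (2 * l - 2)) \<and>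
     (\<exists>c. \<forall>x. euclidean_laplacian F x = c * norm x powi (int l - 2)) \<and>
     \<not> F constant_on unit_sphere"

definition focal_submanifolds :: "'a::euclidean_space set \<Rightarrow> 'a set \<Rightarrow> 'a set \<Rightarrow> bool" where
  "focal_submanifolds S M M' \<longleftrightarrow>
     (\<exists>F l. cartan_muenzner F l \<and> regular_level_set F S \<and>
        (M = sphere_level F 1 \<and> M' = sphere_level F (-1) \<or>
         M = sphere_level F (-1) \<and> M' = sphere_level F 1))"


section \<open>The equation\<close>

definition critical_exponent :: "nat \<Rightarrow> nat \<Rightarrow> ereal" where
  "critical_exponent n d =
     (if real n - real d - 2 = 0 then \<infinity>
      else ereal ((real n - real d + 2) / (real n - real d - 2)))"

text \<open>Classical (C^2) solutions of \<open>-\<Delta> u + \<lambda> u = \<lambda> |u|^(p-1) u\<close> on the unit sphere.\<close>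
definition yamabe_type_solution :: "real \<Rightarrow> real \<Rightarrow> ('a::euclidean_space \<Rightarrow> real) \<Rightarrow> bool" where
  "yamabe_type_solution lam p u \<longleftrightarrow>
     Ck_on 2 unit_sphere u \<and>
     (\<forall>x\<in>unit_sphere.
        - sphere_laplacian u x + lam * u x = lam * (\<bar>u x\<bar> powr (p - 1) * u x))"

definition nodal :: "('a::euclidean_space \<Rightarrow> real) \<Rightarrow> bool" where
  "nodal u \<longleftrightarrow> (\<exists>x\<in>unit_sphere. u x > 0) \<and> (\<exists>x\<in>unit_sphere. u x < 0)"

text \<open>Used instead of \<open>k \<le> card A\<close>, which fails for infinite \<open>A\<close>.\<close>
definition at_least :: "nat \<Rightarrow> 'b set \<Rightarrow> bool" where
  "at_least k A \<longleftrightarrow> (\<exists>B\<subseteq>A. finite B \<and> card B = k)"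

end

theory Submission
  imports Defs
begin

text \<open>
  Let \<open>S\<close> be a regular level of the Cartan--Muenzner polynomial \<open>F\<close> of degree \<open>l\<close>. On the unit sphere the norm of the
  gradient and the Laplacian of \<open>F\<close> are functions of \<open>F\<close> (\<open>sphere_laplacian_comp\<close>), so a function
  \<open>u = W ((1 - F) / 2)\<close> solves the equation on the sphere if the profile \<open>W\<close> solves on \<open>{0..1}\<close> the equation

  \<open>s (1 - s) W'' + (\<alpha> (1 - s) - \<beta> s) W' + \<mu> (\<bar>W\<bar> powr (p - 1) * W - W) = 0\<close>, \<open>\<mu> = lam / l\<^sup>2\<close>,

  which is singular at both ends. The solutions \<open>u\<close> come from profiles that are regular at both ends and have
  many zeros. The zeros and critical points of such a profile are finite in number and correspond to
  levels of \<open>F\<close>.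

  \<^bold>\<open>Shooting.\<close> For each initial value \<open>d\<close> there is a unique solution on \<open>{0..1/2}\<close> that is regular at \<open>0\<close>: near the
  singular end the equation becomes an integral equation of Volterra type, solved by contraction, and an energy
  bound prevents blow-up (\<open>integral_solution_exists\<close>). It depends continuously on \<open>d\<close>. The assumption on \<open>p\<close> says that
  the equation is subcritical at both ends. A Pohozaev identity then shows that the energy at \<open>1/2\<close> tends to
  infinity with \<open>d\<close> (\<open>energy_tends_to_infinity\<close>). High energy means fast rotation of the phase vector (\<open>many_zeros\<close>).
  Hence the state \<open>(w, w')\<close> at \<open>1/2\<close>, as a function of \<open>d\<close>, runs along a spiral that winds clockwise to infinity
  (\<open>shooting_curve\<close>). Shooting from the other end gives, after reflection, a spiral with the opposite orientation.
  By a two-dimensional intermediate value theorem the two spirals meet arbitrarily far out (\<open>spirals_meet\<close>), and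
  each intersection is a profile on \<open>{0..1}\<close> (\<open>nodal_profile\<close>). Far out means large initial values, many turns and
  therefore many zeros; the value of the solution on a focal submanifold is the initial value, so it
  tends to infinity.

  \<^bold>\<open>Geometry.\<close> Along a great circle normal to a level of \<open>F\<close> the gradient of \<open>F\<close> differs from an explicit vector
  field by a solution of a linear differential equation that vanishes at the start, so it is this field
  (\<open>gradient_along_normal\<close>). The normal great circles therefore carry
  regular levels diffeomorphically onto each other and reach both focal submanifolds (\<open>levels_diffeomorphic\<close>,
  \<open>level_nonempty\<close>). Together with the connectedness of \<open>S\<close> this shows that all regular levels are isoparametric
  hypersurfaces diffeomorphic to \<open>S\<close>. Finally \<open>2 \<alpha>\<close> and \<open>2 \<beta>\<close> have to be compared with the codimensions of the focal
  submanifolds. At a focal point the Hessian of \<open>F\<close> on the sphere lies between \<open>- l\<^sup>2\<close> and \<open>0\<close>, with value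
  \<open>- l\<^sup>2\<close> on the direction of a normal great circle and \<open>0\<close> on the tangent space of the focal submanifold. Its trace is
  \<open>- l\<^sup>2\<close> times \<open>2 \<alpha>\<close> or \<open>2 \<beta>\<close>, which gives \<open>1 \<le> 2 \<alpha> \<le> n - d\<close> for a focal submanifold of dimension \<open>d\<close>
  (\<open>codim_const_ge_1\<close>, \<open>codim_const_le\<close>), as required for the shooting argument.
\<close>

section \<open>One-dimensional calculus\<close>

lemma mono_of_deriv_within:
  fixes f f' :: "real \<Rightarrow> real"
  assumes d: "\<And>s. s \<in> {a..b} \<Longrightarrow> (f has_real_derivative f' s) (at s within {a..b})"
    and nn: "\<And>s. a < s \<Longrightarrow> s < b \<Longrightarrow> f' s \<ge> 0"
    and xy: "a \<le> x" "x \<le> y" "y \<le> b"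
  shows "f x \<le> f y"
proof (rule DERIV_nonneg_imp_increasing_open[OF xy(2)])
  fix t assume t: "x < t" "t < y"
  then have "at t within {a..b} = at t"
    using xy by (intro at_within_interior) auto
  then show "\<exists>u. (f has_real_derivative u) (at t) \<and> 0 \<le> u"
    using d[of t] nn[of t] t xy by auto
next
  have "continuous_on {a..b} f"
    by (meson DERIV_continuous_on d)
  then show "continuous_on {x..y} f"
    by (rule continuous_on_subset) (use xy in auto)
qed

text \<open>A Gronwall argument in both directions from \<open>s0\<close>: \<open>N exp (K s)\<close> increases and
  \<open>N exp (- K s)\<close> decreases.\<close>

lemma gronwall_eq_0:
  fixes N N' :: "real \<Rightarrow> real"
  assumes d: "\<And>s. s \<in> {a..b} \<Longrightarrow> (N has_real_derivative N' s) (at s within {a..b})"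
    and nn: "\<And>s. s \<in> {a..b} \<Longrightarrow> N s \<ge> 0"
    and bd: "\<And>s. s \<in> {a..b} \<Longrightarrow> \<bar>N' s\<bar> \<le> K * N s"
    and s0: "s0 \<in> {a..b}" "N s0 = 0" and s: "s \<in> {a..b}"
  shows "N s = 0"
proof -
  have up: "((\<lambda>s. N s * exp (K * s)) has_real_derivative (N' t + K * N t) * exp (K * t))
      (at t within {a..b})" if "t \<in> {a..b}" for t
    using that by (auto intro!: derivative_eq_intros d simp: algebra_simps)
  have dn: "((\<lambda>s. - (N s * exp (- K * s))) has_real_derivative (K * N t - N' t) * exp (- K * t))
      (at t within {a..b})" if "t \<in> {a..b}" for t
    using that by (auto intro!: derivative_eq_intros d simp: algebra_simps)
  have bd2: "0 \<le> K * N t + N' t" "0 \<le> N' t + K * N t" "N' t \<le> K * N t" if "a < t" "t < b" for t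
    using bd[of t] that by (auto simp: abs_le_iff)
  show ?thesis
  proof (cases "s \<le> s0")
    case True
    have "N s * exp (K * s) \<le> N s0 * exp (K * s0)"
      by (rule mono_of_deriv_within[OF up]) (use s s0 True bd2 in auto)
    then have "N s \<le> 0"
      using s0 by (simp add: mult_le_0_iff)
    then show ?thesis using nn[OF s] by simp
  next
    case False
    have "- (N s0 * exp (- K * s0)) \<le> - (N s * exp (- K * s))"
      by (rule mono_of_deriv_within[OF dn]) (use s s0 False bd2 in auto)
    then have "N s \<le> 0"
      using s0 by (simp add: mult_le_0_iff)
    then show ?thesis using nn[OF s] by simp
  qed
qed

lemma first_hit:
  fixes f :: "real \<Rightarrow> real"
  assumes c: "continuous_on {a..b} f" and ab: "a \<le> b" and fa: "f a < c" and fb: "c \<le> f b"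
  obtains s where "a < s" "s \<le> b" "f s = c" "\<And>t. a \<le> t \<Longrightarrow> t < s \<Longrightarrow> f t < c"
proof -
  let ?Z = "{a..b} \<inter> f -` {c..}"
  have cl: "closed ?Z" by (rule continuous_closed_preimage[OF c]) auto
  have ne: "?Z \<noteq> {}" using fb ab by auto
  have bb: "bdd_below ?Z" by (rule bdd_belowI[of _ a]) auto
  define z where "z = Inf ?Z"
  have zZ: "z \<in> ?Z" unfolding z_def by (rule closed_contains_Inf[OF ne bb cl])
  have below: "f t < c" if "a \<le> t" "t < z" for t
    using that zZ cInf_lower[OF _ bb, of t] unfolding z_def[symmetric] by force
  have za: "a < z" using zZ fa by (cases "a = z") auto
  have "f z = c"
  proof (rule ccontr)
    assume "f z \<noteq> c"
    then have "f z > c" using zZ by auto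
    moreover have "continuous_on {a..z} f" by (rule continuous_on_subset[OF c]) (use zZ in auto)
    ultimately obtain t where "a \<le> t" "t \<le> z" "f t = c" using IVT'[of f a c z] fa za by auto
    then show False using below[of t] \<open>f z > c\<close> by (cases "t = z") auto
  qed
  then show ?thesis using that za zZ below by auto
qed

lemma real_quotient_limit:
  assumes "(f has_real_derivative D) (at 0)" "f 0 = 0"
  shows "((\<lambda>s. f s / s) \<longlongrightarrow> D) (at (0::real))"
  using assms by (simp add: has_field_derivative_iff)

lemma glue_deriv:
  fixes f g f' g' :: "real \<Rightarrow> real"
  assumes A: "closed A" and B: "closed B"
    and f: "\<And>s. s \<in> A \<Longrightarrow> (f has_real_derivative f' s) (at s within A)"
    and g: "\<And>s. s \<in> B \<Longrightarrow> (g has_real_derivative g' s) (at s within B)"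
    and eq: "\<And>s. s \<in> A \<Longrightarrow> s \<in> B \<Longrightarrow> f s = g s \<and> f' s = g' s"
    and s: "s \<in> A \<union> B"
  shows "((\<lambda>s. if s \<in> A then f s else g s) has_real_derivative (if s \<in> A then f' s else g' s))
    (at s within A \<union> B)"
  unfolding has_real_derivative_iff_has_vector_derivative
proof (rule has_vector_derivative_If_within_closures[OF s refl])
  have cA: "closure A = A" "closure B = B" using A B by auto
  have AB: "A \<union> (A \<inter> B) = A" "B \<union> (A \<inter> B) = B" by auto
  show "(f has_vector_derivative f' s) (at s within A \<union> (closure A \<inter> closure B))"
    if "s \<in> A \<union> (closure A \<inter> closure B)"
    using that f unfolding cA AB has_real_derivative_iff_has_vector_derivative by auto
  show "(g has_vector_derivative g' s) (at s within B \<union> (closure A \<inter> closure B))"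
    if "s \<in> B \<union> (closure A \<inter> closure B)"
    using that g unfolding cA AB has_real_derivative_iff_has_vector_derivative by auto
  show "f s = g s" "f' s = g' s" if "s \<in> closure A" "s \<in> closure B"
    using that eq unfolding cA by auto
qed

lemma glue_continuous:
  fixes f g :: "real \<Rightarrow> real"
  assumes "closed A" "closed B" "continuous_on A f" "continuous_on B g"
    and "\<And>s. s \<in> A \<Longrightarrow> s \<in> B \<Longrightarrow> f s = g s"
  shows "continuous_on (A \<union> B) (\<lambda>s. if s \<in> A then f s else g s)"
  by (rule continuous_on_cases[OF assms(1-4)]) (use assms(5) in blast)

text \<open>Beyond the end point the function is continued by its Taylor polynomial of degree two.\<close>

lemma C2_extend_right:
  fixes f f1 f2 :: "real \<Rightarrow> real"
  assumes A: "closed A" "A \<subseteq> {..b}" "b \<in> A"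
    and f: "\<And>s. s \<in> A \<Longrightarrow> (f has_real_derivative f1 s) (at s within A)"
      "\<And>s. s \<in> A \<Longrightarrow> (f1 has_real_derivative f2 s) (at s within A)"
    and c: "continuous_on A f2"
  shows "\<exists>g g1 g2. (\<forall>s\<in>A. g s = f s \<and> g1 s = f1 s \<and> g2 s = f2 s) \<and>
    (\<forall>s\<in>A \<union> {b..}. (g has_real_derivative g1 s) (at s within A \<union> {b..})) \<and>
    (\<forall>s\<in>A \<union> {b..}. (g1 has_real_derivative g2 s) (at s within A \<union> {b..})) \<and>
    continuous_on (A \<union> {b..}) g2"
proof -
  define h h1 where "h s = f b + f1 b * (s - b) + f2 b * (s - b)^2 / 2"
    and "h1 s = f1 b + f2 b * (s - b)" for s
  have h: "(h has_real_derivative h1 s) (at s within B)" "(h1 has_real_derivative f2 b) (at s within B)" for s B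
    unfolding h_def h1_def by (auto intro!: derivative_eq_intros)
  let ?I = "\<lambda>u v s. if s \<in> A then u s else v s :: real"
  have eq: "f s = h s \<and> f1 s = h1 s \<and> f2 s = f2 b" if "s \<in> A" "s \<in> {b..}" for s
  proof -
    have "s = b" using A that by auto
    then show ?thesis by (simp add: h_def h1_def)
  qed
  have "(?I f h has_real_derivative ?I f1 h1 s) (at s within A \<union> {b..})" if "s \<in> A \<union> {b..}" for s
    by (rule glue_deriv[OF A(1) closed_atLeast f(1) h(1)]) (use eq that in blast)+
  moreover have "(?I f1 h1 has_real_derivative ?I f2 (\<lambda>_. f2 b) s) (at s within A \<union> {b..})" if "s \<in> A \<union> {b..}" for s
    by (rule glue_deriv[OF A(1) closed_atLeast f(2) h(2)]) (use eq that in blast)+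
  moreover have "continuous_on (A \<union> {b..}) (?I f2 (\<lambda>_. f2 b))"
    by (rule glue_continuous[OF A(1) closed_atLeast c continuous_on_const]) (use eq in blast)
  ultimately show ?thesis
    by (intro exI[of _ "?I f h"] exI[of _ "?I f1 h1"] exI[of _ "?I f2 (\<lambda>_. f2 b)"]) auto
qed

lemma C2_extend:
  fixes f f1 f2 :: "real \<Rightarrow> real"
  assumes ab: "a \<le> b"
    and f: "\<And>s. s \<in> {a..b} \<Longrightarrow> (f has_real_derivative f1 s) (at s within {a..b})"
      "\<And>s. s \<in> {a..b} \<Longrightarrow> (f1 has_real_derivative f2 s) (at s within {a..b})"
    and c: "continuous_on {a..b} f2"
  obtains g g1 g2 where "\<And>s. s \<in> {a..b} \<Longrightarrow> g s = f s" "\<And>s. s \<in> {a..b} \<Longrightarrow> g1 s = f1 s"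
    "\<And>s. s \<in> {a..b} \<Longrightarrow> g2 s = f2 s"
    "\<And>s. (g has_real_derivative g1 s) (at s)" "\<And>s. (g1 has_real_derivative g2 s) (at s)"
    "continuous_on UNIV g2"
proof -
  have "\<exists>g g1 g2. (\<forall>s\<in>{a..b}. g s = f s \<and> g1 s = f1 s \<and> g2 s = f2 s) \<and>
    (\<forall>s\<in>{a..b} \<union> {b..}. (g has_real_derivative g1 s) (at s within {a..b} \<union> {b..})) \<and>
    (\<forall>s\<in>{a..b} \<union> {b..}. (g1 has_real_derivative g2 s) (at s within {a..b} \<union> {b..})) \<and>
    continuous_on ({a..b} \<union> {b..}) g2"
    by (rule C2_extend_right) (use ab f c in auto)
  moreover have "{a..b} \<union> {b..} = {a..}" using ab by auto
  ultimately obtain g g1 g2 where g: "\<forall>s\<in>{a..b}. g s = f s \<and> g1 s = f1 s \<and> g2 s = f2 s"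
    "\<forall>s\<in>{a..}. (g has_real_derivative g1 s) (at s within {a..})"
    "\<forall>s\<in>{a..}. (g1 has_real_derivative g2 s) (at s within {a..})"
    "continuous_on {a..} g2" by auto
  have r: "((\<lambda>s. h (- s)) has_real_derivative - h' (- s)) (at s within {..-a})"
    if "\<forall>s\<in>{a..}. (h has_real_derivative h' s) (at s within {a..})" "s \<in> {..-a}" for h h' s
  proof -
    have "uminus ` {..-a} = {a..}" by (force simp: image_iff intro: bexI[of _ "- _"])
    moreover have "(h has_real_derivative h' (-s)) (at (-s) within {a..})" using that by auto
    ultimately have "(h has_real_derivative h' (-s)) (at (-s) within uminus ` {..-a})" by simp
    moreover have "(uminus has_real_derivative -1) (at s within {..-a})"
      by (auto intro!: derivative_eq_intros)
    ultimately show ?thesis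
      using DERIV_image_chain[of h "h' (-s)" uminus s "{..-a}" "-1"] by (simp add: o_def)
  qed
  let ?A = "{..-a}"
  have "\<exists>k k1 k2. (\<forall>s\<in>?A. k s = g (-s) \<and> k1 s = - g1 (-s) \<and> k2 s = g2 (-s)) \<and>
    (\<forall>s\<in>?A \<union> {-a..}. (k has_real_derivative k1 s) (at s within ?A \<union> {-a..})) \<and>
    (\<forall>s\<in>?A \<union> {-a..}. (k1 has_real_derivative k2 s) (at s within ?A \<union> {-a..})) \<and>
    continuous_on (?A \<union> {-a..}) k2"
  proof (rule C2_extend_right)
    show "((\<lambda>s. g (-s)) has_real_derivative - g1 (- s)) (at s within ?A)" if "s \<in> ?A" for s
      using r[OF g(2) that] .
    show "((\<lambda>s. - g1 (-s)) has_real_derivative g2 (- s)) (at s within ?A)" if "s \<in> ?A" for s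
      using DERIV_minus[OF r[OF g(3) that]] by simp
    show "continuous_on ?A (\<lambda>s. g2 (-s))"
      by (rule continuous_on_compose2[OF g(4)]) (auto intro!: continuous_intros)
  qed auto
  moreover have "{..-a} \<union> {-a..} = (UNIV :: real set)" by auto
  ultimately obtain k k1 k2 where k: "\<forall>s\<in>?A. k s = g (-s) \<and> k1 s = - g1 (-s) \<and> k2 s = g2 (-s)"
    "\<forall>s. (k has_real_derivative k1 s) (at s)"
    "\<forall>s. (k1 has_real_derivative k2 s) (at s)"
    "continuous_on UNIV k2" by auto
  show ?thesis
  proof
    fix s assume "s \<in> {a..b}"
    then show "k (-s) = f s" "- k1 (-s) = f1 s" "k2 (-s) = f2 s" using k(1) g(1) by auto
  next
    fix s
    have m: "((\<lambda>s. h (- s)) has_real_derivative - h' (- s)) (at s)"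
      if "\<forall>s. (h has_real_derivative h' s) (at s)" for h h' :: "real \<Rightarrow> real"
      using DERIV_mirror[of h "h' (-s)" s] that by simp
    show "((\<lambda>s. k (- s)) has_real_derivative - k1 (- s)) (at s)" using m k by blast
    show "((\<lambda>s. - k1 (- s)) has_real_derivative k2 (- s)) (at s)" using DERIV_minus[OF m[OF k(3)]] by simp
    show "continuous_on UNIV (\<lambda>s. k2 (-s))"
      by (rule continuous_on_compose2[OF k(4)]) (auto intro!: continuous_intros)
  qed
qed

text \<open>Brouwer's theorem is applied to the map that subtracts \<open>(f1, f2)\<close> and projects back to the rectangle: a
  fixed point with a nonzero component of \<open>(f1, f2)\<close> would lie on the side towards which this component
  pushes, and the sign condition excludes that.\<close>

lemma poincare_miranda:
  fixes f1 f2 :: "real \<Rightarrow> real \<Rightarrow> real"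
  assumes ab: "a \<le> b" and cd: "c \<le> d"
    and c1: "continuous_on ({a..b} \<times> {c..d}) (\<lambda>(x, y). f1 x y)"
    and c2: "continuous_on ({a..b} \<times> {c..d}) (\<lambda>(x, y). f2 x y)"
    and L: "\<And>y. y \<in> {c..d} \<Longrightarrow> f1 a y \<le> 0" and R: "\<And>y. y \<in> {c..d} \<Longrightarrow> f1 b y \<ge> 0"
    and D: "\<And>x. x \<in> {a..b} \<Longrightarrow> f2 x c \<le> 0" and U: "\<And>x. x \<in> {a..b} \<Longrightarrow> f2 x d \<ge> 0"
  shows "\<exists>x\<in>{a..b}. \<exists>y\<in>{c..d}. f1 x y = 0 \<and> f2 x y = 0"
proof -
  define h where "h p = (max a (min b (fst p - f1 (fst p) (snd p))), max c (min d (snd p - f2 (fst p) (snd p))))" for p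
  let ?S = "{a..b} \<times> {c..d}"
  have c1': "continuous_on ?S (\<lambda>p. f1 (fst p) (snd p))" using c1 by (simp add: case_prod_unfold)
  have c2': "continuous_on ?S (\<lambda>p. f2 (fst p) (snd p))" using c2 by (simp add: case_prod_unfold)
  have "continuous_on ?S h"
    unfolding h_def by (intro continuous_intros c1' c2')
  moreover have "h \<in> ?S \<rightarrow> ?S" using ab cd by (auto simp: h_def)
  moreover have "compact ?S" "convex ?S" "?S \<noteq> {}" using ab cd by (auto intro: compact_Times convex_Times)
  ultimately obtain p where p: "p \<in> ?S" "h p = p" using brouwer[of ?S h] by blast
  obtain x y where xy: "p = (x, y)" by fastforce
  have xyi: "x \<in> {a..b}" "y \<in> {c..d}" using p xy by auto
  have e: "x = max a (min b (x - f1 x y))" "y = max c (min d (y - f2 x y))"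
    using p(2) unfolding xy h_def by simp_all
  have key: "v = 0" if "t = max l (min r (t - v))" "t = l \<Longrightarrow> v \<le> 0" "t = r \<Longrightarrow> v \<ge> 0" "l \<le> r" for t v l r :: real
    using that by (auto simp: max_def min_def split: if_splits)
  have "f1 x y = 0"
    by (rule key[OF e(1)]) (use L[OF xyi(2)] R[OF xyi(2)] ab in auto)
  moreover have "f2 x y = 0"
    by (rule key[OF e(2)]) (use D[OF xyi(1)] U[OF xyi(1)] cd in auto)
  ultimately show ?thesis using xyi by blast
qed

section \<open>Counting zeros with a polar angle\<close>

lemma half_pi_multiple_of_cos_eq_0:
  fixes t :: real
  assumes "cos t = 0"
  obtains m :: int where "t = pi / 2 + m * pi"
proof -
  obtain i where "odd i" "t = of_int i * (pi/2)" using assms cos_zero_iff_int by blast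
  then obtain m where "i = 2 * m + 1" by (auto elim: oddE)
  then show ?thesis using that[of m] \<open>t = _\<close> by (simp add: field_simps)
qed

text \<open>Polar coordinates for the phase curve \<open>(w, s w')\<close>. The factor \<open>s\<close> lets the curve of a solution that is
  regular at the singular point \<open>s = 0\<close> start on the positive first axis, with angle \<open>0\<close>.\<close>

locale clockwise_angle =
  fixes w w1 \<theta> \<rho> :: "real \<Rightarrow> real" and T :: real
  assumes w: "\<And>s. s \<in> {0..T} \<Longrightarrow> (w has_real_derivative w1 s) (at s within {0..T})"
    and \<theta>: "continuous_on {0..T} \<theta>" and \<rho>: "\<And>s. s \<in> {0..T} \<Longrightarrow> \<rho> s > 0"
    and pol: "\<And>s. s \<in> {0..T} \<Longrightarrow> w s = \<rho> s * cos (\<theta> s)"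
      "\<And>s. s \<in> {0..T} \<Longrightarrow> s * w1 s = \<rho> s * sin (\<theta> s)"
    and \<theta>0: "\<theta> 0 = 0"
begin

text \<open>On the vertical axis \<open>w'\<close> has the sign of the sine of the angle, so \<open>w\<close> passes through zero from the side
  that makes the angle decrease.\<close>

lemma crossing:
  fixes m :: int
  assumes s: "0 < s" "s \<le> T" and eq: "\<theta> s = pi / 2 + m * pi"
  shows "\<exists>e>0. (\<forall>t\<in>{0..T}. s < t \<longrightarrow> t < s + e \<longrightarrow> \<theta> t < \<theta> s) \<and>
    (\<forall>t\<in>{0..T}. t < s \<longrightarrow> s - e < t \<longrightarrow> \<theta> s < \<theta> t)"
proof -
  define c where "c = sin (\<theta> s)"
  have cos0: "cos (\<theta> s) = 0"
    unfolding eq using cos_zero_iff_int[of "pi / 2 + of_int m * pi"]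
    by (auto simp: field_simps intro!: exI[of _ "2*m+1"])
  then have c1: "c * c = 1" using sin_cos_squared_add[of "\<theta> s"] by (simp add: c_def power2_eq_square)
  have sT: "s \<in> {0..T}" using s by auto
  have "c * w1 s > 0"
  proof -
    have "s * (c * w1 s) = \<rho> s * (c * c)" using pol(2)[OF sT] by (simp add: c_def algebra_simps)
    then show ?thesis using \<rho>[OF sT] s c1 by (metis mult.right_neutral zero_less_mult_pos)
  qed
  moreover have D: "((\<lambda>t. c * w t) has_real_derivative c * w1 s) (at s within {0..T})"
    by (rule DERIV_cmult[OF w[OF sT]])
  ultimately obtain d1 d2 where d: "d1 > 0" "\<And>h. h > 0 \<Longrightarrow> s + h \<in> {0..T} \<Longrightarrow> h < d1 \<Longrightarrow> c * w s < c * w (s + h)"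
    "d2 > 0" "\<And>h. h > 0 \<Longrightarrow> s - h \<in> {0..T} \<Longrightarrow> h < d2 \<Longrightarrow> c * w (s - h) < c * w s"
    using has_real_derivative_pos_inc_right[OF D] has_real_derivative_pos_inc_left[OF D] by metis
  have ws: "w s = 0" using pol(1)[OF sT] cos0 by simp
  obtain d3 where d3: "d3 > 0" "\<And>t. t \<in> {0..T} \<Longrightarrow> \<bar>t - s\<bar> < d3 \<Longrightarrow> \<bar>\<theta> t - \<theta> s\<bar> < pi"
    using \<theta> sT unfolding continuous_on_iff dist_real_def by (metis pi_gt_zero)
  have cw: "c * w t = - \<rho> t * sin (\<theta> t - \<theta> s)" if "t \<in> {0..T}" for t
  proof -
    have "cos (\<theta> t) = cos ((\<theta> t - \<theta> s) + \<theta> s)" by simp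
    also have "\<dots> = - (sin (\<theta> t - \<theta> s) * c)" unfolding cos_add cos0 c_def by simp
    finally have "c * w t = - (c * c) * \<rho> t * sin (\<theta> t - \<theta> s)" using pol(1)[OF that] by simp
    then show ?thesis using c1 by simp
  qed
  let ?e = "min d1 (min d2 d3)"
  show ?thesis
  proof (intro exI[of _ ?e] conjI ballI impI)
    show "?e > 0" using d d3 by simp
    fix t assume t: "t \<in> {0..T}" "s < t" "t < s + ?e"
    then have "c * w t > 0" using d(2)[of "t - s"] ws by auto
    then have "sin (\<theta> t - \<theta> s) < 0" using cw[OF t(1)] \<rho>[OF t(1)] by (simp add: mult_less_0_iff)
    moreover have "\<bar>\<theta> t - \<theta> s\<bar> < pi" using d3(2)[OF t(1)] t by auto
    ultimately show "\<theta> t < \<theta> s" using sin_ge_zero[of "\<theta> t - \<theta> s"] by (smt (verit))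
  next
    fix t assume t: "t \<in> {0..T}" "t < s" "s - ?e < t"
    then have "c * w t < 0" using d(4)[of "s - t"] ws by auto
    then have "sin (\<theta> t - \<theta> s) > 0" using cw[OF t(1)] \<rho>[OF t(1)] by (simp add: zero_less_mult_iff)
    moreover have "\<bar>\<theta> t - \<theta> s\<bar> < pi" using d3(2)[OF t(1)] t by auto
    ultimately show "\<theta> s < \<theta> t" using sin_ge_zero[of "\<theta> s - \<theta> t"] sin_minus[of "\<theta> t - \<theta> s"] by (smt (verit))
  qed
qed

text \<open>A first return to the level \<open>pi / 2 + m pi\<close> would cross it counterclockwise.\<close>

lemma no_return_strict:
  fixes m :: int
  assumes a: "0 \<le> a" "a < s" "s \<le> T" and lt: "\<theta> a < pi / 2 + m * pi"
  shows "\<theta> s < pi / 2 + m * pi"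
proof (rule ccontr)
  assume n: "\<not> ?thesis"
  let ?c = "pi / 2 + m * pi"
  have "continuous_on {a..s} \<theta>" by (rule continuous_on_subset[OF \<theta>]) (use a in auto)
  then obtain z where za: "a < z" "z \<le> s" and zc: "\<theta> z = ?c"
    and below: "\<And>t. a \<le> t \<Longrightarrow> t < z \<Longrightarrow> \<theta> t < ?c"
    by (rule first_hit[of a s \<theta> ?c]) (use n a lt in auto)
  have zT: "0 < z" "z \<le> T" using za a by auto
  obtain e where e: "e > 0" "\<And>t. t \<in> {0..T} \<Longrightarrow> t < z \<Longrightarrow> z - e < t \<Longrightarrow> \<theta> z < \<theta> t"
    using crossing[OF zT zc] by metis
  define t where "t = max a (z - e / 2)"
  have "a \<le> t" "t < z" "z - e < t" using e za by (auto simp: t_def)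
  then show False using e(2)[of t] below[of t] a za zc by auto
qed

lemma no_return:
  fixes m :: int
  assumes a: "0 < a" "a < s" "s \<le> T" and le: "\<theta> a \<le> pi / 2 + m * pi"
  shows "\<theta> s < pi / 2 + m * pi"
proof (cases "\<theta> a = pi / 2 + m * pi")
  case False
  then show ?thesis using no_return_strict[of a s m] a le by auto
next
  case True
  have aT: "a \<le> T" using a by simp
  obtain e where e: "e > 0" "\<And>t. t \<in> {0..T} \<Longrightarrow> a < t \<Longrightarrow> t < a + e \<Longrightarrow> \<theta> t < \<theta> a"
    using crossing[OF a(1) aT True] by metis
  define t where "t = min ((a + s) / 2) (a + e / 2)"
  have t: "a < t" "t < s" "t < a + e" "t \<in> {0..T}" using e a by (auto simp: t_def field_simps min_def)
  show ?thesis using no_return_strict[of t s m] e(2)[of t] t a True by auto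
qed

text \<open>Each zero forces the angle down by another half turn, because the angle crosses the
  vertical axis only clockwise.\<close>

lemma angle_at_zeros:
  assumes z: "\<And>i. i < j \<Longrightarrow> 0 < z i \<and> z i \<le> T \<and> w (z i) = 0"
    and inc: "\<And>i. Suc i < j \<Longrightarrow> z i < z (Suc i)"
  shows "i < j \<Longrightarrow> \<theta> (z i) \<le> - pi / 2 - real i * pi"
proof (induction i)
  have mult: "\<exists>m::int. \<theta> (z i) = pi / 2 + m * pi" if "i < j" for i
  proof -
    have "cos (\<theta> (z i)) = 0" using z[OF that] pol(1)[of "z i"] \<rho>[of "z i"] by auto
    then show ?thesis by (metis half_pi_multiple_of_cos_eq_0)
  qed
  {
    case 0
    obtain m :: int where m: "\<theta> (z 0) = pi / 2 + m * pi" using mult[OF 0] by blast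
    have "\<theta> (z 0) < pi / 2 + of_int 0 * pi"
      by (rule no_return_strict[of 0]) (use z[OF 0] \<theta>0 in auto)
    then have "real_of_int m * pi < 0" using m by (metis add_0_right add_less_cancel_left mult_zero_left of_int_0)
    then have "m \<le> -1" by (simp add: mult_less_0_iff)
    then have "m * pi \<le> -1 * pi" by (intro mult_right_mono) auto
    then show ?case using m by simp
  next
    case (Suc i)
    obtain m :: int where m: "\<theta> (z (Suc i)) = pi / 2 + m * pi" using mult[OF Suc.prems] by blast
    have le: "\<theta> (z i) \<le> pi / 2 + of_int (- 1 - int i) * pi" using Suc by (simp add: field_simps)
    have "\<theta> (z (Suc i)) < pi / 2 + of_int (- 1 - int i) * pi"
      by (rule no_return[OF _ _ _ le]) (use z[of i] z[of "Suc i"] inc[of i] Suc.prems in auto)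
    then have "m * pi < of_int (- 1 - int i) * pi" using m by simp
    then have "of_int m < (of_int (-1 - int i) :: real)" by (metis mult_less_cancel_right_pos pi_gt_zero)
    then have "m \<le> - 2 - int i" by linarith
    then have "m * pi \<le> of_int (- 2 - int i) * pi" by (intro mult_right_mono) (auto simp del: of_int_diff)
    then show ?case using m by (simp add: algebra_simps)
  }
qed

lemma angle_end_le:
  assumes z: "\<And>i. i \<le> j \<Longrightarrow> 0 < z i \<and> z i \<le> T \<and> w (z i) = 0"
    and inc: "\<And>i. i < j \<Longrightarrow> z i < z (Suc i)"
  shows "\<theta> T \<le> - pi / 2 - real j * pi"
proof -
  have le: "\<theta> (z j) \<le> - pi / 2 - real j * pi"
    by (rule angle_at_zeros[of "Suc j"]) (use z inc in auto)
  show ?thesis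
  proof (cases "z j = T")
    case False
    have "\<theta> T < pi / 2 + of_int (- 1 - int j) * pi"
      by (rule no_return[of "z j"]) (use z[of j] False le in \<open>auto simp: algebra_simps\<close>)
    then show ?thesis by (simp add: algebra_simps)
  qed (use le in auto)
qed

text \<open>Conversely, on its way down the angle takes each value \<open>- pi / 2 - i pi\<close>, and there \<open>w\<close> vanishes.\<close>

lemma zeros_of_angle_le:
  assumes T: "0 \<le> T" and le: "\<theta> T \<le> - pi / 2 - real j * pi"
  shows "\<exists>B\<subseteq>{s\<in>{0..T}. w s = 0}. finite B \<and> card B = Suc j"
proof -
  have "\<exists>s\<in>{0..T}. \<theta> s = - pi / 2 - real i * pi" if "i \<le> j" for i
  proof -
    have "real i * pi \<le> real j * pi" using that by simp
    then have "\<theta> T \<le> - pi / 2 - real i * pi" using le by linarith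
    moreover have "- pi / 2 - real i * pi \<le> \<theta> 0" unfolding \<theta>0
    proof -
      have "0 \<le> real i * pi" by simp
      then show "- pi / 2 - real i * pi \<le> 0" using pi_gt_zero by linarith
    qed
    ultimately show ?thesis using IVT2'[of \<theta> T "- pi / 2 - real i * pi" 0] T \<theta> by auto
  qed
  then obtain z where z: "\<And>i. i \<le> j \<Longrightarrow> z i \<in> {0..T} \<and> \<theta> (z i) = - pi / 2 - real i * pi" by metis
  have "w (z i) = 0" if "i \<le> j" for i
  proof -
    have "cos (- pi / 2 - real i * pi) = 0" by (simp add: cos_diff)
    then show ?thesis using pol(1)[of "z i"] z[OF that] by simp
  qed
  moreover have "inj_on z {..j}"
  proof (rule inj_onI)
    fix a b assume "a \<in> {..j}" "b \<in> {..j}" "z a = z b"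
    then have "real a * pi = real b * pi" using z by (metis atMost_iff diff_left_imp_eq)
    then show "a = b" by simp
  qed
  ultimately show ?thesis using z
    by (intro exI[of _ "z ` {..j}"]) (auto simp: card_image)
qed

end

section \<open>The nonlinearity and its primitive\<close>

definition nonlin :: "real \<Rightarrow> real \<Rightarrow> real" where
  "nonlin p w = \<bar>w\<bar> powr (p - 1) * w - w"

definition potential :: "real \<Rightarrow> real \<Rightarrow> real" where
  "potential p w = \<bar>w\<bar> powr (p + 1) / (p + 1) - w\<^sup>2 / 2"

lemma abs_powr_mult_has_derivative:
  fixes q w :: real
  assumes q: "q > 0"
  shows "((\<lambda>w. \<bar>w\<bar> powr q * w) has_real_derivative (q + 1) * \<bar>w\<bar> powr q) (at w)"
proof -
  consider "w > 0" | "w < 0" | "w = 0" by linarith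
  then show ?thesis
  proof cases
    case 1
    have "((\<lambda>w. w powr q * w) has_real_derivative (q + 1) * \<bar>w\<bar> powr q) (at w)"
      using 1 by (auto intro!: derivative_eq_intros simp: field_simps powr_diff)
    then show ?thesis
      by (rule has_field_derivative_transform_within_open[of _ _ _ "{0<..}"]) (use 1 in auto)
  next
    case 2
    have "((\<lambda>w. (- w) powr q * w) has_real_derivative (q + 1) * \<bar>w\<bar> powr q) (at w)"
      using 2 by (auto intro!: derivative_eq_intros simp: field_simps powr_diff)
    then show ?thesis
      by (rule has_field_derivative_transform_within_open[of _ _ _ "{..<0}"]) (use 2 in auto)
  next
    case 3
    have "((\<lambda>h. \<bar>h\<bar> powr q) \<longlongrightarrow> 0) (at (0::real))"
      by (rule tendsto_zero_powrI[where b = q]) (auto intro!: tendsto_eq_intros q)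
    then have "((\<lambda>h. (\<bar>h\<bar> powr q * h - 0) / (h - 0)) \<longlongrightarrow> 0) (at (0::real))"
      by (rule Lim_transform_eventually) (auto simp: eventually_at intro!: exI[of _ 1])
    then show ?thesis using 3 q by (simp add: has_field_derivative_iff)
  qed
qed

lemma abs_powr_Suc: "\<bar>w\<bar> powr (p + 1) = \<bar>w\<bar> powr (p - 1) * w * (w::real)"
proof (cases "w = 0")
  case False
  have "\<bar>w\<bar> powr (p + 1) = \<bar>w\<bar> powr ((p - 1) + 2)" by (simp add: algebra_simps)
  also have "\<dots> = \<bar>w\<bar> powr (p - 1) * \<bar>w\<bar> powr 2" by (rule powr_add)
  also have "\<bar>w\<bar> powr 2 = w * w" using False by (simp add: powr_numeral power2_eq_square)
  finally show ?thesis by simp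
qed auto

lemma nonlin_has_derivative:
  assumes "p > 1"
  shows "(nonlin p has_real_derivative p * \<bar>w\<bar> powr (p - 1) - 1) (at w within A)"
  unfolding nonlin_def
  by (rule has_field_derivative_at_within)
    (use DERIV_diff[OF abs_powr_mult_has_derivative[of "p - 1" w] DERIV_ident] assms in simp)

lemma nonlin_continuous: "p > 1 \<Longrightarrow> continuous_on A (nonlin p)"
  by (rule DERIV_continuous_on[OF nonlin_has_derivative])

lemma potential_has_derivative:
  assumes p: "p > 1"
  shows "(potential p has_real_derivative nonlin p w) (at w within A)"
proof -
  have A: "((\<lambda>w. \<bar>w\<bar> powr (p - 1) * w) has_real_derivative (p - 1 + 1) * \<bar>w\<bar> powr (p - 1)) (at w)"
    using p by (intro abs_powr_mult_has_derivative) simp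
  have B: "((\<lambda>w::real. w\<^sup>2 / 2) has_real_derivative w) (at w)"
    by (auto intro!: derivative_eq_intros)
  have "((\<lambda>w. \<bar>w\<bar> powr (p - 1) * w * w / (p + 1) - w\<^sup>2 / 2) has_real_derivative
      ((p - 1 + 1) * \<bar>w\<bar> powr (p - 1) * w + \<bar>w\<bar> powr (p - 1) * w) / (p + 1) - w) (at w)"
    by (rule DERIV_cong[OF DERIV_diff[OF DERIV_cdivide[OF DERIV_mult[OF A DERIV_ident], of "p + 1"] B]]) simp
  moreover have "((p - 1 + 1) * \<bar>w\<bar> powr (p - 1) * w + \<bar>w\<bar> powr (p - 1) * w) / (p + 1) - w = nonlin p w"
    using p by (simp add: nonlin_def field_simps)
  moreover have "potential p = (\<lambda>w. \<bar>w\<bar> powr (p - 1) * w * w / (p + 1) - w\<^sup>2 / 2)"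
    by (rule ext) (simp only: potential_def abs_powr_Suc)
  ultimately have "(potential p has_real_derivative nonlin p w) (at w)"
    by (simp only:)
  then show ?thesis by (rule has_field_derivative_at_within)
qed

lemma nonlin_zeros: "p > 1 \<Longrightarrow> nonlin p w = 0 \<longleftrightarrow> w = 0 \<or> \<bar>w\<bar> = 1"
proof (cases "w = 0 \<or> \<bar>w\<bar> = 1")
  case False
  assume "p > 1"
  then have "\<bar>w\<bar> powr (p - 1) \<noteq> 1" using False by (subst powr_eq_one_iff_gen) auto
  then show ?thesis using False by (simp add: nonlin_def)
qed (auto simp: nonlin_def)

lemma potential_lower:
  assumes p: "p > 1"
  shows "potential p w \<ge> - 1 / 2"
proof (cases "\<bar>w\<bar> \<le> 1")
  case True
  then have "w\<^sup>2 \<le> 1" by (simp add: abs_square_le_1)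
  moreover have "\<bar>w\<bar> powr (p + 1) / (p + 1) \<ge> 0" using p by simp
  ultimately show ?thesis unfolding potential_def by linarith
next
  case False
  have "potential p 1 \<le> potential p \<bar>w\<bar>"
  proof (rule DERIV_nonneg_imp_nondecreasing[of 1 "\<bar>w\<bar>" "potential p"])
    fix x assume x: "1 \<le> x" "x \<le> \<bar>w\<bar>"
    have "1 \<le> x powr (p - 1)" using x p by (simp add: ge_one_powr_ge_zero)
    then have "nonlin p x \<ge> 0" using x by (simp add: nonlin_def mult_le_cancel_right1)
    then show "\<exists>y. (potential p has_real_derivative y) (at x) \<and> 0 \<le> y"
      using potential_has_derivative[OF p] by blast
  qed (use False in auto)
  moreover have "potential p 1 \<ge> - 1 / 2" using p by (simp add: potential_def)
  moreover have "potential p \<bar>w\<bar> = potential p w" by (simp add: potential_def)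
  ultimately show ?thesis by linarith
qed

text \<open>The superlinear power dominates the quadratic term.\<close>

lemma square_le_eps_powr:
  fixes p e :: real
  assumes p: "p > 1" and e: "e > 0"
  obtains C where "C \<ge> 0" "\<And>w::real. w\<^sup>2 \<le> e * \<bar>w\<bar> powr (p + 1) + C"
proof
  define R where "R = (1 / e) powr (1 / (p - 1))"
  show "0 \<le> R\<^sup>2" by simp
  fix w :: real
  show "w\<^sup>2 \<le> e * \<bar>w\<bar> powr (p + 1) + R\<^sup>2"
  proof (cases "\<bar>w\<bar> \<le> R")
    case True
    then have "w\<^sup>2 \<le> R\<^sup>2" by (rule power2_le_iff_abs_le[THEN iffD2, rotated]) (simp add: R_def)
    moreover have "0 \<le> e * \<bar>w\<bar> powr (p + 1)" using e by simp
    ultimately show ?thesis by linarith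
  next
    case False
    have "1 / e = R powr (p - 1)" unfolding R_def using p e by (simp add: powr_powr)
    also have "\<dots> \<le> \<bar>w\<bar> powr (p - 1)" using False p by (intro powr_mono2) (auto simp: R_def)
    finally have "1 \<le> e * \<bar>w\<bar> powr (p - 1)" using e by (simp add: field_simps)
    then have "1 * w\<^sup>2 \<le> e * \<bar>w\<bar> powr (p - 1) * w\<^sup>2" by (intro mult_right_mono) auto
    also have "\<dots> = e * \<bar>w\<bar> powr (p + 1)" by (simp add: abs_powr_Suc power2_eq_square)
    finally show ?thesis by (simp add: add_increasing2)
  qed
qed

lemma powr_le_potential:
  assumes p: "p > 1"
  obtains C where "C \<ge> 0" "\<And>w. \<bar>w\<bar> powr (p + 1) \<le> 2 * (p + 1) * potential p w + C"
proof -
  have "1 / (p + 1) > 0" using p by simp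
  from square_le_eps_powr[OF p this]
  obtain C where C: "C \<ge> 0" "\<And>w::real. w\<^sup>2 \<le> (1 / (p + 1)) * \<bar>w\<bar> powr (p + 1) + C"
    by blast
  show ?thesis
  proof
    show "0 \<le> (p + 1) * C" using C p by simp
    fix w :: real
    have "(p + 1) * w\<^sup>2 \<le> (p + 1) * ((1 / (p + 1)) * \<bar>w\<bar> powr (p + 1) + C)"
      using C(2)[of w] p by (intro mult_left_mono) auto
    then have "(p + 1) * w\<^sup>2 \<le> \<bar>w\<bar> powr (p + 1) + (p + 1) * C" using p by (simp add: distrib_left)
    moreover have "2 * (p + 1) * potential p w = 2 * \<bar>w\<bar> powr (p + 1) - (p + 1) * w\<^sup>2"
      using p by (simp add: potential_def field_simps)
    ultimately show "\<bar>w\<bar> powr (p + 1) \<le> 2 * (p + 1) * potential p w + (p + 1) * C" by linarith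
  qed
qed

lemma nonlin_lipschitz:
  assumes p: "p > 1" and ab: "\<bar>a\<bar> \<le> R" "\<bar>b\<bar> \<le> R"
  shows "\<bar>nonlin p a - nonlin p b\<bar> \<le> (p * R powr (p - 1) + 1) * \<bar>a - b\<bar>"
proof -
  have "norm (nonlin p a - nonlin p b) \<le> (p * R powr (p - 1) + 1) * norm (a - b)"
  proof (rule field_differentiable_bound[of "{-R..R}"])
    fix z assume "z \<in> {-R..R}"
    then have "\<bar>z\<bar> powr (p - 1) \<le> R powr (p - 1)" using p by (intro powr_mono2) auto
    then have "p * \<bar>z\<bar> powr (p - 1) \<le> p * R powr (p - 1)" "0 \<le> p * \<bar>z\<bar> powr (p - 1)" using p by auto
    then show "norm (p * \<bar>z\<bar> powr (p - 1) - 1) \<le> p * R powr (p - 1) + 1" by simp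
  qed (use ab in \<open>auto intro: nonlin_has_derivative[OF p]\<close>)
  then show ?thesis by simp
qed

section \<open>Weighted averages\<close>

text \<open>Up to the factor \<open>a * s powr - a\<close> this is the integral of \<open>\<tau> powr (a - 1) * \<psi> \<tau>\<close> over \<open>{0..s}\<close>;
  the substitution \<open>\<tau> = s * y powr (1/a)\<close> removes the singularity at \<open>s = 0\<close>.\<close>

definition avg :: "real \<Rightarrow> (real \<Rightarrow> real) \<Rightarrow> real \<Rightarrow> real" where
  "avg a \<psi> s = integral {0..1} (\<lambda>y. \<psi> (s * y powr (1 / a)))"

context
  fixes a T :: real
  assumes a: "a > 0" and T: "T \<ge> 0"
begin

lemma node_in: "s \<in> {0..T} \<Longrightarrow> y \<in> {0..1} \<Longrightarrow> s * y powr (1 / a) \<in> {0..T}"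
  using a by (auto intro!: mult_left_le[THEN order_trans] powr_le1)

lemma node_le: "s \<ge> 0 \<Longrightarrow> y \<in> {0..1} \<Longrightarrow> s * y powr (1 / a) \<in> {0..s}"
  using a by (auto intro!: mult_left_le powr_le1)

lemma node_continuous: "continuous_on (A \<times> {0..1}) (\<lambda>(s, y). s * y powr (1 / a))"
  unfolding case_prod_unfold using a by (intro continuous_intros continuous_on_powr') auto

lemma powr_node_continuous: "continuous_on {0..1} (\<lambda>y::real. y powr (1 / a))"
  using a by (intro continuous_intros continuous_on_powr') auto

lemma avg_integrand_continuous:
  assumes c: "continuous_on {0..T} \<psi>"
  shows "continuous_on ({0..T} \<times> {0..1}) (\<lambda>(s, y). \<psi> (s * y powr (1 / a)))"
  using continuous_on_compose2[OF c node_continuous[of "{0..T}"]] node_in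
  by (force simp: case_prod_unfold)

lemma avg_slice_continuous:
  assumes c: "continuous_on {0..T} \<psi>" and s: "s \<in> {0..T}"
  shows "continuous_on {0..1} (\<lambda>y. \<psi> (s * y powr (1 / a)))"
  by (rule continuous_on_compose2[OF c]) (use s node_in in \<open>auto intro!: continuous_intros powr_node_continuous\<close>)

lemma avg_continuous:
  assumes c: "continuous_on {0..T} \<psi>"
  shows "continuous_on {0..T} (avg a \<psi>)"
  using integral_continuous_on_param[of "{0..T}" 0 1 "\<lambda>s y. \<psi> (s * y powr (1 / a))"] avg_integrand_continuous[OF c]
  by (simp add: avg_def[abs_def] cbox_interval)

lemma avg_diff:
  assumes c: "continuous_on {0..T} \<psi>" "continuous_on {0..T} \<phi>" and s: "s \<in> {0..T}"
  shows "avg a (\<lambda>t. \<psi> t - \<phi> t) s = avg a \<psi> s - avg a \<phi> s"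
  unfolding avg_def
  by (rule integral_diff) (use avg_slice_continuous[OF _ s] c in \<open>auto intro!: integrable_continuous_real\<close>)

lemma avg_bound:
  assumes c: "continuous_on {0..T} \<psi>" and s: "s \<in> {0..T}" and b: "\<And>t. t \<in> {0..s} \<Longrightarrow> \<bar>\<psi> t\<bar> \<le> M"
  shows "\<bar>avg a \<psi> s\<bar> \<le> M"
proof -
  have "norm (integral {0..1} (\<lambda>y. \<psi> (s * y powr (1 / a)))) \<le> M * (1 - 0)"
    by (rule integral_bound) (use node_le[of s] b s avg_slice_continuous[OF c s] in auto)
  then show ?thesis by (simp add: avg_def)
qed

text \<open>The last identity is the fundamental theorem of calculus for \<open>y * \<psi> (s * y powr (1/a))\<close>
  on \<open>{0..1}\<close>; it turns the average into a solution of a singular first order equation.\<close>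

lemma avg_deriv:
  assumes d: "\<And>t. t \<in> {0..T} \<Longrightarrow> (\<psi> has_real_derivative \<psi>' t) (at t within {0..T})"
    and c': "continuous_on {0..T} \<psi>'"
  shows "\<exists>A'. continuous_on {0..T} A' \<and>
    (\<forall>s\<in>{0..T}. (avg a \<psi> has_real_derivative A' s) (at s within {0..T})) \<and>
    (\<forall>s\<in>{0..T}. s * A' s = a * (\<psi> s - avg a \<psi> s))"
proof -
  have c: "continuous_on {0..T} \<psi>" by (rule DERIV_continuous_on[OF d])
  define F where "F s y = y powr (1 / a) * \<psi>' (s * y powr (1 / a))" for s y
  have Fc: "continuous_on ({0..T} \<times> {0..1}) (\<lambda>(s, y). F s y)"
  proof -
    have "continuous_on ({0..T} \<times> {0..1}) (\<lambda>z::real\<times>real. snd z powr (1 / a))"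
      by (rule continuous_on_compose2[OF powr_node_continuous]) (auto intro!: continuous_intros)
    then show ?thesis
      using avg_integrand_continuous[OF c'] unfolding F_def case_prod_unfold
      by (intro continuous_on_mult) auto
  qed
  have R1: "continuous_on {0..T} (\<lambda>s. integral {0..1} (F s))"
    using integral_continuous_on_param[of "{0..T}" 0 1 F] Fc by (simp add: cbox_interval)
  have R2: "(avg a \<psi> has_real_derivative integral {0..1} (F s)) (at s within {0..T})" if s: "s \<in> {0..T}" for s
  proof -
    have "((\<lambda>s. integral (cbox 0 1) (\<lambda>y. \<psi> (s * y powr (1 / a)))) has_real_derivative integral (cbox 0 1) (F s)) (at s within {0..T})"
    proof (rule leibniz_rule_field_derivative)
      fix x t :: real assume x: "x \<in> {0..T}" and t: "t \<in> cbox 0 1"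
      let ?c = "t powr (1 / a)"
      have im: "(\<lambda>x. x * ?c) ` {0..T} \<subseteq> {0..T}" using node_in t by (auto simp: cbox_interval)
      have D: "(\<psi> has_real_derivative \<psi>' (x * ?c)) (at (x * ?c) within (\<lambda>x. x * ?c) ` {0..T})"
        by (rule DERIV_subset[OF d im]) (use im x in blast)
      have "((\<lambda>x. x * ?c) has_real_derivative ?c) (at x within {0..T})"
        by (auto intro!: derivative_eq_intros)
      from DERIV_image_chain[OF D this] show "((\<lambda>x. \<psi> (x * ?c)) has_real_derivative F x t) (at x within {0..T})"
        by (simp add: F_def o_def mult.commute)
    next
      fix x assume "x \<in> {0..T}"
      then show "(\<lambda>y. \<psi> (x * y powr (1 / a))) integrable_on cbox 0 1"
        using avg_slice_continuous[OF c] by (simp add: cbox_interval integrable_continuous_real)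
    qed (use s Fc in \<open>auto simp: cbox_interval\<close>)
    then show ?thesis by (simp add: avg_def[abs_def] cbox_interval)
  qed
  have R3: "s * integral {0..1} (F s) = a * (\<psi> s - avg a \<psi> s)" if s: "s \<in> {0..T}" for s
  proof -
    have D: "((\<lambda>y. y * \<psi> (s * y powr (1 / a))) has_real_derivative \<psi> (s * y powr (1 / a)) + (s / a) * F s y) (at y)"
      if y: "y \<in> {0<..<1}" for y
    proof -
      let ?g = "\<lambda>y. s * y powr (1 / a)"
      have im: "?g ` {0<..<1} \<subseteq> {0..T}" using node_in s by auto
      have g: "(?g has_real_derivative s * (1 / a * y powr (1 / a - 1))) (at y within {0<..<1})"
        using y a by (auto intro!: derivative_eq_intros)
      have "(\<psi> has_real_derivative \<psi>' (?g y)) (at (?g y) within ?g ` {0<..<1})"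
        by (rule DERIV_subset[OF d im]) (use im y in blast)
      from DERIV_image_chain[OF this g]
      have "((\<lambda>y. \<psi> (?g y)) has_real_derivative \<psi>' (?g y) * (s * (1 / a * y powr (1 / a - 1)))) (at y within {0<..<1})"
        by (simp add: o_def)
      then have "((\<lambda>y. \<psi> (?g y)) has_real_derivative \<psi>' (?g y) * (s * (1 / a * y powr (1 / a - 1)))) (at y)"
        using y at_within_open[of y "{0<..<1}"] by simp
      from DERIV_mult[OF DERIV_ident this] show ?thesis
        by (rule DERIV_cong) (use y in \<open>simp add: F_def powr_diff field_simps\<close>)
    qed
    have "((\<lambda>y. \<psi> (s * y powr (1 / a)) + (s / a) * F s y) has_integral
       (1 * \<psi> (s * 1 powr (1 / a)) - 0 * \<psi> (s * 0 powr (1 / a)))) {0..1}"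
      by (rule fundamental_theorem_of_calculus_interior)
        (use D avg_slice_continuous[OF c s] in \<open>auto intro!: continuous_intros simp: has_real_derivative_iff_has_vector_derivative\<close>)
    then have "integral {0..1} (\<lambda>y. \<psi> (s * y powr (1 / a)) + (s / a) * F s y) = \<psi> s"
      by (simp add: integral_unique)
    moreover have "integral {0..1} (\<lambda>y. \<psi> (s * y powr (1 / a)) + (s / a) * F s y) = avg a \<psi> s + (s / a) * integral {0..1} (F s)"
    proof -
      have "continuous_on {0..1} (F s)"
        unfolding F_def[abs_def] by (intro continuous_on_mult powr_node_continuous avg_slice_continuous[OF c' s])
      then have i2: "(\<lambda>y. (s / a) * F s y) integrable_on {0..1}"
        by (intro integrable_continuous_real continuous_intros)
      have i1: "(\<lambda>y. \<psi> (s * y powr (1 / a))) integrable_on {0..1}"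
        by (rule integrable_continuous_real[OF avg_slice_continuous[OF c s]])
      show ?thesis
        unfolding avg_def using integral_add[OF i1 i2] by simp
    qed
    ultimately have "(s / a) * integral {0..1} (F s) = \<psi> s - avg a \<psi> s" by linarith
    then show ?thesis using a by (simp add: field_simps)
  qed
  show ?thesis using R1 R2 R3 by (intro exI[of _ "\<lambda>s. integral {0..1} (F s)"]) blast
qed

end

section \<open>The singular initial value problem\<close>

lemma one_minus_powr_deriv:
  "t < 1 \<Longrightarrow> ((\<lambda>t. (1 - t) powr b) has_real_derivative - b * (1 - t) powr (b - 1)) (at t within A)"
  by (auto intro!: derivative_eq_intros)

text \<open>The equation \<open>s (1 - s) w'' + (\<alpha> (1 - s) - \<beta> s) w' + \<mu> (\<bar>w\<bar> powr (p - 1) * w - w) = 0\<close>: a Jacobi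
  differential operator with a superlinear term. For \<open>s = (1 - F) / 2\<close> it describes functions of a
  Cartan--Muenzner polynomial \<open>F\<close> on the sphere, where \<open>2 \<alpha>\<close> and \<open>2 \<beta>\<close> are the codimensions of the focal submanifolds \<open>s = 0\<close> and \<open>s = 1\<close>.
  Only \<open>{0..1/2}\<close> is studied here: reflection \<open>s \<mapsto> 1 - s\<close> exchanges \<open>\<alpha>\<close> and \<open>\<beta>\<close>.\<close>

locale jacobi =
  fixes \<alpha> \<beta> \<mu> p :: real
  assumes \<alpha>: "\<alpha> \<ge> 1 / 2" and \<beta>: "\<beta> \<ge> 1 / 2" and \<mu>: "\<mu> > 0" and p: "p > 1"
begin

lemma \<alpha>_pos: "\<alpha> > 0" using \<alpha> by simp

text \<open>The divergence form \<open>(s powr \<alpha> * (1 - s) powr \<beta> * w')' = - \<mu> * s powr (\<alpha> - 1) * (1 - s) powr (\<beta> - 1) * \<phi>\<close>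
  of the equation, with \<open>\<phi>\<close> for the nonlinear term, is solved by \<open>w' = - flux \<phi>\<close> when \<open>w\<close> is regular at \<open>0\<close>.\<close>

definition flux :: "(real \<Rightarrow> real) \<Rightarrow> real \<Rightarrow> real" where
  "flux \<phi> s = \<mu> / \<alpha> * (1 - s) powr (- \<beta>) * avg \<alpha> (\<lambda>t. (1 - t) powr (\<beta> - 1) * \<phi> t) s"

text \<open>On \<open>{0..1/2}\<close> the outer weight is at most \<open>2 powr \<beta>\<close>, and the inner one at most \<open>2\<close> because \<open>\<beta> \<ge> 1/2\<close>.\<close>

definition flux_const :: real where "flux_const = \<mu> / \<alpha> * 2 powr \<beta> * 2"

lemma flux_const_pos: "flux_const > 0" using \<mu> \<alpha>_pos by (simp add: flux_const_def)

lemma weighted_continuous: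
  assumes "T \<le> 1 / 2" "continuous_on {0..T} \<phi>"
  shows "continuous_on {0..T::real} (\<lambda>t. (1 - t) powr b * \<phi> t)"
  using assms by (intro continuous_intros) auto

lemma flux_continuous:
  assumes T: "0 \<le> T" "T \<le> 1 / 2" and c: "continuous_on {0..T} \<phi>"
  shows "continuous_on {0..T} (flux \<phi>)"
  unfolding flux_def[abs_def]
  by (intro continuous_intros avg_continuous[OF \<alpha>_pos T(1)] weighted_continuous[OF T(2) c]) (use T in auto)

lemma flux_bound:
  assumes T: "0 \<le> T" "T \<le> 1 / 2" and c: "continuous_on {0..T} \<phi>" and s: "s \<in> {0..T}"
    and b: "\<And>t. t \<in> {0..s} \<Longrightarrow> \<bar>\<phi> t\<bar> \<le> M"
  shows "\<bar>flux \<phi> s\<bar> \<le> flux_const * M"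
proof -
  have M0: "M \<ge> 0" using b[of 0] s by auto
  have wt: "(1 - t) powr (\<beta> - 1) \<le> 2" if "t \<in> {0..s}" for t
  proof (cases "\<beta> \<ge> 1")
    case True
    have "(1 - t) powr (\<beta> - 1) \<le> 1 powr (\<beta> - 1)" using that s T True by (intro powr_mono2) auto
    then show ?thesis by simp
  next
    case False
    have "(1 - t) powr (\<beta> - 1) \<le> (1 / 2) powr (\<beta> - 1)" using that s T False by (intro powr_mono2') auto
    also have "\<dots> = 2 powr (1 - \<beta>)" by (simp add: powr_divide powr_minus_divide[symmetric])
    also have "\<dots> \<le> 2 powr 1" using \<beta> by (intro powr_mono) auto
    finally show ?thesis by simp
  qed
  have A: "\<bar>avg \<alpha> (\<lambda>t. (1 - t) powr (\<beta> - 1) * \<phi> t) s\<bar> \<le> 2 * M"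
  proof (rule avg_bound[OF \<alpha>_pos T(1) weighted_continuous[OF T(2) c] s])
    fix t assume t: "t \<in> {0..s}"
    show "\<bar>(1 - t) powr (\<beta> - 1) * \<phi> t\<bar> \<le> 2 * M"
      using wt[OF t] b[OF t] M0 unfolding abs_mult by (intro mult_mono) auto
  qed
  have "(1 - s) powr (- \<beta>) \<le> (1 / 2) powr (- \<beta>)" using s T \<beta> by (intro powr_mono2') auto
  also have "\<dots> = 2 powr \<beta>" by (simp add: powr_divide powr_minus_divide)
  finally have B: "(1 - s) powr (- \<beta>) \<le> 2 powr \<beta>" .
  have "\<bar>flux \<phi> s\<bar> = \<mu> / \<alpha> * ((1 - s) powr (- \<beta>) * \<bar>avg \<alpha> (\<lambda>t. (1 - t) powr (\<beta> - 1) * \<phi> t) s\<bar>)"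
    using \<mu> \<alpha>_pos by (simp add: flux_def abs_mult)
  also have "\<dots> \<le> \<mu> / \<alpha> * (2 powr \<beta> * (2 * M))"
    using A B \<mu> \<alpha>_pos by (intro mult_left_mono mult_mono) auto
  finally show ?thesis by (simp add: flux_const_def)
qed

lemma flux_cong:
  assumes s: "0 \<le> s" and eq: "\<And>t. t \<in> {0..s} \<Longrightarrow> \<phi> t = \<psi> t"
  shows "flux \<phi> s = flux \<psi> s"
  unfolding flux_def avg_def
  using eq node_le[OF \<alpha>_pos s s] by (intro arg_cong2[of _ _ _ _ "(*)"] refl integral_cong) auto

lemma flux_diff:
  assumes T: "0 \<le> T" "T \<le> 1 / 2" and c: "continuous_on {0..T} \<phi>" "continuous_on {0..T} \<psi>" and s: "s \<in> {0..T}"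
  shows "flux (\<lambda>t. \<phi> t - \<psi> t) s = flux \<phi> s - flux \<psi> s"
  using avg_diff[OF \<alpha>_pos T(1) weighted_continuous[OF T(2) c(1)] weighted_continuous[OF T(2) c(2)] s]
  by (simp add: flux_def right_diff_distrib)

lemma flux_integrable:
  assumes T: "0 \<le> T" "T \<le> 1 / 2" and c: "continuous_on {0..T} \<phi>" and s: "s \<in> {0..T}"
  shows "flux \<phi> integrable_on {0..s}"
  by (rule integrable_continuous_real, rule continuous_on_subset[OF flux_continuous[OF T c]]) (use s in auto)

text \<open>In the norm weighted by \<open>exp (- \<kappa> s)\<close> the integral operator gains a factor \<open>1 / \<kappa>\<close>, so it
  contracts for large \<open>\<kappa>\<close>; this gives both existence and Lipschitz dependence on the data.\<close>

lemma volterra_estimate: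
  assumes T: "0 \<le> T" "T \<le> 1 / 2" and h: "continuous_on UNIV h"
    and w: "continuous_on {0..T} w" and v: "continuous_on {0..T} v"
    and L: "L \<ge> 0" and D: "D \<ge> 0" and \<kappa>: "\<kappa> > 0"
    and lip: "\<And>t. t \<in> {0..T} \<Longrightarrow> \<bar>h (w t) - h (v t)\<bar> \<le> L * \<bar>w t - v t\<bar>"
    and wv: "\<And>t. t \<in> {0..T} \<Longrightarrow> \<bar>w t - v t\<bar> \<le> D * exp (\<kappa> * t)"
    and s: "s \<in> {0..T}"
  shows "\<bar>integral {0..s} (flux (\<lambda>t. h (w t))) - integral {0..s} (flux (\<lambda>t. h (v t)))\<bar>
    \<le> flux_const * L * D / \<kappa> * exp (\<kappa> * s)"
proof -
  have hw: "continuous_on {0..T} (\<lambda>t. h (w t))" "continuous_on {0..T} (\<lambda>t. h (v t))"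
    by (rule continuous_on_compose2[OF h w] continuous_on_compose2[OF h v]; simp)+
  let ?f = "\<lambda>r. flux (\<lambda>t. h (w t)) r - flux (\<lambda>t. h (v t)) r"
  have fb: "\<bar>?f r\<bar> \<le> flux_const * L * D * exp (\<kappa> * r)" if r: "r \<in> {0..T}" for r
  proof -
    have "\<bar>flux (\<lambda>t. h (w t) - h (v t)) r\<bar> \<le> flux_const * (L * (D * exp (\<kappa> * r)))"
    proof (rule flux_bound[OF T _ r])
      show "continuous_on {0..T} (\<lambda>t. h (w t) - h (v t))" by (intro continuous_intros hw)
      fix t assume t: "t \<in> {0..r}"
      have "\<bar>h (w t) - h (v t)\<bar> \<le> L * \<bar>w t - v t\<bar>" using lip t r by auto
      also have "\<dots> \<le> L * (D * exp (\<kappa> * t))" using wv[of t] t r L by (intro mult_left_mono) auto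
      also have "\<dots> \<le> L * (D * exp (\<kappa> * r))" using t \<kappa> L D by (intro mult_left_mono) auto
      finally show "\<bar>h (w t) - h (v t)\<bar> \<le> L * (D * exp (\<kappa> * r))" .
    qed
    then show ?thesis using flux_diff[OF T hw r] by (simp add: mult.assoc)
  qed
  have int: "((\<lambda>r. flux_const * L * D * exp (\<kappa> * r)) has_integral
      (flux_const * L * D / \<kappa> * exp (\<kappa> * s) - flux_const * L * D / \<kappa> * exp (\<kappa> * 0))) {0..s}"
    by (rule fundamental_theorem_of_calculus)
      (use s \<kappa> in \<open>auto simp: has_real_derivative_iff_has_vector_derivative[symmetric] intro!: derivative_eq_intros\<close>)
  have "integral {0..s} (flux (\<lambda>t. h (w t))) - integral {0..s} (flux (\<lambda>t. h (v t))) = integral {0..s} ?f"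
    by (rule integral_diff[symmetric]; rule flux_integrable[OF T _ s]; rule hw)
  also have "norm (integral {0..s} ?f) \<le> integral {0..s} (\<lambda>r. flux_const * L * D * exp (\<kappa> * r))"
  proof (rule integral_norm_bound_integral)
    show "?f integrable_on {0..s}"
      by (intro integrable_diff flux_integrable[OF T _ s] hw)
    show "(\<lambda>r. flux_const * L * D * exp (\<kappa> * r)) integrable_on {0..s}" using int by blast
    show "norm (?f r) \<le> flux_const * L * D * exp (\<kappa> * r)" if "r \<in> {0..s}" for r
      using fb[of r] that s by simp
  qed
  also have "\<dots> \<le> flux_const * L * D / \<kappa> * exp (\<kappa> * s)"
    unfolding integral_unique[OF int] using flux_const_pos L D \<kappa> by simp
  finally show ?thesis by simp
qed

lemma lipschitz_fixed_point:
  assumes h: "continuous_on UNIV h" and L: "L \<ge> 0" and lip: "\<And>a b. \<bar>h a - h b\<bar> \<le> L * \<bar>a - b\<bar>"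
  shows "\<exists>w. continuous_on {0..1/2} w \<and>
    (\<forall>s\<in>{0..1/2}. w s = d - integral {0..s} (flux (\<lambda>t. h (w t))))"
proof -
  define \<kappa> where "\<kappa> = 2 * flux_const * L + 1"
  have \<kappa>: "\<kappa> > 0" using flux_const_pos L by (simp add: \<kappa>_def add_nonneg_pos)
  have half: "flux_const * L / \<kappa> \<le> 1 / 2" using \<kappa> by (simp add: \<kappa>_def field_simps)
  \<comment> \<open>The unknown is \<open>v = exp (- \<kappa> s) w\<close>, so that the weighted norm becomes the supremum norm.\<close>
  define W where "W v t = exp (\<kappa> * t) * apply_bcontfun v t" for v :: "real \<Rightarrow>\<^sub>C real" and t
  have Wc: "continuous_on A (W v)" for A v
    unfolding W_def[abs_def] by (intro continuous_intros continuous_on_subset[OF continuous_on_apply_bcontfun]) auto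
  define A where "A v s = exp (- \<kappa> * s) * (d - integral {0..s} (flux (\<lambda>t. h (W v t))))" for v s
  have T: "(0::real) \<le> 1/2" "(1/2::real) \<le> 1/2" by auto
  have hWc: "continuous_on {0..1/2} (\<lambda>t. h (W v t))" for v
    by (rule continuous_on_compose2[OF h Wc]) simp
  have Ac: "continuous_on {0..1/2} (A v)" for v
    unfolding A_def[abs_def]
    by (intro continuous_intros indefinite_integral_continuous_1 flux_integrable[OF T hWc]) auto
  \<comment> \<open>Clipping the argument turns functions on \<open>{0..1/2}\<close> into bounded continuous functions on the line.\<close>
  define clip where "clip s = max 0 (min (1/2) s)" for s :: real
  have clip: "clip s \<in> {0..1/2}" for s by (simp add: clip_def)
  have clip_id: "s \<in> {0..1/2} \<Longrightarrow> clip s = s" for s by (auto simp: clip_def)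
  have clipc: "continuous_on UNIV clip" unfolding clip_def[abs_def] by (intro continuous_intros)
  define S where "S v = Bcontfun (\<lambda>s. A v (clip s))" for v
  have Sapp: "apply_bcontfun (S v) s = A v (clip s)" for v s
  proof -
    have "continuous_on UNIV (\<lambda>s. A v (clip s))"
      by (rule continuous_on_compose2[OF Ac clipc]) (use clip in auto)
    moreover have "bounded (range (\<lambda>s. A v (clip s)))"
      by (rule bounded_subset[OF compact_imp_bounded[OF compact_continuous_image[OF Ac compact_Icc]]]) (use clip in auto)
    ultimately have "(\<lambda>s. A v (clip s)) \<in> bcontfun" by (simp add: bcontfun_def)
    then show ?thesis unfolding S_def by (simp add: Bcontfun_inverse)
  qed
  have "\<exists>!v. S v = v"
  proof (rule banach_fix_type)
    show "\<forall>v v'. dist (S v) (S v') \<le> 1/2 * dist v v'"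
    proof (intro allI dist_bound)
      fix v v' and s
      let ?c = "clip s"
      have "\<bar>integral {0..?c} (flux (\<lambda>t. h (W v t))) - integral {0..?c} (flux (\<lambda>t. h (W v' t)))\<bar>
          \<le> flux_const * L * dist v v' / \<kappa> * exp (\<kappa> * ?c)"
      proof (rule volterra_estimate[OF T h Wc Wc L _ \<kappa> lip _ clip])
        fix t :: real
        have "\<bar>W v t - W v' t\<bar> = exp (\<kappa> * t) * dist (v t) (v' t)"
          by (simp add: W_def right_diff_distrib[symmetric] abs_mult dist_real_def)
        also have "\<dots> \<le> exp (\<kappa> * t) * dist v v'" by (intro mult_left_mono dist_bounded) auto
        finally show "\<bar>W v t - W v' t\<bar> \<le> dist v v' * exp (\<kappa> * t)" by (simp add: mult.commute)
      qed simp
      then have "exp (- \<kappa> * ?c) * \<bar>integral {0..?c} (flux (\<lambda>t. h (W v t))) - integral {0..?c} (flux (\<lambda>t. h (W v' t)))\<bar>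
          \<le> exp (- \<kappa> * ?c) * (flux_const * L * dist v v' / \<kappa> * exp (\<kappa> * ?c))"
        by (intro mult_left_mono) auto
      also have "\<dots> = flux_const * L / \<kappa> * dist v v'" by (simp add: exp_minus)
      also have "\<dots> \<le> 1/2 * dist v v'" by (intro mult_right_mono half) auto
      finally show "dist (apply_bcontfun (S v) s) (apply_bcontfun (S v') s) \<le> 1/2 * dist v v'"
        unfolding Sapp A_def dist_real_def right_diff_distrib[symmetric] abs_mult
        by (simp add: abs_minus_commute)
    qed
  qed auto
  then obtain v where v: "S v = v" by blast
  show ?thesis
  proof (intro exI[of _ "W v"] conjI ballI)
    show "continuous_on {0..1/2} (W v)" by (rule Wc)
    fix s :: real assume s: "s \<in> {0..1/2}"
    have "apply_bcontfun v s = A v s" using Sapp[of v s] v clip_id[OF s] by simp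
    then have "W v s = exp (\<kappa> * s) * (exp (- \<kappa> * s) * (d - integral {0..s} (flux (\<lambda>t. h (W v t)))))"
      by (simp add: W_def[of v s] A_def)
    then have "W v s = (exp (\<kappa> * s) * exp (- \<kappa> * s)) * (d - integral {0..s} (flux (\<lambda>t. h (W v t))))"
      by (simp only: mult.assoc)
    then show "W v s = d - integral {0..s} (flux (\<lambda>t. h (W v t)))"
      by (simp add: exp_minus)
  qed
qed

definition integral_solution :: "real \<Rightarrow> real \<Rightarrow> (real \<Rightarrow> real) \<Rightarrow> bool" where
  "integral_solution T d w \<longleftrightarrow> continuous_on {0..T} w \<and>
     (\<forall>s\<in>{0..T}. w s = d - integral {0..s} (flux (\<lambda>t. nonlin p (w t))))"

definition solution :: "real \<Rightarrow> (real \<Rightarrow> real) \<Rightarrow> (real \<Rightarrow> real) \<Rightarrow> (real \<Rightarrow> real) \<Rightarrow> bool" where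
  "solution T w w1 w2 \<longleftrightarrow>
     (\<forall>s\<in>{0..T}. (w has_real_derivative w1 s) (at s within {0..T}) \<and>
        (w1 has_real_derivative w2 s) (at s within {0..T}) \<and>
        s * (1 - s) * w2 s + (\<alpha> * (1 - s) - \<beta> * s) * w1 s + \<mu> * nonlin p (w s) = 0) \<and>
     continuous_on {0..T} w2"

text \<open>The average in the flux is as smooth as its argument, so \<open>w\<close> is twice continuously differentiable up to the
  singular point, and the singular first order equation for the average becomes the equation for \<open>w\<close>.\<close>

lemma integral_solution_imp_solution:
  assumes T: "0 \<le> T" "T \<le> 1 / 2" and w: "integral_solution T d w"
  shows "\<exists>w2. solution T w (\<lambda>s. - flux (\<lambda>t. nonlin p (w t)) s) w2"
proof -
  let ?\<phi> = "\<lambda>t. nonlin p (w t)"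
  have wc: "continuous_on {0..T} w" and weq: "\<And>s. s \<in> {0..T} \<Longrightarrow> w s = d - integral {0..s} (flux ?\<phi>)"
    using w by (auto simp: integral_solution_def)
  have \<phi>c: "continuous_on {0..T} ?\<phi>"
    by (rule continuous_on_compose2[OF nonlin_continuous[OF p, of UNIV] wc]) simp
  have fc: "continuous_on {0..T} (flux ?\<phi>)" by (rule flux_continuous[OF T \<phi>c])
  have w1: "(w has_real_derivative - flux ?\<phi> s) (at s within {0..T})" if s: "s \<in> {0..T}" for s
  proof -
    have "((\<lambda>u. integral {0..u} (flux ?\<phi>)) has_real_derivative flux ?\<phi> s) (at s within {0..T})"
      using integral_has_vector_derivative[OF fc s] by (simp add: has_real_derivative_iff_has_vector_derivative)
    from DERIV_diff[OF DERIV_const[of d] this]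
    have "((\<lambda>u. d - integral {0..u} (flux ?\<phi>)) has_real_derivative - flux ?\<phi> s) (at s within {0..T})" by simp
    then show ?thesis
      by (rule has_field_derivative_transform_within[OF _ zero_less_one s]) (use weq in auto)
  qed
  define \<psi> where "\<psi> t = (1 - t) powr (\<beta> - 1) * ?\<phi> t" for t
  define \<psi>' where "\<psi>' t = - (\<beta> - 1) * (1 - t) powr (\<beta> - 1 - 1) * ?\<phi> t
      + (p * \<bar>w t\<bar> powr (p - 1) - 1) * (- flux ?\<phi> t) * (1 - t) powr (\<beta> - 1)" for t
  have \<psi>d: "(\<psi> has_real_derivative \<psi>' t) (at t within {0..T})" if t: "t \<in> {0..T}" for t
  proof -
    have N: "(?\<phi> has_real_derivative (p * \<bar>w t\<bar> powr (p - 1) - 1) * (- flux ?\<phi> t)) (at t within {0..T})"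
      using DERIV_image_chain[OF nonlin_has_derivative[OF p] w1[OF t]] by (simp add: o_def)
    have t1: "t < 1" using t T by simp
    show ?thesis
      unfolding \<psi>_def[abs_def] \<psi>'_def
      by (rule DERIV_mult[OF one_minus_powr_deriv[OF t1] N])
  qed
  have \<psi>'c: "continuous_on {0..T} \<psi>'"
    unfolding \<psi>'_def[abs_def] using T p by (intro continuous_intros \<phi>c fc wc continuous_on_powr') auto
  obtain A' where A': "continuous_on {0..T} A'"
    "\<And>s. s \<in> {0..T} \<Longrightarrow> (avg \<alpha> \<psi> has_real_derivative A' s) (at s within {0..T})"
    "\<And>s. s \<in> {0..T} \<Longrightarrow> s * A' s = \<alpha> * (\<psi> s - avg \<alpha> \<psi> s)"
    using avg_deriv[OF \<alpha>_pos T(1) \<psi>d \<psi>'c] by blast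
  have flux: "flux ?\<phi> s = \<mu> / \<alpha> * (1 - s) powr (- \<beta>) * avg \<alpha> \<psi> s" for s
    unfolding flux_def \<psi>_def ..
  define w2 where "w2 s = - (\<mu> / \<alpha>) * (\<beta> * (1 - s) powr (- \<beta> - 1) * avg \<alpha> \<psi> s + (1 - s) powr (- \<beta>) * A' s)" for s
  have "((\<lambda>s. - flux ?\<phi> s) has_real_derivative w2 s) (at s within {0..T})" if s: "s \<in> {0..T}" for s
  proof -
    have s1: "s < 1" using s T by simp
    show ?thesis
      unfolding flux w2_def mult.assoc
      by (rule DERIV_cong[OF DERIV_minus[OF DERIV_cmult[OF DERIV_mult[OF one_minus_powr_deriv[OF s1] A'(2)[OF s]]]]])
        (simp add: algebra_simps)
  qed
  moreover have "s * (1 - s) * w2 s + (\<alpha> * (1 - s) - \<beta> * s) * (- flux ?\<phi> s) + \<mu> * ?\<phi> s = 0" if s: "s \<in> {0..T}" for s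
  proof -
    have pos: "1 - s > 0" using s T by simp
    define Q where "Q = (1 - s) powr (- \<beta>)"
    have Q1: "(1 - s) * (1 - s) powr (- \<beta> - 1) = Q"
      using pos by (simp add: Q_def powr_diff)
    have Q2: "(1 - s) * Q * \<psi> s = ?\<phi> s"
    proof -
      have "(1 - s) * Q * (1 - s) powr (\<beta> - 1) = 1"
        using pos by (simp add: Q_def powr_diff powr_minus field_simps)
      then show ?thesis by (simp add: \<psi>_def algebra_simps)
    qed
    have "s * (1 - s) * w2 s = - (\<mu> / \<alpha>) * (\<beta> * s * ((1 - s) * (1 - s) powr (- \<beta> - 1)) * avg \<alpha> \<psi> s + (1 - s) * Q * (s * A' s))"
      by (simp add: w2_def Q_def algebra_simps add_divide_distrib diff_divide_distrib)
    also have "\<dots> = - (\<mu> / \<alpha>) * (\<beta> * s * Q * avg \<alpha> \<psi> s + (1 - s) * Q * (\<alpha> * (\<psi> s - avg \<alpha> \<psi> s)))"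
      unfolding Q1 A'(3)[OF s] ..
    also have "\<dots> = - (\<mu> / \<alpha>) * (\<beta> * s * Q * avg \<alpha> \<psi> s - \<alpha> * (1 - s) * Q * avg \<alpha> \<psi> s) - (\<mu> / \<alpha>) * \<alpha> * ((1 - s) * Q * \<psi> s)"
      by (simp add: algebra_simps)
    also have "\<dots> = - (\<beta> * s - \<alpha> * (1 - s)) * flux ?\<phi> s - \<mu> * ?\<phi> s"
      unfolding Q2 flux Q_def[symmetric] using \<alpha>_pos
      by (simp add: algebra_simps add_divide_distrib diff_divide_distrib)
    finally show ?thesis by (simp add: algebra_simps)
  qed
  moreover have "continuous_on {0..T} w2"
  proof -
    have "continuous_on {0..T} (avg \<alpha> \<psi>)" by (rule DERIV_continuous_on[OF A'(2)])
    then show ?thesis unfolding w2_def[abs_def] using T by (intro continuous_intros A'(1)) auto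
  qed
  ultimately show ?thesis unfolding solution_def using w1 by blast
qed

subsection \<open>The energy\<close>

text \<open>The additive constant makes the energy nonnegative.\<close>

definition energy :: "(real \<Rightarrow> real) \<Rightarrow> (real \<Rightarrow> real) \<Rightarrow> real \<Rightarrow> real" where
  "energy w w1 s = s * (1 - s) * (w1 s)\<^sup>2 / 2 + \<mu> * potential p (w s) + \<mu> / 2"

lemma energy_ge_kinetic: "s * (1 - s) * (w1 s)\<^sup>2 / 2 \<le> energy w w1 s"
  using mult_left_mono[OF potential_lower[OF p, of "w s"], of \<mu>] \<mu> by (simp add: energy_def)

lemma energy_ge_potential: "s \<in> {0..1} \<Longrightarrow> \<mu> * potential p (w s) + \<mu> / 2 \<le> energy w w1 s"
  by (simp add: energy_def)

lemma energy_nonneg: "s \<in> {0..1} \<Longrightarrow> 0 \<le> energy w w1 s"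
  by (rule order_trans[OF _ energy_ge_kinetic]) auto

lemma solution_derivs:
  assumes "solution T w w1 w2" "s \<in> {0..T}"
  shows "(w has_real_derivative w1 s) (at s within {0..T})"
    "(w1 has_real_derivative w2 s) (at s within {0..T})"
    "s * (1 - s) * w2 s = - (\<alpha> * (1 - s) - \<beta> * s) * w1 s - \<mu> * nonlin p (w s)"
  using assms by (auto simp: solution_def algebra_simps)

lemma solution_continuous:
  assumes "solution T w w1 w2"
  shows "continuous_on {0..T} w" "continuous_on {0..T} w1" "continuous_on {0..T} w2"
proof -
  show "continuous_on {0..T} w" by (rule DERIV_continuous_on[OF solution_derivs(1)[OF assms]])
  show "continuous_on {0..T} w1" by (rule DERIV_continuous_on[OF solution_derivs(2)[OF assms]])
  show "continuous_on {0..T} w2" using assms by (simp add: solution_def)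
qed

lemma energy_deriv:
  assumes w: "solution T w w1 w2" and s: "s \<in> {0..T}"
  shows "(energy w w1 has_real_derivative ((1/2 - \<alpha>) * (1 - s) + (\<beta> - 1/2) * s) * (w1 s)\<^sup>2) (at s within {0..T})"
proof -
  note d = solution_derivs[OF w s]
  have P: "((\<lambda>s. potential p (w s)) has_real_derivative nonlin p (w s) * w1 s) (at s within {0..T})"
    using DERIV_image_chain[OF potential_has_derivative[OF p] d(1)] by (simp add: o_def)
  have A: "((\<lambda>s. s * (1 - s)) has_real_derivative 1 - 2 * s) (at s within {0..T})"
    by (auto intro!: derivative_eq_intros)
  have B: "((\<lambda>s. (w1 s)\<^sup>2 / 2) has_real_derivative w1 s * w2 s) (at s within {0..T})"
    by (auto intro!: derivative_eq_intros d)
  have E: "energy w w1 = (\<lambda>s. s * (1 - s) * ((w1 s)\<^sup>2 / 2) + \<mu> * potential p (w s) + \<mu> / 2)"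
    by (rule ext) (simp add: energy_def)
  have "(energy w w1 has_real_derivative
      ((1 - 2 * s) * ((w1 s)\<^sup>2 / 2) + (s * (1 - s) * w2 s) * w1 s + \<mu> * (nonlin p (w s) * w1 s))) (at s within {0..T})"
    unfolding E
    by (rule DERIV_cong[OF DERIV_add[OF DERIV_add[OF DERIV_mult[OF A B] DERIV_cmult[OF P]] DERIV_const]])
      (simp add: algebra_simps)
  moreover have "(1 - 2 * s) * ((w1 s)\<^sup>2 / 2) + (s * (1 - s) * w2 s) * w1 s + \<mu> * (nonlin p (w s) * w1 s)
      = ((1/2 - \<alpha>) * (1 - s) + (\<beta> - 1/2) * s) * (w1 s)\<^sup>2"
    unfolding d(3) by (simp add: power2_eq_square algebra_simps add_divide_distrib diff_divide_distrib)
  ultimately show ?thesis by simp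
qed

text \<open>The energy can only be increased by the term with \<open>\<beta>\<close>, which is regular on \<open>{0..1/2}\<close>.\<close>

lemma energy_growth:
  assumes T: "T \<le> 1 / 2" and w: "solution T w w1 w2" and st: "0 \<le> s" "s \<le> t" "t \<le> T"
  shows "energy w w1 t \<le> exp (2 * \<beta>) * energy w w1 s"
proof -
  define b where "b = 4 * (\<beta> - 1/2)"
  have b0: "b \<ge> 0" using \<beta> by (simp add: b_def)
  have der: "((\<lambda>r. - (energy w w1 r * exp (- b * r))) has_real_derivative
      (b * energy w w1 r - ((1/2 - \<alpha>) * (1 - r) + (\<beta> - 1/2) * r) * (w1 r)\<^sup>2) * exp (- b * r)) (at r within {0..T})"
    if "r \<in> {0..T}" for r
    by (auto intro!: derivative_eq_intros energy_deriv[OF w that] simp: algebra_simps)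
  have "- (energy w w1 s * exp (- b * s)) \<le> - (energy w w1 t * exp (- b * t))"
  proof (rule mono_of_deriv_within[OF der])
    fix r assume r: "0 < r" "r < T"
    have "r / 4 * (w1 r)\<^sup>2 \<le> r * (1 - r) * (w1 r)\<^sup>2 / 2"
    proof -
      have "r * (1/2) * (w1 r)\<^sup>2 \<le> r * (1 - r) * (w1 r)\<^sup>2"
        using r T by (intro mult_right_mono mult_left_mono) auto
      then show ?thesis by simp
    qed
    also have "\<dots> \<le> energy w w1 r" by (rule energy_ge_kinetic)
    finally have "b * (r / 4 * (w1 r)\<^sup>2) \<le> b * energy w w1 r" using b0 by (intro mult_left_mono)
    moreover have "b * (r / 4 * (w1 r)\<^sup>2) = (\<beta> - 1/2) * r * (w1 r)\<^sup>2" by (simp add: b_def)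
    moreover have "((1/2 - \<alpha>) * (1 - r)) * (w1 r)\<^sup>2 \<le> 0"
      using \<alpha> r T by (intro mult_nonpos_nonneg) (auto simp: mult_nonpos_nonneg)
    moreover have "((1/2 - \<alpha>) * (1 - r) + (\<beta> - 1/2) * r) * (w1 r)\<^sup>2
        = ((1/2 - \<alpha>) * (1 - r)) * (w1 r)\<^sup>2 + (\<beta> - 1/2) * r * (w1 r)\<^sup>2" by (rule distrib_right)
    ultimately have "0 \<le> b * energy w w1 r - ((1/2 - \<alpha>) * (1 - r) + (\<beta> - 1/2) * r) * (w1 r)\<^sup>2" by linarith
    then show "0 \<le> (b * energy w w1 r - ((1/2 - \<alpha>) * (1 - r) + (\<beta> - 1/2) * r) * (w1 r)\<^sup>2) * exp (- b * r)"
      by (rule mult_nonneg_nonneg) simp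
  qed (use st in auto)
  then have "energy w w1 t * exp (- b * t) * exp (b * t) \<le> energy w w1 s * exp (- b * s) * exp (b * t)"
    by (intro mult_right_mono) auto
  also have "\<dots> = energy w w1 s * exp (b * (t - s))" by (simp add: mult.assoc exp_add[symmetric] algebra_simps)
  also have "\<dots> \<le> energy w w1 s * exp (2 * \<beta>)"
  proof (intro mult_left_mono energy_nonneg)
    have "b * (t - s) \<le> b * (1/2)" using st T b0 by (intro mult_left_mono) auto
    also have "\<dots> \<le> 2 * \<beta>" by (simp add: b_def)
    finally show "exp (b * (t - s)) \<le> exp (2 * \<beta>)" by simp
  qed (use st T in auto)
  moreover have "energy w w1 t * exp (- b * t) * exp (b * t) = energy w w1 t"
    by (simp add: mult.assoc exp_minus)
  ultimately have "energy w w1 t \<le> energy w w1 s * exp (2 * \<beta>)" by linarith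
  then show ?thesis by (simp add: mult.commute)
qed

text \<open>At \<open>s = 0\<close> the kinetic part of the energy vanishes, so the initial value alone controls the energy.\<close>

lemma solution_bound:
  obtains A B where "A \<ge> 0" "B \<ge> 0"
    "\<And>T w w1 w2 s. T \<le> 1/2 \<Longrightarrow> solution T w w1 w2 \<Longrightarrow> s \<in> {0..T} \<Longrightarrow>
       \<bar>w s\<bar> powr (p + 1) \<le> A * \<bar>w 0\<bar> powr (p + 1) + B"
proof -
  obtain C where C: "C \<ge> 0" "\<And>w. \<bar>w\<bar> powr (p + 1) \<le> 2 * (p + 1) * potential p w + C"
    using powr_le_potential[OF p] by blast
  let ?e = "exp (2 * \<beta>)"
  show ?thesis
  proof
    show "0 \<le> 2 * ?e" "0 \<le> C + (p + 1) * ?e" using C p by auto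
    fix T w w1 w2 s assume T: "T \<le> 1/2" and w: "solution T w w1 w2" and s: "s \<in> {0..T}"
    have "\<mu> * potential p (w s) \<le> energy w w1 s" using energy_ge_potential[of s w w1] s T \<mu> by auto
    also have "\<dots> \<le> ?e * energy w w1 0" by (rule energy_growth[OF T w]) (use s in auto)
    also have "\<dots> = \<mu> * (?e * (potential p (w 0) + 1/2))" by (simp add: energy_def algebra_simps)
    finally have "potential p (w s) \<le> ?e * (potential p (w 0) + 1/2)" using \<mu> by simp
    also have "\<dots> \<le> ?e * (\<bar>w 0\<bar> powr (p + 1) / (p + 1) + 1/2)" by (intro mult_left_mono) (auto simp: potential_def)
    finally have "2 * (p + 1) * potential p (w s) \<le> 2 * (p + 1) * (?e * (\<bar>w 0\<bar> powr (p + 1) / (p + 1) + 1/2))"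
      using p by (intro mult_left_mono) auto
    also have "\<dots> = 2 * ?e * \<bar>w 0\<bar> powr (p + 1) + (p + 1) * ?e" using p by (simp add: field_simps)
    finally show "\<bar>w s\<bar> powr (p + 1) \<le> 2 * ?e * \<bar>w 0\<bar> powr (p + 1) + (C + (p + 1) * ?e)"
      using C(2)[of "w s"] by linarith
  qed
qed

text \<open>Outside a large interval the nonlinearity may be cut off: the energy bound keeps the solution of
  the modified problem away from the region where it was changed.\<close>

lemma integral_solution_exists:
  shows "\<exists>w. integral_solution (1/2) d w"
proof -
  obtain A B where AB: "A \<ge> 0" "B \<ge> 0"
    "\<And>T w w1 w2 s. T \<le> 1/2 \<Longrightarrow> solution T w w1 w2 \<Longrightarrow> s \<in> {0..T} \<Longrightarrow>
       \<bar>w s\<bar> powr (p + 1) \<le> A * \<bar>w 0\<bar> powr (p + 1) + B"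
    using solution_bound by blast
  define M where "M = A * \<bar>d\<bar> powr (p + 1) + B + 1"
  have M0: "M > 0" unfolding M_def using AB by (simp add: add_nonneg_pos)
  define R where "R = max (\<bar>d\<bar> + 1) (M powr (1 / (p + 1)))"
  have R: "\<bar>d\<bar> < R" "R > 0" by (auto simp: R_def)
  have "M = (M powr (1 / (p + 1))) powr (p + 1)" using M0 p by (simp add: powr_powr)
  also have "\<dots> \<le> R powr (p + 1)" using p by (intro powr_mono2) (auto simp: R_def)
  finally have MR: "M \<le> R powr (p + 1)" .
  define cut where "cut x = max (- R) (min R x)" for x
  have cut: "\<bar>cut x\<bar> \<le> R" "\<bar>cut x - cut y\<bar> \<le> \<bar>x - y\<bar>" for x y using R by (auto simp: cut_def)
  have cut_id: "\<bar>x\<bar> \<le> R \<Longrightarrow> cut x = x" for x by (auto simp: cut_def)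
  let ?h = "\<lambda>x. nonlin p (cut x)" and ?L = "p * R powr (p - 1) + 1"
  have L0: "0 \<le> ?L" using p by (simp add: add_nonneg_nonneg)
  have hc: "continuous_on UNIV ?h"
    by (rule continuous_on_compose2[OF nonlin_continuous[OF p, of UNIV]]) (auto simp: cut_def[abs_def] intro!: continuous_intros)
  have hl: "\<bar>?h a - ?h b\<bar> \<le> ?L * \<bar>a - b\<bar>" for a b
  proof -
    have "\<bar>?h a - ?h b\<bar> \<le> ?L * \<bar>cut a - cut b\<bar>" by (rule nonlin_lipschitz[OF p cut(1) cut(1)])
    also have "\<dots> \<le> ?L * \<bar>a - b\<bar>" by (intro mult_left_mono cut L0)
    finally show ?thesis .
  qed
  obtain w where w: "continuous_on {0..1/2} w"
    "\<And>s. s \<in> {0..1/2} \<Longrightarrow> w s = d - integral {0..s} (flux (\<lambda>t. ?h (w t)))"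
    using lipschitz_fixed_point[OF hc L0 hl, of d] by blast
  have w0: "w 0 = d" using w(2)[of 0] by simp
  have sol: "integral_solution T d w" if T: "T \<in> {0..1/2}" and small: "\<And>t. t \<in> {0..T} \<Longrightarrow> \<bar>w t\<bar> \<le> R" for T
    unfolding integral_solution_def
  proof (intro conjI ballI)
    show "continuous_on {0..T} w" by (rule continuous_on_subset[OF w(1)]) (use T in auto)
    fix s assume s: "s \<in> {0..T}"
    have "integral {0..s} (flux (\<lambda>t. ?h (w t))) = integral {0..s} (flux (\<lambda>t. nonlin p (w t)))"
      by (intro integral_cong flux_cong) (use small cut_id s in auto)
    then show "w s = d - integral {0..s} (flux (\<lambda>t. nonlin p (w t)))" using w(2)[of s] s T by auto
  qed
  have "\<bar>w t\<bar> < R" if t: "t \<in> {0..1/2}" for t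
  proof (rule ccontr)
    assume "\<not> \<bar>w t\<bar> < R"
    moreover have "continuous_on {0..t} (\<lambda>t. \<bar>w t\<bar>)"
      by (intro continuous_intros continuous_on_subset[OF w(1)]) (use t in auto)
    ultimately obtain s where s: "0 < s" "s \<le> t" "\<bar>w s\<bar> = R" "\<And>r. 0 \<le> r \<Longrightarrow> r < s \<Longrightarrow> \<bar>w r\<bar> < R"
      using first_hit[of 0 t "\<lambda>t. \<bar>w t\<bar>" R] t R w0 by auto
    have "\<bar>w r\<bar> \<le> R" if "r \<in> {0..s}" for r
      using s(3) s(4)[of r] that by (cases "r = s") auto
    then have "integral_solution s d w" using sol[of s] s t by auto
    then obtain w2 where "solution s w (\<lambda>s. - flux (\<lambda>t. nonlin p (w t)) s) w2"
      using integral_solution_imp_solution[of s d w] s t by auto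
    then have "\<bar>w s\<bar> powr (p + 1) \<le> A * \<bar>w 0\<bar> powr (p + 1) + B" by (rule AB(3)[rotated]) (use s t in auto)
    then show False using MR s(3) w0 by (simp add: M_def)
  qed
  then have "integral_solution (1/2) d w" by (intro sol) (auto intro: less_imp_le)
  then show ?thesis by blast
qed

text \<open>The contraction estimate, applied at the point where the weighted difference is largest.\<close>

lemma integral_solution_lipschitz:
  assumes w: "integral_solution (1/2) d w" and v: "integral_solution (1/2) e v"
    and bw: "\<And>t. t \<in> {0..1/2} \<Longrightarrow> \<bar>w t\<bar> \<le> R" and bv: "\<And>t. t \<in> {0..1/2} \<Longrightarrow> \<bar>v t\<bar> \<le> R"
    and s: "s \<in> {0..1/2}"
  shows "\<bar>w s - v s\<bar> \<le> 2 * exp (flux_const * (p * R powr (p - 1) + 1) + 1) * \<bar>d - e\<bar>"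
proof -
  define L where "L = p * R powr (p - 1) + 1"
  have L0: "L \<ge> 0" using p by (simp add: L_def add_nonneg_nonneg)
  define \<kappa> where "\<kappa> = 2 * flux_const * L + 1"
  have \<kappa>: "\<kappa> > 0" using flux_const_pos L0 by (simp add: \<kappa>_def add_nonneg_pos)
  have half: "flux_const * L / \<kappa> \<le> 1 / 2" using \<kappa> by (simp add: \<kappa>_def field_simps)
  have T: "(0::real) \<le> 1/2" "(1/2::real) \<le> 1/2" by auto
  have c: "continuous_on {0..1/2} w" "continuous_on {0..1/2} v" using w v by (auto simp: integral_solution_def)
  let ?q = "\<lambda>t. exp (- \<kappa> * t) * \<bar>w t - v t\<bar>"
  have "continuous_on {0..1/2} ?q" by (intro continuous_intros c)
  then obtain m where m: "m \<in> {0..1/2}" "\<And>t. t \<in> {0..1/2} \<Longrightarrow> ?q t \<le> ?q m"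
    using continuous_attains_sup[of "{0..1/2}" ?q] by auto
  have wv: "\<bar>w t - v t\<bar> \<le> ?q m * exp (\<kappa> * t)" if "t \<in> {0..1/2}" for t
  proof -
    have "?q t * exp (\<kappa> * t) \<le> ?q m * exp (\<kappa> * t)" by (intro mult_right_mono m that) auto
    then show ?thesis by (simp add: exp_minus field_simps)
  qed
  let ?I = "\<lambda>u. integral {0..m} (flux (\<lambda>t. nonlin p (u t)))"
  have "\<bar>?I w - ?I v\<bar> \<le> flux_const * L * ?q m / \<kappa> * exp (\<kappa> * m)"
    by (rule volterra_estimate[OF T nonlin_continuous[OF p] c L0 _ \<kappa> _ wv m(1)])
      (auto simp: L_def intro!: nonlin_lipschitz[OF p] bw bv)
  moreover have "\<bar>w m - v m\<bar> \<le> \<bar>d - e\<bar> + \<bar>?I w - ?I v\<bar>"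
    using w v m(1) by (auto simp: integral_solution_def)
  ultimately have "exp (- \<kappa> * m) * \<bar>w m - v m\<bar> \<le> exp (- \<kappa> * m) * (\<bar>d - e\<bar> + flux_const * L * ?q m / \<kappa> * exp (\<kappa> * m))"
    by (intro mult_left_mono) auto
  also have "\<dots> = exp (- \<kappa> * m) * \<bar>d - e\<bar> + flux_const * L / \<kappa> * ?q m"
    by (simp add: distrib_left exp_minus)
  also have "\<dots> \<le> 1 * \<bar>d - e\<bar> + 1/2 * ?q m"
  proof -
    have "exp (- \<kappa> * m) * \<bar>d - e\<bar> \<le> 1 * \<bar>d - e\<bar>" using \<kappa> m(1) by (intro mult_right_mono) auto
    moreover have "flux_const * L / \<kappa> * ?q m \<le> 1/2 * ?q m" by (intro mult_right_mono half) auto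
    ultimately show ?thesis by linarith
  qed
  finally have q: "?q m \<le> 2 * \<bar>d - e\<bar>" by linarith
  have "\<bar>w s - v s\<bar> \<le> ?q m * exp (\<kappa> * s)" by (rule wv[OF s])
  also have "\<dots> \<le> 2 * \<bar>d - e\<bar> * exp (flux_const * L + 1)"
  proof (rule mult_mono[OF q])
    have "\<kappa> * s \<le> \<kappa> * (1/2)" using s \<kappa> by (intro mult_left_mono) auto
    then show "exp (\<kappa> * s) \<le> exp (flux_const * L + 1)" by (simp add: \<kappa>_def)
  qed auto
  finally show ?thesis by (simp add: L_def algebra_simps)
qed

end

section \<open>Shooting from the singular end\<close>

lemma continuous_on_Times_lipschitz:
  fixes F :: "real \<Rightarrow> real \<Rightarrow> real"
  assumes c: "\<And>d. continuous_on S (F d)"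
    and lip: "\<And>D. \<exists>K. \<forall>d e s. \<bar>d\<bar> \<le> D \<longrightarrow> \<bar>e\<bar> \<le> D \<longrightarrow> s \<in> S \<longrightarrow> \<bar>F d s - F e s\<bar> \<le> K * \<bar>d - e\<bar>"
  shows "continuous_on (UNIV \<times> S) (\<lambda>(d, s). F d s)"
  unfolding continuous_on_def
proof (intro ballI, clarify)
  fix d s assume s: "s \<in> S"
  obtain K where K: "\<And>d' e s. \<bar>d'\<bar> \<le> \<bar>d\<bar> + 1 \<Longrightarrow> \<bar>e\<bar> \<le> \<bar>d\<bar> + 1 \<Longrightarrow> s \<in> S \<Longrightarrow> \<bar>F d' s - F e s\<bar> \<le> K * \<bar>d' - e\<bar>"
    using lip[of "\<bar>d\<bar> + 1"] by blast
  let ?L = "at (d, s) within UNIV \<times> S"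
  have f: "((\<lambda>z. fst z) \<longlongrightarrow> d) ?L" "((\<lambda>z. snd z) \<longlongrightarrow> s) ?L"
    by (auto intro!: tendsto_eq_intros)
  have "(F d \<longlongrightarrow> F d s) (at s within S)" using c s by (auto simp: continuous_on_def)
  have cd: "continuous_on (UNIV \<times> S) (\<lambda>z. F d (snd z))"
    by (rule continuous_on_compose2[OF c]) (auto intro!: continuous_intros)
  then have t2: "((\<lambda>z. F d (snd z)) \<longlongrightarrow> F d s) ?L" using s by (force simp: continuous_on_def)
  have "((\<lambda>z. K * \<bar>fst z - d\<bar>) \<longlongrightarrow> 0) ?L"
    using f by (auto intro!: tendsto_eq_intros)
  moreover have "\<forall>\<^sub>F z in ?L. norm (F (fst z) (snd z) - F d (snd z)) \<le> K * \<bar>fst z - d\<bar>"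
  proof -
    have "\<forall>\<^sub>F z in ?L. dist (fst z) d < 1" using tendstoD[OF f(1), of 1] by simp
    moreover have "\<forall>\<^sub>F z in ?L. z \<in> UNIV \<times> S" by (auto simp: eventually_at_filter)
    ultimately show ?thesis
    proof eventually_elim
      case (elim z)
      then have "\<bar>fst z\<bar> \<le> \<bar>d\<bar> + 1" by (auto simp: dist_real_def)
      then show ?case using K[of "fst z" d "snd z"] elim by auto
    qed
  qed
  ultimately have "((\<lambda>z. F (fst z) (snd z) - F d (snd z)) \<longlongrightarrow> 0) ?L"
    by (rule Lim_null_comparison[rotated])
  from tendsto_add[OF this t2] show "((\<lambda>(d, s). F d s) \<longlongrightarrow> F d s) ?L"
    by (simp add: case_prod_unfold)
qed

context jacobi
begin

definition shoot :: "real \<Rightarrow> real \<Rightarrow> real" where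
  "shoot d = (SOME w. integral_solution (1/2) d w)"

definition vel :: "real \<Rightarrow> real \<Rightarrow> real" where
  "vel d s = - flux (\<lambda>t. nonlin p (shoot d t)) s"

definition acc :: "real \<Rightarrow> real \<Rightarrow> real" where
  "acc d = (SOME w2. solution (1/2) (shoot d) (vel d) w2)"

lemma shoot_integral_solution: "integral_solution (1/2) d (shoot d)"
  unfolding shoot_def by (rule someI_ex[where P = "integral_solution (1/2) d"]) (rule integral_solution_exists)

lemma shoot_solution: "solution (1/2) (shoot d) (vel d) (acc d)"
  unfolding acc_def
  by (rule someI_ex[where P = "solution (1/2) (shoot d) (vel d)"]) (use integral_solution_imp_solution[OF _ _ shoot_integral_solution[of d]] in \<open>simp add: vel_def[abs_def]\<close>)

lemma shoot_0: "shoot d 0 = d"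
  using shoot_integral_solution[of d] by (auto simp: integral_solution_def)

text \<open>The bound is linear in the initial value because powers of the same order \<open>p + 1\<close> bound the energy at \<open>0\<close> from
  above and the energy at \<open>s\<close> from below.\<close>

lemma shoot_bound:
  obtains C where "C \<ge> 1" "\<And>d s D. \<bar>d\<bar> \<le> D \<Longrightarrow> 1 \<le> D \<Longrightarrow> s \<in> {0..1/2} \<Longrightarrow> \<bar>shoot d s\<bar> \<le> C * D"
proof -
  obtain A B where AB: "A \<ge> 0" "B \<ge> 0"
    "\<And>T w w1 w2 s. T \<le> 1/2 \<Longrightarrow> solution T w w1 w2 \<Longrightarrow> s \<in> {0..T} \<Longrightarrow>
       \<bar>w s\<bar> powr (p + 1) \<le> A * \<bar>w 0\<bar> powr (p + 1) + B"
    using solution_bound by blast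
  define C where "C = (A + B + 1) powr (1 / (p + 1))"
  show ?thesis
  proof
    have "1 powr (1 / (p + 1)) \<le> C" unfolding C_def using AB p by (intro powr_mono2) auto
    then show "1 \<le> C" by simp
    fix d s D :: real assume d: "\<bar>d\<bar> \<le> D" "1 \<le> D" and s: "s \<in> {0..1/2}"
    have "\<bar>shoot d s\<bar> powr (p + 1) \<le> A * \<bar>d\<bar> powr (p + 1) + B"
      using AB(3)[OF _ shoot_solution s] by (simp add: shoot_0)
    also have "\<dots> \<le> A * D powr (p + 1) + B * D powr (p + 1)"
    proof (intro add_mono mult_left_mono AB)
      show "\<bar>d\<bar> powr (p + 1) \<le> D powr (p + 1)" using d p by (intro powr_mono2) auto
      have "B * 1 \<le> B * D powr (p + 1)" using d p AB by (intro mult_left_mono ge_one_powr_ge_zero) auto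
      then show "B \<le> B * D powr (p + 1)" by simp
    qed
    also have "\<dots> \<le> (A + B + 1) * D powr (p + 1)" by (simp add: distrib_right)
    finally have "(\<bar>shoot d s\<bar> powr (p + 1)) powr (1 / (p + 1)) \<le> ((A + B + 1) * D powr (p + 1)) powr (1 / (p + 1))"
      using p by (intro powr_mono2) auto
    then show "\<bar>shoot d s\<bar> \<le> C * D"
      using p d AB by (simp add: powr_powr powr_mult C_def)
  qed
qed

lemma shoot_lipschitz:
  "\<exists>K. \<forall>d e s. \<bar>d\<bar> \<le> D \<longrightarrow> \<bar>e\<bar> \<le> D \<longrightarrow> s \<in> {0..1/2} \<longrightarrow>
    \<bar>shoot d s - shoot e s\<bar> \<le> K * \<bar>d - e\<bar> \<and> \<bar>vel d s - vel e s\<bar> \<le> K * \<bar>d - e\<bar>"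
proof -
  obtain C where C: "C \<ge> 1" "\<And>d s D. \<bar>d\<bar> \<le> D \<Longrightarrow> 1 \<le> D \<Longrightarrow> s \<in> {0..1/2} \<Longrightarrow> \<bar>shoot d s\<bar> \<le> C * D"
    using shoot_bound by blast
  define R where "R = C * (\<bar>D\<bar> + 1)"
  define L where "L = p * R powr (p - 1) + 1"
  have L0: "L \<ge> 1" using p by (simp add: L_def)
  define K1 where "K1 = 2 * exp (flux_const * L + 1)"
  have K1: "K1 \<ge> 0" by (simp add: K1_def)
  define K where "K = K1 + flux_const * L * K1"
  have K: "K1 \<le> K" "flux_const * L * K1 \<le> K" using K1 flux_const_pos L0 by (auto simp: K_def)
  have T: "(0::real) \<le> 1/2" "(1/2::real) \<le> 1/2" by auto
  have nc: "continuous_on {0..1/2} (\<lambda>t. nonlin p (shoot d t))" for d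
    by (rule continuous_on_compose2[OF nonlin_continuous[OF p, of UNIV] solution_continuous(1)[OF shoot_solution]]) simp
  have "\<bar>shoot d s - shoot e s\<bar> \<le> K * \<bar>d - e\<bar> \<and> \<bar>vel d s - vel e s\<bar> \<le> K * \<bar>d - e\<bar>"
    if d: "\<bar>d\<bar> \<le> D" "\<bar>e\<bar> \<le> D" and s: "s \<in> {0..1/2}" for d e s
  proof
    have b: "\<bar>shoot d t\<bar> \<le> R" "\<bar>shoot e t\<bar> \<le> R" if "t \<in> {0..1/2}" for t
      using C(2)[of d "\<bar>D\<bar> + 1" t] C(2)[of e "\<bar>D\<bar> + 1" t] d that by (auto simp: R_def)
    have lip: "\<bar>shoot d t - shoot e t\<bar> \<le> K1 * \<bar>d - e\<bar>" if "t \<in> {0..1/2}" for t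
      using integral_solution_lipschitz[OF shoot_integral_solution[of d] shoot_integral_solution[of e] b that]
      by (simp add: K1_def L_def)
    also have "K1 * \<bar>d - e\<bar> \<le> K * \<bar>d - e\<bar>" by (intro mult_right_mono K) auto
    finally show "\<bar>shoot d s - shoot e s\<bar> \<le> K * \<bar>d - e\<bar>" using s by blast
    have "\<bar>flux (\<lambda>t. nonlin p (shoot d t) - nonlin p (shoot e t)) s\<bar> \<le> flux_const * (L * (K1 * \<bar>d - e\<bar>))"
    proof (rule flux_bound[OF T _ s])
      show "continuous_on {0..1/2} (\<lambda>t. nonlin p (shoot d t) - nonlin p (shoot e t))"
        by (intro continuous_intros nc)
      fix t assume t: "t \<in> {0..s}"
      then have t': "t \<in> {0..1/2}" using s by auto
      have "\<bar>nonlin p (shoot d t) - nonlin p (shoot e t)\<bar> \<le> L * \<bar>shoot d t - shoot e t\<bar>"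
        unfolding L_def by (rule nonlin_lipschitz[OF p b[OF t']])
      also have "\<dots> \<le> L * (K1 * \<bar>d - e\<bar>)" using L0 lip[OF t'] by (intro mult_left_mono) auto
      finally show "\<bar>nonlin p (shoot d t) - nonlin p (shoot e t)\<bar> \<le> L * (K1 * \<bar>d - e\<bar>)" .
    qed
    then have "\<bar>vel d s - vel e s\<bar> \<le> flux_const * L * K1 * \<bar>d - e\<bar>"
      unfolding flux_diff[OF T nc nc s] vel_def by (simp add: mult.assoc abs_minus_commute)
    also have "\<dots> \<le> K * \<bar>d - e\<bar>" by (intro mult_right_mono K) auto
    finally show "\<bar>vel d s - vel e s\<bar> \<le> K * \<bar>d - e\<bar>" .
  qed
  then show ?thesis by blast
qed

lemma shoot_continuous:
  "continuous_on (UNIV \<times> {0..1/2}) (\<lambda>(d, s). shoot d s)"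
  "continuous_on (UNIV \<times> {0..1/2}) (\<lambda>(d, s). vel d s)"
  by (rule continuous_on_Times_lipschitz;
      use solution_continuous[OF shoot_solution] shoot_lipschitz in meson)+

text \<open>Uniqueness at the regular point \<open>s0\<close>, compared with the constant solution \<open>c\<close>. The coefficients are bounded only
  away from \<open>0\<close>; Gronwall's argument on every \<open>{a..1/2}\<close> and continuity at \<open>0\<close> give the whole interval.\<close>

lemma solution_rigid:
  assumes w: "solution (1/2) w w1 w2" and c: "nonlin p c = 0"
    and s0: "0 < s0" "s0 \<le> 1/2" "w s0 = c" "w1 s0 = 0" and s: "s \<in> {0..1/2}"
  shows "w s = c"
proof -
  note d = solution_derivs[OF w] and wc = solution_continuous[OF w]
  have "bounded (w ` {0..1/2})" by (intro compact_imp_bounded compact_continuous_image wc) auto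
  then obtain R' where "\<forall>x\<in>w ` {0..1/2}. norm x \<le> R'" unfolding bounded_iff by blast
  then have R': "\<And>t. t \<in> {0..1/2} \<Longrightarrow> \<bar>w t\<bar> \<le> R'" by simp
  define R where "R = max R' \<bar>c\<bar>"
  define L where "L = p * R powr (p - 1) + 1"
  have L0: "L \<ge> 0" using p by (simp add: L_def add_nonneg_nonneg)
  have nl: "\<bar>nonlin p (w t)\<bar> \<le> L * \<bar>w t - c\<bar>" if "t \<in> {0..1/2}" for t
    using nonlin_lipschitz[OF p, of "w t" R c] R'[OF that] c by (simp add: R_def L_def)
  let ?N = "\<lambda>t. (w t - c)\<^sup>2 + (w1 t)\<^sup>2"
  have pos: "w t = c" if a: "0 < a" "a \<le> s0" and t: "t \<in> {a..1/2}" for a t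
  proof -
    define k where "k = 2 / a"
    define K where "K = 1 + 2 * (k * (\<alpha> + \<beta>)) + k * (\<mu> * L)"
    have k0: "k > 0" using a by (simp add: k_def)
    have sub: "{a..1/2} \<subseteq> {0..1/2}" using a by auto
    have "?N t = 0"
    proof (rule gronwall_eq_0[of a "1/2" ?N "\<lambda>t. 2 * ((w t - c) * w1 t) + 2 * (w1 t * w2 t)" K s0 t])
      fix r assume r: "r \<in> {a..1/2}"
      then have r': "r \<in> {0..1/2}" using a by auto
      show "(?N has_real_derivative 2 * ((w r - c) * w1 r) + 2 * (w1 r * w2 r)) (at r within {a..1/2})"
        using DERIV_subset[OF d(1)[OF r'] sub] DERIV_subset[OF d(2)[OF r'] sub]
        by (auto intro!: derivative_eq_intros)
      have w2: "\<bar>w2 r\<bar> \<le> k * ((\<alpha> + \<beta>) * \<bar>w1 r\<bar> + \<mu> * (L * \<bar>w r - c\<bar>))"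
      proof -
        have rr: "a / 2 \<le> r * (1 - r)" using r a mult_mono[of a r "1/2" "1 - r"] by auto
        have "a / 2 * \<bar>w2 r\<bar> \<le> r * (1 - r) * \<bar>w2 r\<bar>" by (intro mult_right_mono rr) auto
        also have "\<dots> = \<bar>r * (1 - r) * w2 r\<bar>" using r a by (simp add: abs_mult)
        also have "\<dots> \<le> \<bar>(\<alpha> * (1 - r) - \<beta> * r) * w1 r\<bar> + \<bar>\<mu> * nonlin p (w r)\<bar>" unfolding d(3)[OF r'] by linarith
        also have "\<dots> \<le> (\<alpha> + \<beta>) * \<bar>w1 r\<bar> + \<mu> * (L * \<bar>w r - c\<bar>)"
        proof -
          have "0 \<le> \<alpha> * r" "0 \<le> \<beta> * r" "\<alpha> * r \<le> \<alpha> * 1" "\<beta> * r \<le> \<beta> * 1" using r a \<alpha>_pos \<beta> by (auto intro!: mult_left_mono)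
          moreover have "\<alpha> * (1 - r) - \<beta> * r = \<alpha> - \<alpha> * r - \<beta> * r" by (simp add: algebra_simps)
          ultimately have "\<bar>\<alpha> * (1 - r) - \<beta> * r\<bar> \<le> \<alpha> + \<beta>" using \<beta> \<alpha>_pos by linarith
          then show ?thesis unfolding abs_mult using nl[OF r'] \<mu> by (intro add_mono mult_right_mono mult_left_mono) auto
        qed
        finally show ?thesis using a by (simp add: k_def field_simps)
      qed
      define x y where "x = \<bar>w r - c\<bar>" and "y = \<bar>w1 r\<bar>"
      have xy: "2 * (x * y) \<le> x\<^sup>2 + y\<^sup>2" using zero_le_power2[of "x - y"] by (simp add: power2_diff)
      have xy0: "x \<ge> 0" "y \<ge> 0" by (auto simp: x_def y_def)
      have "\<bar>2 * ((w r - c) * w1 r) + 2 * (w1 r * w2 r)\<bar> \<le> 2 * (x * y) + 2 * (y * \<bar>w2 r\<bar>)"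
        unfolding x_def y_def abs_mult[symmetric] by linarith
      also have "\<dots> \<le> 2 * (x * y) + 2 * (y * (k * ((\<alpha> + \<beta>) * y + \<mu> * (L * x))))"
        using w2 xy0 by (intro add_mono mult_left_mono) (auto simp: x_def y_def)
      also have "\<dots> = 2 * (x * y) + 2 * (k * (\<alpha> + \<beta>)) * y\<^sup>2 + k * (\<mu> * L) * (2 * (x * y))"
        by (simp add: power2_eq_square algebra_simps)
      also have "\<dots> \<le> (x\<^sup>2 + y\<^sup>2) + 2 * (k * (\<alpha> + \<beta>)) * (x\<^sup>2 + y\<^sup>2) + k * (\<mu> * L) * (x\<^sup>2 + y\<^sup>2)"
        using xy k0 \<alpha>_pos \<beta> \<mu> L0 by (intro add_mono mult_left_mono) auto
      also have "\<dots> = K * (x\<^sup>2 + y\<^sup>2)" by (simp add: K_def algebra_simps)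
      finally show "\<bar>2 * ((w r - c) * w1 r) + 2 * (w1 r * w2 r)\<bar> \<le> K * ?N r" by (simp add: x_def y_def)
    qed (use a s0 t in auto)
    then show ?thesis by (simp add: sum_power2_eq_zero_iff)
  qed
  have inner: "w t = c" if "t \<in> {0<..1/2}" for t
    using pos[of "min t s0" t] that s0 by auto
  moreover have "w 0 = c"
  proof -
    have "(w \<longlongrightarrow> w 0) (at 0 within {0..1/2})" using wc(1) by (auto simp: continuous_on_def)
    then have "(w \<longlongrightarrow> w 0) (at_right 0)" by (rule tendsto_within_subset[of _ _ _ "{0..1/2}", THEN filterlim_mono]) (auto simp: at_within_Icc_at_right)
    moreover have "(w \<longlongrightarrow> c) (at_right 0)"
      by (rule tendsto_eventually) (auto simp: eventually_at_right[of 0 "1/2"] intro!: exI[of _ "1/2"] inner)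
    ultimately show ?thesis by (rule tendsto_unique[rotated]) simp
  qed
  ultimately show ?thesis using s inner by (cases "s = 0") auto
qed

lemma shoot_nontrivial:
  assumes "d \<noteq> 0" "0 < s" "s \<le> 1/2" "shoot d s = 0"
  shows "vel d s \<noteq> 0"
  using solution_rigid[OF shoot_solution[of d], of 0 s 0] assms by (auto simp: shoot_0 nonlin_def)

end

section \<open>Large initial values: energy and oscillation\<close>

text \<open>With \<open>N = 2 \<alpha>\<close> in the role of the dimension this is \<open>p < (N + 2) / (N - 2)\<close>, read as no condition for
  \<open>N \<le> 2\<close>.\<close>

locale subcritical_jacobi = jacobi +
  assumes sub: "p * (\<alpha> - 1) < \<alpha> + 1"
begin

text \<open>The constant \<open>\<kappa>\<close> of the Pohozaev functional must exceed \<open>(\<alpha> - 1) / 2\<close> for the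
  kinetic term and stay below \<open>\<alpha> / (p + 1)\<close> for the potential term to have a good sign.\<close>

lemma pohozaev_deriv:
  assumes w: "solution (1/2) w w1 w2" and s: "0 < s" "s < 1/2"
  shows "((\<lambda>s. s powr \<alpha> * (energy w w1 s + \<kappa> * ((1 - s) * (w s * w1 s)))) has_real_derivative
    s powr (\<alpha> - 1) * (s * (w1 s)\<^sup>2 * ((1 - s) * (\<kappa> - (\<alpha> - 1) / 2) + (\<beta> - 1/2) * s)
      + \<mu> * ((\<alpha> / (p + 1) - \<kappa>) * \<bar>w s\<bar> powr (p + 1) + (\<kappa> - \<alpha> / 2) * (w s)\<^sup>2)
      + \<kappa> * (\<beta> - 1) * s * (w s * w1 s) + \<alpha> * \<mu> / 2)) (at s)"
proof -
  have s': "s \<in> {0..1/2}" and at: "at s within {0..1/2} = at s" using s by (auto intro!: at_within_interior)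
  note d = solution_derivs[OF w s', unfolded at] and E = energy_deriv[OF w s', unfolded at]
  define X Y Z q where "X = (w s)\<^sup>2" and "Y = (w1 s)\<^sup>2" and "Z = \<bar>w s\<bar> powr (p + 1)" and "q = 1 / (p + 1)"
  define v where "v = w s * w1 s"
  define E' where "E' = ((1/2 - \<alpha>) * (1 - s) + (\<beta> - 1/2) * s) * (w1 s)\<^sup>2"
  have A: "((\<lambda>s. s powr \<alpha>) has_real_derivative \<alpha> * s powr (\<alpha> - 1)) (at s)"
    using s by (auto intro!: derivative_eq_intros)
  have B: "((\<lambda>s. (1 - s) * (w s * w1 s)) has_real_derivative - (w s * w1 s) + (1 - s) * (w1 s * w1 s + w s * w2 s)) (at s)"
    by (auto intro!: derivative_eq_intros d simp: algebra_simps)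
  have "((\<lambda>s. s powr \<alpha> * (energy w w1 s + \<kappa> * ((1 - s) * (w s * w1 s)))) has_real_derivative
      \<alpha> * s powr (\<alpha> - 1) * (energy w w1 s + \<kappa> * ((1 - s) * (w s * w1 s)))
      + (E' + \<kappa> * (- (w s * w1 s) + (1 - s) * (w1 s * w1 s + w s * w2 s))) * s powr \<alpha>) (at s)"
    unfolding E'_def by (rule DERIV_mult[OF A DERIV_add[OF E DERIV_cmult[OF B]]])
  moreover have "s powr \<alpha> = s * s powr (\<alpha> - 1)" using s by (simp add: powr_diff)
  ultimately have D: "((\<lambda>s. s powr \<alpha> * (energy w w1 s + \<kappa> * ((1 - s) * (w s * w1 s)))) has_real_derivative
      s powr (\<alpha> - 1) * (\<alpha> * (energy w w1 s + \<kappa> * ((1 - s) * v))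
      + s * E' + \<kappa> * (- (s * v) + s * (1 - s) * Y + w s * (s * (1 - s) * w2 s)))) (at s)"
    by (elim DERIV_cong) (simp add: v_def Y_def algebra_simps power2_eq_square)
  have n: "w s * nonlin p (w s) = Z - X"
    by (simp add: nonlin_def Z_def X_def abs_powr_Suc power2_eq_square right_diff_distrib mult.commute mult.left_commute)
  have w2: "w s * (s * (1 - s) * w2 s) = - (\<alpha> * (1 - s) - \<beta> * s) * v - \<mu> * (Z - X)"
    unfolding d(3) n[symmetric] v_def by (simp add: algebra_simps)
  have en: "energy w w1 s = s * (1 - s) * Y / 2 + \<mu> * (Z * q - X / 2) + \<mu> / 2"
    by (simp add: energy_def potential_def X_def Y_def Z_def q_def)
  show ?thesis
  proof (rule DERIV_cong[OF D], rule arg_cong[of _ _ "(*) (s powr (\<alpha> - 1))"])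
    show "\<alpha> * (energy w w1 s + \<kappa> * ((1 - s) * v)) + s * E' + \<kappa> * (- (s * v) + s * (1 - s) * Y + w s * (s * (1 - s) * w2 s)) =
      s * (w1 s)\<^sup>2 * ((1 - s) * (\<kappa> - (\<alpha> - 1) / 2) + (\<beta> - 1/2) * s)
      + \<mu> * ((\<alpha> / (p + 1) - \<kappa>) * \<bar>w s\<bar> powr (p + 1) + (\<kappa> - \<alpha> / 2) * (w s)\<^sup>2)
      + \<kappa> * (\<beta> - 1) * s * (w s * w1 s) + \<alpha> * \<mu> / 2"
      unfolding en w2 E'_def Y_def[symmetric] X_def[symmetric] Z_def[symmetric] v_def[symmetric]
      using q_def by (simp add: algebra_simps add_divide_distrib diff_divide_distrib)
  qed
qed

text \<open>Subcriticality is what makes room for such a \<open>\<kappa>\<close>. The mixed term is absorbed by the kinetic one, and the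
  quadratic terms by the superlinear power.\<close>

lemma pohozaev_growth:
  "\<exists>\<kappa> c C. \<kappa> > 0 \<and> c > 0 \<and> C \<ge> 0 \<and> (\<forall>w w1 w2 s. solution (1/2) w w1 w2 \<longrightarrow> 0 < s \<longrightarrow> s < 1/2 \<longrightarrow>
     (\<exists>D. ((\<lambda>s. s powr \<alpha> * (energy w w1 s + \<kappa> * ((1 - s) * (w s * w1 s)))) has_real_derivative D) (at s) \<and>
        D \<ge> s powr (\<alpha> - 1) * (c * \<bar>w s\<bar> powr (p + 1) - C)))"
proof -
  \<comment> \<open>The middle of the interval of admissible constants, kept positive.\<close>
  define l r where "l = max 0 ((\<alpha> - 1) / 2)" and "r = \<alpha> / (p + 1)"
  define \<kappa> where "\<kappa> = (l + r) / 2"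
  have "l < r" unfolding l_def r_def using sub p \<alpha>_pos by (auto simp: field_simps)
  moreover have "0 \<le> l" "(\<alpha> - 1) / 2 \<le> l" by (simp_all add: l_def)
  ultimately have lt: "0 < \<kappa>" "(\<alpha> - 1) / 2 < \<kappa>" "\<kappa> < \<alpha> / (p + 1)"
    by (simp_all add: \<kappa>_def r_def[symmetric])
  define \<delta> \<eta> where "\<delta> = \<kappa> - (\<alpha> - 1) / 2" and "\<eta> = \<alpha> / (p + 1) - \<kappa>"
  have pos: "\<kappa> > 0" "\<delta> > 0" "\<eta> > 0" using lt by (auto simp: \<delta>_def \<eta>_def)
  define K where "K = \<mu> * \<alpha> / 2 + \<kappa>\<^sup>2 * (\<beta> - 1)\<^sup>2 / (2 * \<delta>)"
  have "\<mu> * \<alpha> / 2 > 0" using \<mu> \<alpha>_pos by simp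
  moreover have "\<kappa>\<^sup>2 * (\<beta> - 1)\<^sup>2 / (2 * \<delta>) \<ge> 0" using pos by simp
  ultimately have K: "K > 0" unfolding K_def by linarith
  have "\<mu> * \<eta> / (2 * K) > 0" using \<mu> pos K by simp
  from square_le_eps_powr[OF p this] obtain C where C: "C \<ge> 0"
    "\<And>w::real. w\<^sup>2 \<le> \<mu> * \<eta> / (2 * K) * \<bar>w\<bar> powr (p + 1) + C" by blast
  let ?B = "\<lambda>s v y. s * y\<^sup>2 * ((1 - s) * (\<kappa> - (\<alpha> - 1) / 2) + (\<beta> - 1/2) * s)
      + \<mu> * ((\<alpha> / (p + 1) - \<kappa>) * \<bar>v\<bar> powr (p + 1) + (\<kappa> - \<alpha> / 2) * v\<^sup>2)
      + \<kappa> * (\<beta> - 1) * s * (v * y) + \<alpha> * \<mu> / 2"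
  have B: "\<mu> * \<eta> / 2 * \<bar>v\<bar> powr (p + 1) - K * C \<le> ?B s v y" if s: "0 < s" "s < 1/2" for s v y :: real
  proof -
    have 1: "s * y\<^sup>2 * (\<delta> / 2) \<le> s * y\<^sup>2 * ((1 - s) * (\<kappa> - (\<alpha> - 1) / 2) + (\<beta> - 1/2) * s)"
    proof (rule mult_left_mono)
      have "1/2 * \<delta> \<le> (1 - s) * \<delta>" using s pos by (intro mult_right_mono) auto
      moreover have "0 \<le> (\<beta> - 1/2) * s" using s \<beta> by (intro mult_nonneg_nonneg) auto
      ultimately show "\<delta> / 2 \<le> (1 - s) * (\<kappa> - (\<alpha> - 1) / 2) + (\<beta> - 1/2) * s" by (simp add: \<delta>_def)
    qed (use s in auto)
    define g where "g = \<kappa> * (\<beta> - 1)"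
    have 2: "- (s * y\<^sup>2 * (\<delta> / 2)) - g\<^sup>2 / (2 * \<delta>) * v\<^sup>2 \<le> \<kappa> * (\<beta> - 1) * s * (v * y)"
    proof -
      have "0 \<le> s / (2 * \<delta>) * (\<delta> * y + g * v)\<^sup>2" using s pos by simp
      also have "\<dots> = s * y\<^sup>2 * (\<delta> / 2) + s * (g\<^sup>2 / (2 * \<delta>) * v\<^sup>2) + g * s * (v * y)"
        using pos by (simp add: power2_eq_square field_simps)
      also have "s * (g\<^sup>2 / (2 * \<delta>) * v\<^sup>2) \<le> 1 * (g\<^sup>2 / (2 * \<delta>) * v\<^sup>2)"
        using s pos by (intro mult_right_mono) auto
      finally show ?thesis by (simp add: g_def)
    qed
    have 3: "K * v\<^sup>2 \<le> \<mu> * \<eta> / 2 * \<bar>v\<bar> powr (p + 1) + K * C"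
      using mult_left_mono[OF C(2)[of v], of K] K by (simp add: distrib_left)
    have 4: "0 \<le> \<mu> * \<kappa> * v\<^sup>2" "0 \<le> \<alpha> * \<mu> / 2" using \<mu> pos \<alpha>_pos by auto
    have 5: "\<mu> * ((\<alpha> / (p + 1) - \<kappa>) * \<bar>v\<bar> powr (p + 1) + (\<kappa> - \<alpha> / 2) * v\<^sup>2)
        = \<mu> * \<eta> * \<bar>v\<bar> powr (p + 1) + \<mu> * \<kappa> * v\<^sup>2 - \<mu> * \<alpha> / 2 * v\<^sup>2"
      unfolding \<eta>_def by (simp add: algebra_simps)
    have 6: "K * v\<^sup>2 = \<mu> * \<alpha> / 2 * v\<^sup>2 + g\<^sup>2 / (2 * \<delta>) * v\<^sup>2"
      unfolding K_def g_def by (simp add: distrib_right power_mult_distrib)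
    have 7: "\<mu> * \<eta> * \<bar>v\<bar> powr (p + 1) = \<mu> * \<eta> / 2 * \<bar>v\<bar> powr (p + 1) + \<mu> * \<eta> / 2 * \<bar>v\<bar> powr (p + 1)" by simp
    show ?thesis using 1 2 3 4 unfolding 5 6 7 by linarith
  qed
  show ?thesis
  proof (rule exI[of _ \<kappa>], rule exI[of _ "\<mu> * \<eta> / 2"], rule exI[of _ "K * C"], intro conjI allI impI)
    fix w w1 w2 s assume w: "solution (1/2) w w1 w2" and s: "0 < s" "s < (1/2::real)"
    show "\<exists>D. ((\<lambda>s. s powr \<alpha> * (energy w w1 s + \<kappa> * ((1 - s) * (w s * w1 s)))) has_real_derivative D) (at s) \<and>
        D \<ge> s powr (\<alpha> - 1) * (\<mu> * \<eta> / 2 * \<bar>w s\<bar> powr (p + 1) - K * C)"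
      using pohozaev_deriv[OF w s, of \<kappa>] B[OF s, of "w s" "w1 s"]
      by (intro exI[of _ "s powr (\<alpha> - 1) * ?B s (w s) (w1 s)"] conjI mult_left_mono) auto
  qed (use pos \<mu> K C in auto)
qed

text \<open>Integrating the Pohozaev inequality: \<open>{0..\<sigma>}\<close>, where \<open>w\<close> is large, contributes \<open>m * \<sigma> powr \<alpha>\<close>, the rest loses at
  most a constant, and at \<open>1/2\<close> the functional is controlled by the energy.\<close>

lemma energy_lower:
  "\<exists>a b. a > 0 \<and> (\<forall>w w1 w2 \<sigma> m. solution (1/2) w w1 w2 \<longrightarrow> 0 < \<sigma> \<longrightarrow> \<sigma> \<le> 1/2 \<longrightarrow>
     (\<forall>s\<in>{0..\<sigma>}. m \<le> \<bar>w s\<bar> powr (p + 1)) \<longrightarrow> a * (m * \<sigma> powr \<alpha>) - b \<le> energy w w1 (1/2))"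
proof -
  obtain \<kappa> c C where k: "\<kappa> > 0" "c > 0" "C \<ge> 0" and
    P': "\<forall>w w1 w2 s. solution (1/2) w w1 w2 \<longrightarrow> 0 < s \<longrightarrow> s < 1/2 \<longrightarrow>
     (\<exists>D. ((\<lambda>s. s powr \<alpha> * (energy w w1 s + \<kappa> * ((1 - s) * (w s * w1 s)))) has_real_derivative D) (at s) \<and>
        D \<ge> s powr (\<alpha> - 1) * (c * \<bar>w s\<bar> powr (p + 1) - C))"
    using pohozaev_growth by blast
  note P = P'[rule_format]
  obtain C1 where C1: "C1 \<ge> 0" "\<And>w. \<bar>w\<bar> powr (p + 1) \<le> 2 * (p + 1) * potential p w + C1"
    using powr_le_potential[OF p] by blast
  from square_le_eps_powr[OF p zero_less_one]
  obtain C2 where C2: "C2 \<ge> 0" "\<And>w::real. w\<^sup>2 \<le> 1 * \<bar>w\<bar> powr (p + 1) + C2"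
    by blast
  define C5 where "C5 = 1 + \<kappa> * 8 + \<kappa> * (2 * (p + 1) / \<mu>)"
  have C5: "C5 > 0" using k p \<mu> by (simp add: C5_def add_pos_nonneg)
  define C6 where "C6 = \<kappa> * (C1 + C2)"
  have C6: "C6 \<ge> 0" using k C1 C2 by (simp add: C6_def)
  have main: "c / \<alpha> * (m * \<sigma> powr \<alpha>) - C / \<alpha> - C6 \<le> C5 * energy w w1 (1/2)"
    if w: "solution (1/2) w w1 w2" and \<sigma>: "0 < \<sigma>" "\<sigma> \<le> 1/2" and m: "\<forall>s\<in>{0..\<sigma>}. m \<le> \<bar>w s\<bar> powr (p + 1)" for w w1 w2 \<sigma> m
  proof -
    define Q where "Q s = s powr \<alpha> * (energy w w1 s + \<kappa> * ((1 - s) * (w s * w1 s)))" for s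
    note wc = solution_continuous[OF w]
    have Ec: "continuous_on {0..1/2} (energy w w1)" by (rule DERIV_continuous_on[OF energy_deriv[OF w]])
    have Qc: "continuous_on {0..1/2} Q"
      unfolding Q_def[abs_def] using \<alpha>_pos by (intro continuous_intros wc Ec continuous_on_powr') auto
    have pc: "continuous_on {0..1/2} (\<lambda>s. B / \<alpha> * s powr \<alpha>)" for B
      using \<alpha>_pos by (intro continuous_intros continuous_on_powr') auto
    have pd: "((\<lambda>s. B / \<alpha> * s powr \<alpha>) has_real_derivative s powr (\<alpha> - 1) * B) (at s)" if "s > 0" for B s
      using that \<alpha>_pos by (auto intro!: derivative_eq_intros)
    have mono: "Q x - B / \<alpha> * x powr \<alpha> \<le> Q y - B / \<alpha> * y powr \<alpha>"
      if xy: "0 \<le> x" "x \<le> y" "y \<le> 1/2" and B: "\<And>s. x < s \<Longrightarrow> s < y \<Longrightarrow> B \<le> c * \<bar>w s\<bar> powr (p + 1) - C" for x y B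
    proof (rule DERIV_nonneg_imp_increasing_open[OF xy(2), of "\<lambda>s. Q s - B / \<alpha> * s powr \<alpha>"])
      fix s assume s: "x < s" "s < y"
      then have s': "0 < s" "s < 1/2" using xy by auto
      obtain D where D: "(Q has_real_derivative D) (at s)" "D \<ge> s powr (\<alpha> - 1) * (c * \<bar>w s\<bar> powr (p + 1) - C)"
        using P[OF w s'] unfolding Q_def[abs_def] by blast
      have "s powr (\<alpha> - 1) * B \<le> D"
        by (rule order_trans[OF _ D(2)]) (use B[OF s] in \<open>auto intro!: mult_left_mono\<close>)
      then show "\<exists>y. ((\<lambda>s. Q s - B / \<alpha> * s powr \<alpha>) has_real_derivative y) (at s) \<and> 0 \<le> y"
        using DERIV_diff[OF D(1) pd[OF s'(1), of B]] by (intro exI[of _ "D - s powr (\<alpha> - 1) * B"]) auto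
    next
      show "continuous_on {x..y} (\<lambda>s. Q s - B / \<alpha> * s powr \<alpha>)"
        by (rule continuous_on_subset[OF continuous_on_diff[OF Qc pc]]) (use xy in auto)
    qed
    have "Q 0 - (c * m - C) / \<alpha> * 0 powr \<alpha> \<le> Q \<sigma> - (c * m - C) / \<alpha> * \<sigma> powr \<alpha>"
      by (rule mono) (use \<sigma> m k in auto)
    then have a1: "(c * m - C) / \<alpha> * \<sigma> powr \<alpha> \<le> Q \<sigma>" using \<alpha>_pos by (simp add: Q_def)
    have "Q \<sigma> - (- C) / \<alpha> * \<sigma> powr \<alpha> \<le> Q (1/2) - (- C) / \<alpha> * (1/2) powr \<alpha>"
      by (rule mono) (use \<sigma> k in auto)
    moreover have "C / \<alpha> * (1/2) powr \<alpha> \<le> C / \<alpha> * 1"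
      using k \<alpha>_pos powr_mono2[of \<alpha> "1/2" 1] by (intro mult_left_mono) auto
    ultimately have "Q \<sigma> + C / \<alpha> * \<sigma> powr \<alpha> - C / \<alpha> \<le> Q (1/2)" by simp
    then have a2: "c / \<alpha> * (m * \<sigma> powr \<alpha>) - C / \<alpha> \<le> Q (1/2)"
      using a1 by (simp add: left_diff_distrib diff_divide_distrib)
    let ?e = "energy w w1 (1/2)" and ?w = "w (1/2)" and ?v = "w1 (1/2)"
    have e0: "?e \<ge> 0" by (rule energy_nonneg) auto
    have v: "?v\<^sup>2 \<le> 8 * ?e" using energy_ge_kinetic[of "1/2" w1 w] by simp
    have w2: "?w\<^sup>2 \<le> 2 * (p + 1) / \<mu> * ?e + (C1 + C2)"
    proof -
      have "\<mu> * potential p ?w \<le> ?e" using energy_ge_potential[of "1/2" w w1] \<mu> by auto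
      then have "potential p ?w \<le> ?e / \<mu>" using \<mu> by (simp add: field_simps)
      then have "2 * (p + 1) * potential p ?w \<le> 2 * (p + 1) * (?e / \<mu>)" using p by (intro mult_left_mono) auto
      then show ?thesis using C1(2)[of ?w] C2(2)[of ?w] by simp
    qed
    have "?w * ?v \<le> ?w\<^sup>2 + ?v\<^sup>2"
      using zero_le_power2[of "?w - ?v"] zero_le_power2[of ?w] zero_le_power2[of ?v] unfolding power2_diff by linarith
    moreover have "- (?w * ?v) \<le> ?w\<^sup>2 + ?v\<^sup>2"
      using zero_le_power2[of "?w + ?v"] zero_le_power2[of ?w] zero_le_power2[of ?v] unfolding power2_sum by linarith
    ultimately have wv: "1/2 * (?w * ?v) \<le> ?w\<^sup>2 + ?v\<^sup>2"
      using zero_le_power2[of ?w] zero_le_power2[of ?v] by linarith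
    have "\<kappa> * (1/2 * (?w * ?v)) \<le> \<kappa> * ((2 * (p + 1) / \<mu> * ?e + (C1 + C2)) + 8 * ?e)"
      using wv v w2 k by (intro mult_left_mono) auto
    then have R: "?e + \<kappa> * (1/2 * (?w * ?v)) \<le> C5 * ?e + C6"
      by (simp add: C5_def C6_def algebra_simps)
    have R0: "0 \<le> C5 * ?e + C6" using C5 C6 e0 by simp
    have "Q (1/2) \<le> (1/2) powr \<alpha> * (C5 * ?e + C6)"
      unfolding Q_def using R by (intro mult_left_mono) auto
    also have "\<dots> \<le> 1 * (C5 * ?e + C6)"
      using R0 \<alpha>_pos powr_mono2[of \<alpha> "1/2" 1] by (intro mult_right_mono) auto
    finally show ?thesis using a2 by simp
  qed
  show ?thesis
  proof (rule exI[of _ "c / \<alpha> / C5"], rule exI[of _ "(C / \<alpha> + C6) / C5"], intro conjI allI impI)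
    fix w w1 w2 \<sigma> m assume h: "solution (1/2) w w1 w2" "0 < \<sigma>" "\<sigma> \<le> 1/2" "\<forall>s\<in>{0..\<sigma>}. m \<le> \<bar>w s\<bar> powr (p + 1)"
    have "(c / \<alpha> * (m * \<sigma> powr \<alpha>) - C / \<alpha> - C6) / C5 \<le> energy w w1 (1/2)"
      using main[OF h] C5 by (simp add: divide_le_eq mult.commute)
    then show "c / \<alpha> / C5 * (m * \<sigma> powr \<alpha>) - (C / \<alpha> + C6) / C5 \<le> energy w w1 (1/2)"
      by (simp add: diff_divide_distrib add_divide_distrib)
  qed (use k \<alpha>_pos C5 in auto)
qed

text \<open>Since \<open>\<bar>w'\<bar>\<close> is at most of order \<open>d powr p\<close>, the solution stays above \<open>d / 2\<close> for a length of order \<open>d powr (1 - p)\<close>.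
  This contributes \<open>d powr (p + 1 + \<alpha> * (1 - p))\<close> to the energy, whose exponent is positive in the subcritical
  range.\<close>

lemma energy_tends_to_infinity:
  "filterlim (\<lambda>d. energy (shoot d) (vel d) (1/2)) at_top at_top"
proof -
  obtain C where C: "C \<ge> 1" "\<And>d s D. \<bar>d\<bar> \<le> D \<Longrightarrow> 1 \<le> D \<Longrightarrow> s \<in> {0..1/2} \<Longrightarrow> \<bar>shoot d s\<bar> \<le> C * D"
    using shoot_bound by blast
  obtain a b where ab: "a > 0" "\<And>w w1 w2 \<sigma> m. solution (1/2) w w1 w2 \<Longrightarrow> 0 < \<sigma> \<Longrightarrow> \<sigma> \<le> 1/2 \<Longrightarrow>
     (\<forall>s\<in>{0..\<sigma>}. m \<le> \<bar>w s\<bar> powr (p + 1)) \<Longrightarrow> a * (m * \<sigma> powr \<alpha>) - b \<le> energy w w1 (1/2)"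
    using energy_lower by meson
  define K where "K = flux_const * (2 * C powr p) + 1"
  have K: "K \<ge> 1" using flux_const_pos by (simp add: K_def)
  define \<gamma> where "\<gamma> = p + 1 + \<alpha> * (1 - p)"
  have \<gamma>: "\<gamma> > 0" using sub by (simp add: \<gamma>_def algebra_simps)
  define a' where "a' = a * ((1/2) powr (p + 1) * (1 / (2 * K)) powr \<alpha>)"
  have a': "a' > 0" using ab K by (simp add: a'_def)
  have low: "a' * d powr \<gamma> - b \<le> energy (shoot d) (vel d) (1/2)" if d: "d \<ge> 1" for d
  proof -
    define \<sigma> where "\<sigma> = 1 / (2 * K) * d powr (1 - p)"
    have "d powr (1 - p) \<le> d powr 0" using d p by (intro powr_mono) auto
    then have d1: "d powr (1 - p) \<le> 1" using d by simp
    have "1 / (2 * K) * d powr (1 - p) \<le> 1/2 * 1" using K d1 by (intro mult_mono) (auto simp: field_simps)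
    then have \<sigma>: "0 < \<sigma>" "\<sigma> \<le> 1/2" using K d by (auto simp: \<sigma>_def)
    have flux: "\<bar>flux (\<lambda>t. nonlin p (shoot d t)) s\<bar> \<le> K * d powr p" if s: "s \<in> {0..1/2}" for s
    proof -
      have "\<bar>flux (\<lambda>t. nonlin p (shoot d t)) s\<bar> \<le> flux_const * (2 * (C * d) powr p)"
      proof (rule flux_bound[of "1/2"])
        show "continuous_on {0..1/2} (\<lambda>t. nonlin p (shoot d t))"
          by (rule continuous_on_compose2[OF nonlin_continuous[OF p, of UNIV] solution_continuous(1)[OF shoot_solution]]) simp
        fix t assume "t \<in> {0..s}"
        then have b: "\<bar>shoot d t\<bar> \<le> C * d" using C(2)[of d d t] d s by auto
        have Cd: "1 \<le> C * d" using C d by (metis mult_mono mult_1 order_trans zero_le_one less_eq_real_def le_less_trans zero_less_one)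
        have "\<bar>nonlin p (shoot d t)\<bar> \<le> \<bar>shoot d t\<bar> powr (p - 1) * \<bar>shoot d t\<bar> + \<bar>shoot d t\<bar>"
          unfolding nonlin_def by (rule order_trans[OF abs_triangle_ineq4]) (simp add: abs_mult)
        also have "\<dots> \<le> (C * d) powr (p - 1) * (C * d) + (C * d) powr 1"
          using b p Cd by (intro add_mono mult_mono powr_mono2) auto
        also have "(C * d) powr (p - 1) * (C * d) = (C * d) powr p" using Cd by (simp add: powr_diff)
        also have "(C * d) powr p + (C * d) powr 1 \<le> (C * d) powr p + (C * d) powr p"
          using Cd p by (intro add_mono powr_mono) auto
        finally show "\<bar>nonlin p (shoot d t)\<bar> \<le> 2 * (C * d) powr p" by simp
      qed (use s in auto)
      also have "\<dots> = (flux_const * (2 * C powr p)) * d powr p" using C d by (simp add: powr_mult)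
      also have "\<dots> \<le> K * d powr p" by (intro mult_right_mono) (auto simp: K_def)
      finally show ?thesis .
    qed
    have big: "(d / 2) powr (p + 1) \<le> \<bar>shoot d s\<bar> powr (p + 1)" if s: "s \<in> {0..\<sigma>}" for s
    proof -
      have fc: "continuous_on {0..1/2} (flux (\<lambda>t. nonlin p (shoot d t)))"
        using solution_continuous(2)[OF shoot_solution, of d] continuous_on_minus
        unfolding vel_def[abs_def] by fastforce
      have "norm (integral {0..s} (flux (\<lambda>t. nonlin p (shoot d t)))) \<le> K * d powr p * (s - 0)"
        by (rule integral_bound) (use s \<sigma> flux in \<open>auto intro: continuous_on_subset[OF fc]\<close>)
      also have "\<dots> \<le> K * d powr p * \<sigma>" using s K by (intro mult_left_mono) auto
      also have "\<dots> = d / 2"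
        using K d by (simp add: \<sigma>_def powr_diff field_simps)
      finally have "shoot d s \<ge> d / 2"
        using shoot_integral_solution[of d] s \<sigma> by (auto simp: integral_solution_def abs_le_iff)
      then show ?thesis using d p by (intro powr_mono2) auto
    qed
    have "a * ((d / 2) powr (p + 1) * \<sigma> powr \<alpha>) - b \<le> energy (shoot d) (vel d) (1/2)"
      by (rule ab(2)[OF shoot_solution \<sigma>]) (use big in blast)
    moreover have "a * ((d / 2) powr (p + 1) * \<sigma> powr \<alpha>) = a' * d powr \<gamma>"
    proof -
      have "(d / 2) powr (p + 1) = d powr (p + 1) * (1/2) powr (p + 1)"
        using d by (subst powr_mult[symmetric]) auto
      moreover have "\<sigma> powr \<alpha> = (1 / (2 * K)) powr \<alpha> * d powr ((1 - p) * \<alpha>)"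
        unfolding \<sigma>_def using K d by (subst powr_mult) (auto simp: powr_powr)
      moreover have "d powr (p + 1) * d powr ((1 - p) * \<alpha>) = d powr \<gamma>"
        by (simp add: powr_add[symmetric] \<gamma>_def mult.commute)
      ultimately show ?thesis by (simp add: a'_def algebra_simps)
    qed
    ultimately show ?thesis by simp
  qed
  have "filterlim (\<lambda>d. exp (\<gamma> * ln d)) at_top at_top"
    by (intro filterlim_compose[OF exp_at_top] filterlim_tendsto_pos_mult_at_top[OF tendsto_const \<gamma>] ln_at_top)
  then have "filterlim (\<lambda>d. d powr \<gamma>) at_top at_top"
    by (rule filterlim_at_top_mono) (auto simp: eventually_at_top_linorder powr_def intro!: exI[of _ 1])
  then have "filterlim (\<lambda>d. a' * d powr \<gamma>) at_top at_top"
    using a' by (intro filterlim_tendsto_pos_mult_at_top[OF tendsto_const]) auto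
  then have "filterlim (\<lambda>d. - b + a' * d powr \<gamma>) at_top at_top"
    by (intro filterlim_tendsto_add_at_top[OF tendsto_const])
  then show ?thesis
    by (rule filterlim_at_top_mono) (use low in \<open>auto simp: eventually_at_top_linorder intro!: exI[of _ 1]\<close>)
qed

end

section \<open>Rotation in the phase plane\<close>

context jacobi
begin

text \<open>At high energy the phase \<open>arctan (w' / (K w))\<close> decreases with speed at least \<open>K / 2\<close>, so \<open>w\<close> cannot
  keep its sign on an interval of length \<open>2 \<pi> / K\<close>: either \<open>w\<close> is large, and with it the superlinear restoring force, or
  \<open>w'\<close> is large.\<close>

lemma zero_in_interval:
  assumes K: "K > 0"
  shows "\<exists>M. \<forall>w w1 w2 a b. solution (1/2) w w1 w2 \<longrightarrow> 1/4 \<le> a \<longrightarrow> b \<le> 1/2 \<longrightarrow> a + 2 * pi / K \<le> b \<longrightarrow>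
    (\<forall>s\<in>{a..b}. M \<le> energy w w1 s) \<longrightarrow> (\<exists>s\<in>{a..b}. w s = 0)"
proof -
  define H where "H = 8 * (\<alpha> + \<beta>)\<^sup>2 + \<mu> + K\<^sup>2 / 8"
  have H: "H > 0" using \<mu> by (simp add: H_def add_nonneg_pos add_pos_nonneg)
  have "\<mu> / (2 * H) > 0" using \<mu> H by simp
  from square_le_eps_powr[OF p this] obtain C where C: "C \<ge> 0"
    "\<And>w::real. w\<^sup>2 \<le> \<mu> / (2 * H) * \<bar>w\<bar> powr (p + 1) + C" by blast
  define M where "M = 2 * (H * C) + \<mu> / 2"
  have "\<exists>s\<in>{a..b}. w s = 0"
    if w: "solution (1/2) w w1 w2" and ab: "1/4 \<le> a" "b \<le> 1/2" "a + 2 * pi / K \<le> b"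
      and en: "\<forall>s\<in>{a..b}. M \<le> energy w w1 s" for w w1 w2 a b
  proof (rule ccontr)
    assume "\<not> ?thesis"
    then have nz: "w s \<noteq> 0" if "s \<in> {a..b}" for s using that by blast
    have sub: "{a..b} \<subseteq> {0..1/2}" using ab by auto
    have key: "(K\<^sup>2 * (w s)\<^sup>2 + (w1 s)\<^sup>2) / 2 \<le> (w1 s)\<^sup>2 - w s * w2 s" if s: "s \<in> {a..b}" for s
    proof -
      define r where "r = s * (1 - s)"
      have "s - 1/4 \<ge> 0" "1/2 - s \<ge> 0" using s ab by auto
      then have "0 \<le> (s - 1/4) * (3/4 - s)" by (intro mult_nonneg_nonneg) auto
      moreover have "0 \<le> (1/2 - s)\<^sup>2" by simp
      moreover have "(s - 1/4) * (3/4 - s) = r - 3/16" "(1/2 - s)\<^sup>2 = 1/4 - r"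
        by (simp_all add: r_def power2_eq_square field_simps)
      ultimately have r: "3/16 \<le> r" "r \<le> 1/4" by linarith+
      define X Y Z c v where "X = (w s)\<^sup>2" and "Y = (w1 s)\<^sup>2" and "Z = \<bar>w s\<bar> powr (p + 1)"
        and "c = \<alpha> * (1 - s) - \<beta> * s" and "v = w s * w1 s"
      have pos: "X \<ge> 0" "Y \<ge> 0" "Z \<ge> 0" by (auto simp: X_def Y_def Z_def)
      have c: "c\<^sup>2 \<le> (\<alpha> + \<beta>)\<^sup>2"
      proof -
        have "0 \<le> \<alpha> * s" "0 \<le> \<beta> * s" "\<alpha> * s \<le> \<alpha> * 1" "\<beta> * s \<le> \<beta> * 1"
          using s ab \<alpha>_pos \<beta> by (auto intro!: mult_left_mono)
        moreover have "c = \<alpha> - \<alpha> * s - \<beta> * s" by (simp add: c_def algebra_simps)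
        ultimately have "\<bar>c\<bar> \<le> \<bar>\<alpha> + \<beta>\<bar>" using \<alpha>_pos \<beta> by linarith
        then show ?thesis by (simp add: abs_le_square_iff)
      qed
      have cv: "- (c * v) \<le> Y / 32 + 8 * (\<alpha> + \<beta>)\<^sup>2 * X"
      proof -
        have "0 \<le> (w1 s + 16 * (c * w s))\<^sup>2 / 32" by simp
        also have "\<dots> = Y / 32 + 8 * (c\<^sup>2 * X) + c * v"
          by (simp add: Y_def X_def v_def power2_eq_square field_simps)
        also have "c\<^sup>2 * X \<le> (\<alpha> + \<beta>)\<^sup>2 * X" using c pos by (intro mult_right_mono)
        finally show ?thesis by simp
      qed
      have n: "w s * nonlin p (w s) = Z - X"
        by (simp add: nonlin_def Z_def X_def abs_powr_Suc power2_eq_square right_diff_distrib mult.commute mult.left_commute)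
      have "r * (w s * w2 s) = w s * (s * (1 - s) * w2 s)" by (simp add: r_def)
      also have "\<dots> = - c * v - \<mu> * (Z - X)"
        using s sub unfolding n[symmetric] by (subst solution_derivs(3)[OF w]) (auto simp: c_def v_def algebra_simps)
      finally have ww2: "r * (w s * w2 s) = - c * v - \<mu> * (Z - X)" .
      have "M \<le> r * Y / 2 + \<mu> * (Z / (p + 1) - X / 2) + \<mu> / 2"
        using en s by (simp add: energy_def potential_def r_def X_def Y_def Z_def)
      also have "\<dots> \<le> Y / 8 + \<mu> * Z + \<mu> / 2"
      proof -
        have "r * Y \<le> 1/4 * Y" using r pos by (intro mult_right_mono) auto
        moreover have "\<mu> * (Z / (p + 1) - X / 2) \<le> \<mu> * Z"
        proof (rule mult_left_mono)
          have "Z / (p + 1) \<le> Z / 1" using p pos by (intro divide_left_mono) auto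
          then show "Z / (p + 1) - X / 2 \<le> Z" using pos by simp
        qed (use \<mu> in simp)
        ultimately show ?thesis by simp
      qed
      finally have e: "H * C \<le> Y / 16 + \<mu> * Z / 2" by (simp add: M_def)
      have "H * X \<le> H * (\<mu> / (2 * H) * Z + C)" using C(2)[of "w s"] H by (intro mult_left_mono) (auto simp: X_def Z_def)
      also have "\<dots> = \<mu> * Z / 2 + H * C" using H by (simp add: distrib_left)
      finally have hx: "H * X \<le> Y / 16 + \<mu> * Z" using e by simp
      have "r * ((K\<^sup>2 * X + Y) / 2) \<le> r * Y / 2 + K\<^sup>2 / 8 * X"
      proof -
        have "r * (K\<^sup>2 * X) \<le> 1/4 * (K\<^sup>2 * X)" using r pos by (intro mult_right_mono) auto
        then show ?thesis by (simp add: algebra_simps)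
      qed
      also have "\<dots> \<le> r * Y - r * (w s * w2 s)"
      proof -
        have "3/16 * Y \<le> r * Y" using r pos by (intro mult_right_mono) auto
        moreover have "H * X = 8 * (\<alpha> + \<beta>)\<^sup>2 * X + \<mu> * X + K\<^sup>2 / 8 * X" by (simp add: H_def algebra_simps)
        moreover have "\<mu> * (Z - X) = \<mu> * Z - \<mu> * X" by (simp add: algebra_simps)
        ultimately show ?thesis unfolding ww2 using cv hx by simp
      qed
      finally have "r * ((K\<^sup>2 * X + Y) / 2) \<le> r * (Y - w s * w2 s)" by (simp add: right_diff_distrib)
      then show ?thesis using r by (simp add: X_def Y_def)
    qed
    define \<psi> where "\<psi> s = arctan (w1 s / (K * w s))" for s
    define \<psi>' where "\<psi>' s = K * (w s * w2 s - (w1 s)\<^sup>2) / (K\<^sup>2 * (w s)\<^sup>2 + (w1 s)\<^sup>2)" for s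
    have D: "((\<lambda>s. - (\<psi> s + K / 2 * s)) has_real_derivative - (\<psi>' s + K / 2)) (at s within {a..b})" if s: "s \<in> {a..b}" for s
    proof -
      note d = DERIV_subset[OF solution_derivs(1)[OF w] sub, of s] DERIV_subset[OF solution_derivs(2)[OF w] sub, of s]
      have ws: "w s \<noteq> 0" "K * w s \<noteq> 0" using nz[OF s] K by auto
      have "((\<lambda>s. w1 s / (K * w s)) has_real_derivative (w2 s * (K * w s) - w1 s * (K * w1 s)) / ((K * w s) * (K * w s))) (at s within {a..b})"
        using d s sub ws by (auto intro!: derivative_eq_intros)
      from DERIV_image_chain[OF has_field_derivative_at_within[OF DERIV_arctan] this]
      have "(\<psi> has_real_derivative inverse (1 + (w1 s / (K * w s))\<^sup>2) * ((w2 s * (K * w s) - w1 s * (K * w1 s)) / ((K * w s) * (K * w s)))) (at s within {a..b})"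
        by (simp add: \<psi>_def[abs_def] o_def)
      moreover have "inverse (1 + (w1 s / (K * w s))\<^sup>2) * ((w2 s * (K * w s) - w1 s * (K * w1 s)) / ((K * w s) * (K * w s))) = \<psi>' s"
      proof -
        have "1 + (w1 s / (K * w s))\<^sup>2 = (K\<^sup>2 * (w s)\<^sup>2 + (w1 s)\<^sup>2) / ((K * w s) * (K * w s))"
          using ws by (simp add: power2_eq_square field_simps)
        then have "inverse (1 + (w1 s / (K * w s))\<^sup>2) = ((K * w s) * (K * w s)) / (K\<^sup>2 * (w s)\<^sup>2 + (w1 s)\<^sup>2)"
          by (simp only: inverse_divide)
        moreover have "w2 s * (K * w s) - w1 s * (K * w1 s) = K * (w s * w2 s - (w1 s)\<^sup>2)"
          by (simp add: power2_eq_square algebra_simps)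
        ultimately show ?thesis using ws unfolding \<psi>'_def by simp
      qed
      ultimately have "(\<psi> has_real_derivative \<psi>' s) (at s within {a..b})" by simp
      then show ?thesis by (auto intro!: derivative_eq_intros)
    qed
    have ab': "a \<le> b" using ab(3) K by (smt (verit) divide_pos_pos pi_gt_zero mult_pos_pos)
    have "- (\<psi> a + K / 2 * a) \<le> - (\<psi> b + K / 2 * b)"
    proof (rule mono_of_deriv_within[OF D])
      fix s assume "a < s" "s < b"
      then have s: "s \<in> {a..b}" by auto
      define q where "q = K\<^sup>2 * (w s)\<^sup>2 + (w1 s)\<^sup>2"
      have q: "q > 0" unfolding q_def using nz[OF s] K by (intro add_pos_nonneg mult_pos_pos) auto
      have "K * (q / 2) \<le> K * ((w1 s)\<^sup>2 - w s * w2 s)"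
        using key[OF s] K unfolding q_def by (intro mult_left_mono) auto
      then have "K * (w s * w2 s - (w1 s)\<^sup>2) \<le> - (K / 2) * q" by (simp add: right_diff_distrib)
      then have "\<psi>' s \<le> - (K / 2)" using q unfolding \<psi>'_def q_def[symmetric] by (simp add: divide_le_eq)
      then show "0 \<le> - (\<psi>' s + K / 2)" by simp
    qed (use ab' in auto)
    then have "K / 2 * (b - a) \<le> \<psi> a - \<psi> b" by (simp add: algebra_simps diff_divide_distrib)
    also have "\<dots> < pi" unfolding \<psi>_def using arctan_bounded[of "w1 a / (K * w a)"] arctan_bounded[of "w1 b / (K * w b)"] by simp
    finally have "K / 2 * (b - a) < pi" .
    moreover have "K / 2 * (2 * pi / K) \<le> K / 2 * (b - a)" using ab K by (intro mult_left_mono) auto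
    ultimately show False using K by simp
  qed
  then show ?thesis by blast
qed

text \<open>High energy at \<open>1/2\<close> forces high energy on all of \<open>{1/4..1/2}\<close>, by \<open>energy_growth\<close> read backwards; then each
  of the disjoint windows of length \<open>h\<close> contains a zero.\<close>

lemma many_zeros:
  "\<exists>M. \<forall>w w1 w2. solution (1/2) w w1 w2 \<longrightarrow> M \<le> energy w w1 (1/2) \<longrightarrow>
    (\<exists>z::nat \<Rightarrow> real. (\<forall>i\<le>j. 0 < z i \<and> z i \<le> 1/2 \<and> w (z i) = 0) \<and> (\<forall>i<j. z i < z (Suc i)))"
proof -
  define h where "h = 1 / (8 * (real j + 1))"
  have h: "h > 0" "2 * (real j + 1) * h = 1/4" by (auto simp: h_def field_simps)
  define K where "K = 2 * pi / h"
  have K: "K > 0" "2 * pi / K = h" using h by (auto simp: K_def)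
  obtain M where M: "\<And>w w1 w2 a b. solution (1/2) w w1 w2 \<Longrightarrow> 1/4 \<le> a \<Longrightarrow> b \<le> 1/2 \<Longrightarrow> a + h \<le> b \<Longrightarrow>
    (\<forall>s\<in>{a..b}. M \<le> energy w w1 s) \<Longrightarrow> (\<exists>s\<in>{a..b}. w s = 0)"
    using zero_in_interval[OF K(1)] unfolding K(2) by blast
  show ?thesis
  proof (intro exI[of _ "exp (2 * \<beta>) * M"] allI impI)
    fix w w1 w2 assume w: "solution (1/2) w w1 w2" and E: "exp (2 * \<beta>) * M \<le> energy w w1 (1/2)"
    have en: "M \<le> energy w w1 s" if s: "s \<in> {1/4..1/2}" for s
    proof -
      have "exp (2 * \<beta>) * M \<le> exp (2 * \<beta>) * energy w w1 s"
        by (rule order_trans[OF E energy_growth[OF _ w]]) (use s in auto)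
      then show ?thesis by simp
    qed
    define a where "a i = 1/4 + 2 * real i * h" for i
    have a: "1/4 \<le> a i" "a i + h \<le> 1/2" if "i \<le> j" for i
    proof -
      show "1/4 \<le> a i" using h by (simp add: a_def)
      have "2 * real i * h \<le> 2 * real j * h" using that h by (intro mult_right_mono) auto
      moreover have "2 * real j * h + 2 * h = 1/4" using h(2) by (simp add: algebra_simps)
      ultimately show "a i + h \<le> 1/2" unfolding a_def using h(1) by linarith
    qed
    have "\<exists>s\<in>{a i..a i + h}. w s = 0" if "i \<le> j" for i
      by (rule M[OF w]) (use a[OF that] en in auto)
    then obtain z where z: "\<And>i. i \<le> j \<Longrightarrow> z i \<in> {a i..a i + h} \<and> w (z i) = 0" by metis
    have "z i < z (Suc i)" if "i < j" for i
      using z[of i] z[of "Suc i"] that h by (auto simp: a_def algebra_simps)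
    moreover have "0 < z i \<and> z i \<le> 1/2 \<and> w (z i) = 0" if "i \<le> j" for i
      using z[OF that] a[OF that] by auto
    ultimately show "\<exists>z::nat \<Rightarrow> real. (\<forall>i\<le>j. 0 < z i \<and> z i \<le> 1/2 \<and> w (z i) = 0) \<and> (\<forall>i<j. z i < z (Suc i))"
      by blast
  qed
qed

text \<open>The angle is lifted over the half strip of all pairs \<open>(d, s)\<close>, which is contractible; so it is at the
  same time a continuous function of the initial value and the rotation angle along each solution.\<close>

lemma polar_coordinates:
  "\<exists>\<rho> \<theta>. continuous_on ({0<..} \<times> {0..1/2}) (\<lambda>(d, s). \<rho> d s) \<and>
    continuous_on ({0<..} \<times> {0..1/2}) (\<lambda>(d, s). \<theta> d s) \<and>
    (\<forall>d>0. \<theta> d 0 = 0) \<and>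
    (\<forall>d>0. \<forall>s\<in>{0..1/2}. \<rho> d s > 0 \<and> shoot d s = \<rho> d s * cos (\<theta> d s) \<and> s * vel d s = \<rho> d s * (sin (\<theta> d s) :: real))"
proof -
  let ?U = "{0<..} \<times> {0..1/2} :: (real \<times> real) set"
  let ?f = "\<lambda>z. Complex (shoot (fst z) (snd z)) (snd z * vel (fst z) (snd z))"
  have sc: "continuous_on ?U (\<lambda>z. shoot (fst z) (snd z))" "continuous_on ?U (\<lambda>z. vel (fst z) (snd z))"
    using shoot_continuous by (auto simp: case_prod_unfold intro: continuous_on_subset)
  have cf: "continuous_on ?U ?f"
    unfolding Complex_eq by (intro continuous_intros sc)
  have "convex ?U" by (intro convex_Times) auto
  then have ctr: "contractible ?U" by (rule convex_imp_contractible)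
  have nz: "?f z \<noteq> 0" if "z \<in> ?U" for z
    using that shoot_nontrivial[of "fst z" "snd z"]
    by (cases "snd z = 0") (auto simp: complex_eq_iff shoot_0)
  from continuous_logarithm_on_contractible[OF cf ctr nz]
  obtain L where L: "continuous_on ?U L" "\<And>z. z \<in> ?U \<Longrightarrow> ?f z = exp (L z)" by blast
  define m where "m = Im (L (1, 0))"
  have re: "shoot (fst z) (snd z) = exp (Re (L z)) * cos (Im (L z))"
    "snd z * vel (fst z) (snd z) = exp (Re (L z)) * sin (Im (L z))" if "z \<in> ?U" for z
  proof -
    have "Re (?f z) = Re (exp (L z))" "Im (?f z) = Im (exp (L z))" using L(2)[OF that] by auto
    then show "shoot (fst z) (snd z) = exp (Re (L z)) * cos (Im (L z))"
      "snd z * vel (fst z) (snd z) = exp (Re (L z)) * sin (Im (L z))" by (auto simp: Re_exp Im_exp)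
  qed
  have mult: "\<exists>n::int. Im (L (d, 0)) = 2 * pi * n" if "d > 0" for d
  proof -
    have "d = exp (Re (L (d, 0))) * cos (Im (L (d, 0)))" "sin (Im (L (d, 0))) = 0"
      using re[of "(d, 0)"] that by (auto simp: shoot_0)
    moreover from this that have "0 < exp (Re (L (d, 0))) * cos (Im (L (d, 0)))" by simp
    then have "cos (Im (L (d, 0))) > 0" using exp_gt_zero zero_less_mult_pos by blast
    ultimately have "cos (Im (L (d, 0))) = 1" using sin_zero_abs_cos_one by fastforce
    then show ?thesis by (auto simp: cos_one_2pi_int mult.commute)
  qed
  have "(\<lambda>d. Im (L (d, 0))) constant_on {0<..}"
  proof (rule continuous_discrete_range_constant)
    show "continuous_on {0<..} (\<lambda>d. Im (L (d, 0)))"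
      by (intro continuous_intros continuous_on_compose2[OF L(1)]) auto
    fix d :: real assume "d \<in> {0<..}"
    then obtain n :: int where n: "Im (L (d, 0)) = 2 * pi * n" using mult by auto
    show "\<exists>e>0. \<forall>y. y \<in> {0<..} \<and> Im (L (y, 0)) \<noteq> Im (L (d, 0)) \<longrightarrow> e \<le> norm (Im (L (y, 0)) - Im (L (d, 0)))"
    proof (intro exI[of _ "2 * pi"] conjI allI impI)
      fix y :: real assume y: "y \<in> {0<..} \<and> Im (L (y, 0)) \<noteq> Im (L (d, 0))"
      then obtain k :: int where k: "Im (L (y, 0)) = 2 * pi * k" using mult by auto
      then have "k \<noteq> n" using y n by auto
      then have "1 \<le> \<bar>real_of_int (k - n)\<bar>" by linarith
      then have "2 * pi * 1 \<le> 2 * pi * \<bar>real_of_int (k - n)\<bar>" by (intro mult_left_mono) auto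
      also have "\<dots> = norm (Im (L (y, 0)) - Im (L (d, 0)))"
        unfolding k n by (simp add: abs_mult right_diff_distrib[symmetric])
      finally show "2 * pi \<le> norm (Im (L (y, 0)) - Im (L (d, 0)))" by simp
    qed simp
  qed (simp add: convex_connected)
  then have const: "Im (L (d, 0)) = m" if "d > 0" for d
    using that unfolding constant_on_def m_def by force
  obtain n :: int where n: "m = 2 * pi * n" using mult[of 1] by (auto simp: m_def)
  have per: "cos (x - m) = cos x" "sin (x - m) = sin x" for x
    unfolding n cos_diff sin_diff by (simp_all add: cos_int_2pin sin_int_2pin)
  show ?thesis
    by (rule exI[of _ "\<lambda>d s. exp (Re (L (d, s)))"], rule exI[of _ "\<lambda>d s. Im (L (d, s)) - m"])
      (use re const in \<open>auto simp: per case_prod_unfold intro!: continuous_intros L(1)\<close>)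
qed

end

context subcritical_jacobi
begin

text \<open>As a function of the initial value, the state at \<open>s = 1/2\<close> is a spiral: bounded radius would mean bounded
  energy, and high energy produces zeros, each of which costs half a turn.\<close>

lemma shooting_curve:
  "\<exists>\<rho> \<theta>. continuous_on {0<..} \<rho> \<and> continuous_on {0<..} \<theta> \<and>
    (\<forall>d>0. \<rho> d > 0 \<and> shoot d (1/2) = \<rho> d * cos (\<theta> d) \<and> vel d (1/2) / 2 = \<rho> d * sin (\<theta> d)) \<and>
    filterlim \<rho> at_top at_top \<and> filterlim \<theta> at_bot at_top \<and>
    (\<forall>d>0. \<forall>j. \<theta> d \<le> - pi / 2 - real j * pi \<longrightarrow> at_least (Suc j) {s\<in>{0..1/2}. shoot d s = 0})"
proof -
  obtain \<rho> \<theta> where c: "continuous_on ({0<..} \<times> {0..1/2}) (\<lambda>(d, s). \<rho> d s)"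
    "continuous_on ({0<..} \<times> {0..1/2}) (\<lambda>(d, s). \<theta> d s)"
    and \<theta>0: "\<And>d. d > 0 \<Longrightarrow> \<theta> d 0 = 0"
    and pol: "\<And>d s. d > 0 \<Longrightarrow> s \<in> {0..1/2} \<Longrightarrow>
      \<rho> d s > 0 \<and> shoot d s = \<rho> d s * cos (\<theta> d s) \<and> s * vel d s = \<rho> d s * (sin (\<theta> d s) :: real)"
    using polar_coordinates by blast
  have pc: "continuous_on {0<..} (\<lambda>d::real. (d, 1/2::real))" by (intro continuous_intros)
  have c1: "continuous_on {0<..} (\<lambda>d. \<rho> d (1/2))" "continuous_on {0<..} (\<lambda>d. \<theta> d (1/2))"
    using continuous_on_compose2[OF c(1) pc] continuous_on_compose2[OF c(2) pc] by (auto simp: image_subset_iff)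
  have ang: "clockwise_angle (shoot d) (vel d) (\<theta> d) (\<rho> d) (1/2)" if d: "d > 0" for d
  proof
    show "continuous_on {0..1/2} (\<theta> d)"
    proof -
      have "continuous_on {0..1/2} (\<lambda>s::real. (d, s))" by (intro continuous_intros)
      from continuous_on_compose2[OF c(2) this] show ?thesis using d by (auto simp: image_subset_iff)
    qed
  qed (use pol[OF d] \<theta>0[OF d] solution_derivs(1)[OF shoot_solution] in auto)
  have "filterlim (\<lambda>d. \<rho> d (1/2)) at_top at_top"
    unfolding filterlim_at_top
  proof
    fix R :: real
    let ?R = "\<bar>R\<bar>"
    have "eventually (\<lambda>d. d > 0 \<and> ?R\<^sup>2 / 2 + \<mu> * ?R powr (p + 1) + \<mu> / 2 + 1 \<le> energy (shoot d) (vel d) (1/2)) at_top"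
      using energy_tends_to_infinity eventually_gt_at_top[of 0] unfolding filterlim_at_top by (auto intro: eventually_conj)
    then show "eventually (\<lambda>d. R \<le> \<rho> d (1/2)) at_top"
    proof eventually_elim
      case (elim d)
      show ?case
      proof (rule ccontr)
        let ?r = "\<rho> d (1/2)" and ?w = "shoot d (1/2)" and ?v = "vel d (1/2)"
        assume "\<not> R \<le> ?r"
        then have lt: "?r < ?R" by simp
        have P: "?r > 0" "?w = ?r * cos (\<theta> d (1/2))" "1/2 * ?v = ?r * sin (\<theta> d (1/2))" using pol[of d "1/2"] elim by auto
        have "\<bar>?w\<bar> \<le> ?r * 1" "\<bar>1/2 * ?v\<bar> \<le> ?r * 1"
          unfolding P(2,3) abs_mult using P(1) by (auto intro!: mult_left_mono)
        then have b: "\<bar>?w\<bar> \<le> ?R" "\<bar>?v / 2\<bar> \<le> \<bar>R\<bar>" using lt by auto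
        have "(?v / 2)\<^sup>2 \<le> ?R\<^sup>2" using b(2) by (metis abs_le_square_iff power2_abs)
        then have "(?v)\<^sup>2 / 8 \<le> ?R\<^sup>2 / 2" by (simp add: power_divide)
        moreover have "potential p ?w \<le> ?R powr (p + 1)"
        proof -
          have "potential p ?w \<le> \<bar>?w\<bar> powr (p + 1) / (p + 1)" by (simp add: potential_def)
          also have "\<dots> \<le> \<bar>?w\<bar> powr (p + 1) / 1" using p by (intro divide_left_mono) auto
          also have "\<dots> \<le> ?R powr (p + 1)" using b p by (auto intro!: powr_mono2)
          finally show ?thesis .
        qed
        then have "\<mu> * potential p ?w \<le> \<mu> * ?R powr (p + 1)" using \<mu> by (intro mult_left_mono) auto
        ultimately have "energy (shoot d) (vel d) (1/2) \<le> ?R\<^sup>2 / 2 + \<mu> * ?R powr (p + 1) + \<mu> / 2"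
          by (simp add: energy_def)
        then show False using elim by simp
      qed
    qed
  qed
  moreover have "filterlim (\<lambda>d. \<theta> d (1/2)) at_bot at_top"
    unfolding filterlim_at_bot
  proof
    fix B :: real
    obtain j :: nat where j: "\<bar>B\<bar> / pi \<le> real j" using real_arch_simple by blast
    then have jB: "- real j * pi \<le> B" by (simp add: field_simps abs_le_iff)
    obtain M where M: "\<And>w w1 w2. solution (1/2) w w1 w2 \<Longrightarrow> M \<le> energy w w1 (1/2) \<Longrightarrow>
      (\<exists>z::nat \<Rightarrow> real. (\<forall>i\<le>j. 0 < z i \<and> z i \<le> 1/2 \<and> w (z i) = 0) \<and> (\<forall>i<j. z i < z (Suc i)))"
      using many_zeros[of j] by blast
    have "eventually (\<lambda>d. d > 0 \<and> M \<le> energy (shoot d) (vel d) (1/2)) at_top"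
      using energy_tends_to_infinity eventually_gt_at_top[of 0] unfolding filterlim_at_top by (auto intro: eventually_conj)
    then show "eventually (\<lambda>d. \<theta> d (1/2) \<le> B) at_top"
    proof eventually_elim
      case (elim d)
      then obtain z :: "nat \<Rightarrow> real" where z: "\<forall>i\<le>j. 0 < z i \<and> z i \<le> 1/2 \<and> shoot d (z i) = 0" "\<forall>i<j. z i < z (Suc i)"
        using M[OF shoot_solution] by blast
      interpret clockwise_angle "shoot d" "vel d" "\<theta> d" "\<rho> d" "1/2" using ang elim by blast
      have "\<theta> d (1/2) \<le> - pi / 2 - real j * pi" by (rule angle_end_le[of j z]) (use z in auto)
      then show ?case using jB pi_gt_zero by linarith
    qed
  qed
  moreover have "at_least (Suc j) {s\<in>{0..1/2}. shoot d s = 0}" if "d > 0" "\<theta> d (1/2) \<le> - pi / 2 - real j * pi" for d j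
  proof -
    interpret clockwise_angle "shoot d" "vel d" "\<theta> d" "\<rho> d" "1/2" using ang that by blast
    show ?thesis unfolding at_least_def using zeros_of_angle_le[OF _ that(2)] by simp
  qed
  ultimately show ?thesis using c1 pol[of _ "1/2"]
    by (intro exI[of _ "\<lambda>d. \<rho> d (1/2)"] exI[of _ "\<lambda>d. \<theta> d (1/2)"]) auto
qed

end

section \<open>Matching the two shooting curves\<close>

lemma at_least_mono:
  assumes "at_least n A" "m \<le> n" "A \<subseteq> B"
  shows "at_least m B"
proof -
  obtain C where C: "C \<subseteq> A" "finite C" "card C = n" using assms by (auto simp: at_least_def)
  then obtain D where "D \<subseteq> C" "card D = m" using obtain_subset_with_card_n[of m C] assms by auto
  then show ?thesis unfolding at_least_def using C assms finite_subset[of D C] by blast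
qed

lemma at_least_inj_image:
  assumes "at_least n A" "inj_on f A"
  shows "at_least n (f ` A)"
proof -
  obtain C where C: "C \<subseteq> A" "finite C" "card C = n" using assms by (auto simp: at_least_def)
  then have "f ` C \<subseteq> f ` A" "finite (f ` C)" "card (f ` C) = n"
    using assms by (auto simp: card_image inj_on_subset)
  then show ?thesis unfolding at_least_def by blast
qed

text \<open>Induction on the number of zeros, splitting off the largest one.\<close>

lemma rolle_at_least:
  fixes f f' :: "real \<Rightarrow> real"
  assumes d: "\<And>s. (f has_real_derivative f' s) (at s)"
    and B: "at_least (Suc n) {s \<in> {a<..<b}. f s = 0}"
  shows "at_least n {s \<in> {a<..<b}. f' s = 0}"
proof -
  obtain B where B: "B \<subseteq> {s \<in> {a<..<b}. f s = 0}" "finite B" "card B = Suc n"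
    using B by (auto simp: at_least_def)
  have "\<exists>C. finite C \<and> card C = n \<and> (\<forall>c\<in>C. f' c = 0 \<and> c < Max B \<and> (\<exists>x\<in>B. x < c))"
    using B(2,3) B(1)
  proof (induction n arbitrary: B)
    case 0
    then show ?case by (intro exI[of _ "{}"]) auto
  next
    case (Suc n)
    define M where "M = Max B"
    have M: "M \<in> B" "\<And>x. x \<in> B \<Longrightarrow> x \<le> M" unfolding M_def using Suc.prems by (auto intro!: Max_in)
    let ?B = "B - {M}"
    have B': "finite ?B" "card ?B = Suc n" "?B \<subseteq> {s \<in> {a<..<b}. f s = 0}" using Suc.prems M by auto
    then have ne: "?B \<noteq> {}" by (metis card.empty nat.distinct(1))
    define M' where "M' = Max ?B"
    have M': "M' \<in> ?B" unfolding M'_def using B' ne by (intro Max_in)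
    obtain C where C: "finite C" "card C = n" "\<forall>c\<in>C. f' c = 0 \<and> c < M' \<and> (\<exists>x\<in>?B. x < c)"
      using Suc.IH[OF B'] unfolding M'_def by blast
    have lt: "M' < M" using M' M(2)[of M'] by auto
    have "M' \<in> {s \<in> {a<..<b}. f s = 0}" "M \<in> {s \<in> {a<..<b}. f s = 0}" using M' M(1) Suc.prems(3) by blast+
    then have ff: "f M' = f M" by simp
    have "\<exists>c. M' < c \<and> c < M \<and> (f has_real_derivative 0) (at c)"
    proof (rule Rolle[OF lt ff])
      show "continuous_on {M'..M} f"
        by (rule DERIV_continuous_on[OF has_field_derivative_at_within[OF d]])
      show "f differentiable (at x)" for x unfolding real_differentiable_def using d[of x] by blast
    qed
    then obtain c where c: "M' < c" "c < M" "(f has_real_derivative 0) (at c)" by blast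
    then have "f' c = 0" using DERIV_unique[OF d] by blast
    have cC: "c \<notin> C" using C(3) c(1) by force
    have "f' x = 0 \<and> x < M \<and> (\<exists>y\<in>B. y < x)" if "x \<in> insert c C" for x
    proof (cases "x = c")
      case True
      then show ?thesis using \<open>f' c = 0\<close> c M' by blast
    next
      case False
      then have "x \<in> C" using that by simp
      then have "f' x = 0" "x < M'" "\<exists>y\<in>?B. y < x" using C(3) by blast+
      then show ?thesis using lt by fastforce
    qed
    moreover have "finite (insert c C)" "card (insert c C) = Suc n" using C cC by auto
    ultimately show ?case unfolding M_def by blast
  qed
  then obtain C where C: "finite C" "card C = n" "\<forall>c\<in>C. f' c = 0 \<and> c < Max B \<and> (\<exists>x\<in>B. x < c)" by blast
  have "Max B \<in> B" using B by (intro Max_in) auto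
  then have "C \<subseteq> {s \<in> {a<..<b}. f' s = 0}" using C(3) B(1) by fastforce
  then show ?thesis unfolding at_least_def using C by blast
qed

text \<open>Otherwise the zeros accumulate, and the derivative vanishes at the limit.\<close>

lemma simple_zeros_finite:
  fixes f f' :: "real \<Rightarrow> real"
  assumes d: "\<And>s. (f has_real_derivative f' s) (at s)"
    and s: "\<And>s. s \<in> {a..b} \<Longrightarrow> f s = 0 \<Longrightarrow> f' s \<noteq> 0"
  shows "finite {s \<in> {a..b}. f s = 0}"
proof (rule ccontr)
  let ?Z = "{s \<in> {a..b}. f s = 0}"
  assume "infinite ?Z"
  then obtain x where x: "x \<in> {a..b}" "x islimpt ?Z"
    using compact_eq_Bolzano_Weierstrass[of "{a..b}"] compact_Icc[of a b] by (metis (no_types, lifting) mem_Collect_eq subsetI)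
  have "continuous_on {a..b} f" by (rule DERIV_continuous_on[OF has_field_derivative_at_within[OF d]])
  then have "closed ({a..b} \<inter> f -` {0})" by (intro continuous_closed_preimage) auto
  moreover have "{a..b} \<inter> f -` {0} = ?Z" by auto
  ultimately have "x \<in> ?Z" using x closed_limpt by auto
  then have "f x = 0" "f' x \<noteq> 0" using s by auto
  have "((\<lambda>y. (f y - f x) / (y - x)) \<longlongrightarrow> f' x) (at x)"
    using d[of x] by (simp add: has_field_derivative_iff)
  then have "eventually (\<lambda>y. (f y - f x) / (y - x) \<noteq> 0) (at x)"
    by (rule tendsto_imp_eventually_ne) fact
  then have "eventually (\<lambda>y. y \<notin> ?Z) (at x)"
    by eventually_elim (use \<open>f x = 0\<close> in auto)
  then show False using x(2) by (simp add: islimpt_iff_eventually)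
qed

text \<open>Two curves given in polar coordinates, both winding clockwise to infinity. Reflecting the second one,
  they meet at points arbitrarily far out. On the region \<open>1 \<le> d\<close>, \<open>1 \<le> e\<close> outside a square, \<open>\<rho>\<^sub>1 d - \<rho>\<^sub>2 e\<close> has
  opposite signs on the two coordinate rays and the total angle separates the inner from the outer boundary.\<close>

lemma spirals_meet:
  fixes \<rho>1 \<theta>1 \<rho>2 \<theta>2 :: "real \<Rightarrow> real" and k :: real
  assumes c: "continuous_on {0<..} \<rho>1" "continuous_on {0<..} \<theta>1" "continuous_on {0<..} \<rho>2" "continuous_on {0<..} \<theta>2"
    and \<rho>: "filterlim \<rho>1 at_top at_top" "filterlim \<rho>2 at_top at_top"
    and \<theta>: "filterlim \<theta>1 at_bot at_top" "filterlim \<theta>2 at_bot at_top"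
  obtains d e and j :: nat where "d \<ge> 1" "e \<ge> 1" "d \<ge> k" "e \<ge> k" "\<theta>1 d \<le> - k" "\<rho>1 d = \<rho>2 e"
    "\<theta>1 d + \<theta>2 e = - (2 * pi * real j)"
proof -
  have bdd: "\<exists>B. \<forall>x\<in>{1..D}. \<bar>f x\<bar> \<le> B" if "continuous_on {0<..} f" for f :: "real \<Rightarrow> real" and D
  proof -
    have "continuous_on {1..D} f" by (rule continuous_on_subset[OF that]) auto
    then have "bounded (f ` {1..D})" by (intro compact_imp_bounded compact_continuous_image) auto
    then obtain B where "\<forall>x\<in>f ` {1..D}. norm x \<le> B" unfolding bounded_iff by blast
    then show ?thesis by auto
  qed
  have ev_top: "\<exists>D. \<forall>x\<ge>D. f x > M" if "filterlim f at_top at_top" for f :: "real \<Rightarrow> real" and M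
    using that unfolding filterlim_at_top_dense eventually_at_top_linorder by blast
  have ev_bot: "\<exists>D. \<forall>x\<ge>D. f x \<le> M" if "filterlim f at_bot at_top" for f :: "real \<Rightarrow> real" and M
    using that unfolding filterlim_at_bot eventually_at_top_linorder by blast
  obtain D1 where D1: "\<And>x. x \<ge> D1 \<Longrightarrow> \<theta>1 x \<le> - k" using ev_bot[OF \<theta>(1), of "- k"] by blast
  define k' where "k' = max 1 (max D1 k)"
  obtain B1 B2 where "\<forall>x\<in>{1..k'}. \<bar>\<rho>1 x\<bar> \<le> B1" "\<forall>x\<in>{1..k'}. \<bar>\<rho>2 x\<bar> \<le> B2" using bdd c by metis
  moreover define Bm where "Bm = max B1 B2"
  ultimately have B: "\<bar>\<rho>1 x\<bar> \<le> Bm" "\<bar>\<rho>2 x\<bar> \<le> Bm" if "1 \<le> x" "x \<le> k'" for x using that by force+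
  obtain E1 E2 where E: "\<And>x. x \<ge> E1 \<Longrightarrow> \<rho>1 x > Bm" "\<And>x. x \<ge> E2 \<Longrightarrow> \<rho>2 x > Bm"
    using ev_top[OF \<rho>(1), of Bm] ev_top[OF \<rho>(2), of Bm] by blast
  define R0 where "R0 = max k' (max E1 E2)"
  have R0: "R0 \<ge> 1" "R0 \<ge> k'" "R0 \<ge> E1" "R0 \<ge> E2" by (auto simp: R0_def k'_def)
  obtain A1 A2 where A: "\<forall>x\<in>{1..1+R0}. \<bar>\<theta>1 x\<bar> \<le> A1" "\<forall>x\<in>{1..1+R0}. \<bar>\<theta>2 x\<bar> \<le> A2" using bdd c by metis
  \<comment> \<open>So many turns that the total angle stays above \<open>- 2 pi j\<close> on the inner square.\<close>
  obtain j :: nat where j: "A1 + A2 \<le> real j" using real_arch_simple by blast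
  have "1 \<le> 2 * pi" using pi_ge_two by linarith
  then have "1 * real j \<le> 2 * pi * real j" by (rule mult_right_mono) simp
  then have j2: "A1 + A2 \<le> 2 * pi * real j" using j by simp
  have upper: "\<exists>S. \<forall>x\<ge>1. f x \<le> S" if cf: "continuous_on {0<..} f" "filterlim f at_bot at_top" for f :: "real \<Rightarrow> real"
  proof -
    obtain D where D: "\<forall>x\<ge>D. f x \<le> 0" using ev_bot[OF cf(2)] by blast
    obtain S where S: "\<forall>x\<in>{1..D}. \<bar>f x\<bar> \<le> S" using bdd[OF cf(1)] by blast
    have "f x \<le> max S 0" if "x \<ge> 1" for x
      using D[rule_format, of x] bspec[OF S, of x] that by (cases "x \<le> D") auto
    then show ?thesis by blast
  qed
  obtain S1 S2 where S: "\<forall>x\<ge>1. \<theta>1 x \<le> S1" "\<forall>x\<ge>1. \<theta>2 x \<le> S2"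
    using upper[OF c(2) \<theta>(1)] upper[OF c(4) \<theta>(2)] by blast
  obtain G1 G2 where G: "\<forall>x\<ge>G1. \<theta>1 x \<le> - (2 * pi * real j) - S2" "\<forall>x\<ge>G2. \<theta>2 x \<le> - (2 * pi * real j) - S1"
    using ev_bot[OF \<theta>(1)] ev_bot[OF \<theta>(2)] by metis
  define R1 where "R1 = max R0 (max G1 G2)"
  have R1: "R0 \<le> R1" "G1 \<le> R1" "G2 \<le> R1" by (auto simp: R1_def)
  \<comment> \<open>Polar-like coordinates for the maximum norm: \<open>x\<close> is the distance from the corner \<open>(1, 1)\<close>, and \<open>y\<close> runs from the
    ray \<open>d = 1\<close> to the ray \<open>e = 1\<close>.\<close>
  define d e where "d x y = 1 + x * min 1 (2 * y)" and "e x y = 1 + x * min 1 (2 - 2 * y)" for x y :: real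
  have de1: "d x y \<ge> 1" "e x y \<ge> 1" if "x \<ge> R0" "y \<in> {0..1}" for x y
    using that R0 by (auto simp: d_def e_def)
  have demax: "d x y = 1 + x \<or> e x y = 1 + x" if "y \<in> {0..1}" for x y
    using that by (auto simp: d_def e_def min_def)
  have dele: "d x y \<le> 1 + x" "e x y \<le> 1 + x" if "x \<ge> R0" for x y
    using that R0 mult_left_mono[of "min 1 (2 * y)" 1 x] mult_left_mono[of "min 1 (2 - 2 * y)" 1 x]
    by (auto simp: d_def e_def)
  let ?S = "{R0..R1} \<times> {0..1} :: (real \<times> real) set"
  have dc: "continuous_on ?S (\<lambda>z. d (fst z) (snd z))" "continuous_on ?S (\<lambda>z. e (fst z) (snd z))"
    unfolding d_def e_def by (intro continuous_intros)+
  have img: "(\<lambda>z. d (fst z) (snd z)) ` ?S \<subseteq> {0<..}" "(\<lambda>z. e (fst z) (snd z)) ` ?S \<subseteq> {0<..}"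
    using de1 by (fastforce dest: order_trans[OF zero_less_one[THEN less_imp_le]])+
  have "\<exists>x\<in>{R0..R1}. \<exists>y\<in>{0..1}. - (\<theta>1 (d x y) + \<theta>2 (e x y) + 2 * pi * real j) = 0 \<and> \<rho>1 (d x y) - \<rho>2 (e x y) = 0"
  proof (rule poincare_miranda[OF R1(1)])
    show "continuous_on ?S (\<lambda>(x, y). - (\<theta>1 (d x y) + \<theta>2 (e x y) + 2 * pi * real j))"
      unfolding case_prod_unfold
      by (intro continuous_intros continuous_on_compose2[OF c(2) dc(1) img(1)] continuous_on_compose2[OF c(4) dc(2) img(2)])
    show "continuous_on ?S (\<lambda>(x, y). \<rho>1 (d x y) - \<rho>2 (e x y))"
      unfolding case_prod_unfold
      by (intro continuous_intros continuous_on_compose2[OF c(1) dc(1) img(1)] continuous_on_compose2[OF c(3) dc(2) img(2)])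
    show "- (\<theta>1 (d R0 y) + \<theta>2 (e R0 y) + 2 * pi * real j) \<le> 0" if y: "y \<in> {0..1}" for y
    proof -
      have "\<bar>\<theta>1 (d R0 y)\<bar> \<le> A1" "\<bar>\<theta>2 (e R0 y)\<bar> \<le> A2"
        using A de1[OF order_refl y] dele[OF order_refl] by auto
      then show ?thesis using j2 by linarith
    qed
    show "0 \<le> - (\<theta>1 (d R1 y) + \<theta>2 (e R1 y) + 2 * pi * real j)" if y: "y \<in> {0..1}" for y
    proof -
      have a: "\<theta>1 (d R1 y) \<le> S1" "\<theta>2 (e R1 y) \<le> S2" using S de1[OF R1(1) y] by auto
      show ?thesis using demax[OF y, of R1]
      proof
        assume "d R1 y = 1 + R1"
        then have "\<theta>1 (d R1 y) \<le> - (2 * pi * real j) - S2" using G(1) R1 by auto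
        then show ?thesis using a by linarith
      next
        assume "e R1 y = 1 + R1"
        then have "\<theta>2 (e R1 y) \<le> - (2 * pi * real j) - S1" using G(2) R1 by auto
        then show ?thesis using a by linarith
      qed
    qed
    show "\<rho>1 (d x 0) - \<rho>2 (e x 0) \<le> 0" if x: "x \<in> {R0..R1}" for x
      using B(1)[of 1] E(2)[of "1 + x"] x R0 by (auto simp: d_def e_def k'_def)
    show "0 \<le> \<rho>1 (d x 1) - \<rho>2 (e x 1)" if x: "x \<in> {R0..R1}" for x
      using B(2)[of 1] E(1)[of "1 + x"] x R0 by (auto simp: d_def e_def k'_def)
  qed simp
  then obtain x y where xy: "x \<in> {R0..R1}" "y \<in> {0..1}" "\<theta>1 (d x y) + \<theta>2 (e x y) = - (2 * pi * real j)" "\<rho>1 (d x y) = \<rho>2 (e x y)"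
    by (auto simp: algebra_simps)
  have x: "x \<ge> R0" using xy by simp
  note one = de1[OF x xy(2)]
  have large: "d x y > k'" "e x y > k'"
  proof -
    have "\<rho>1 (d x y) > Bm" using demax[OF xy(2), of x] E(1)[of "1 + x"] E(2)[of "1 + x"] x R0 xy(4) by auto
    then show "d x y > k'" "e x y > k'"
      using B(1)[OF one(1)] B(2)[OF one(2)] xy(4) by fastforce+
  qed
  show ?thesis
    by (rule that[of "d x y" "e x y" j]) (use one large xy D1 in \<open>auto simp: k'_def\<close>)
qed

locale bi_subcritical_jacobi = L: subcritical_jacobi \<alpha> \<beta> \<mu> p + R: subcritical_jacobi \<beta> \<alpha> \<mu> p
  for \<alpha> \<beta> \<mu> p
begin

text \<open>The solution shot from \<open>0\<close> and the reflection of the one shot from \<open>1\<close> are joined at \<open>1/2\<close>, where \<open>spirals_meet\<close>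
  makes values and derivatives agree; the equation then matches the second derivatives. Zeros are counted
  on the left half only.\<close>

theorem nodal_profile:
  fixes k :: nat
  obtains W W1 W2 :: "real \<Rightarrow> real" where
    "\<And>s. (W has_real_derivative W1 s) (at s)" "\<And>s. (W1 has_real_derivative W2 s) (at s)"
    "continuous_on UNIV W2"
    "\<And>s. s \<in> {0..1} \<Longrightarrow> s * (1 - s) * W2 s + (\<alpha> * (1 - s) - \<beta> * s) * W1 s + \<mu> * nonlin p (W s) = 0"
    "W 0 \<ge> real k" "W 0 > 0"
    "finite {s \<in> {0..1}. W s = 0}" "\<And>s. s \<in> {0..1} \<Longrightarrow> W s = 0 \<Longrightarrow> s \<in> {0<..<1}"
    "at_least (Suc k) {s \<in> {0<..<1}. W s = 0}"
    "finite {s \<in> {0..1}. W1 s = 0}" "\<And>s. s \<in> {0..1} \<Longrightarrow> W1 s = 0 \<Longrightarrow> s \<in> {0<..<1}"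
    "at_least k {s \<in> {0<..<1}. W1 s = 0}"
    "\<exists>s\<in>{0<..<1}. W s < 0"
proof -
  obtain \<rho>1 \<theta>1 where c1: "continuous_on {0<..} \<rho>1" "continuous_on {0<..} \<theta>1"
    and pol1': "\<forall>d>0. \<rho>1 d > 0 \<and> L.shoot d (1/2) = \<rho>1 d * cos (\<theta>1 d) \<and> L.vel d (1/2) / 2 = \<rho>1 d * sin (\<theta>1 d)"
    and lim1: "filterlim \<rho>1 at_top at_top" "filterlim \<theta>1 at_bot at_top"
    and zer1': "\<forall>d>0. \<forall>j. \<theta>1 d \<le> - pi / 2 - real j * pi \<longrightarrow> at_least (Suc j) {s\<in>{0..1/2}. L.shoot d s = 0}"
    using L.shooting_curve by (elim exE conjE) (rule that, assumption+)
  note pol1 = pol1'[rule_format]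
  note zer1 = zer1'[rule_format]
  obtain \<rho>2 \<theta>2 where c2: "continuous_on {0<..} \<rho>2" "continuous_on {0<..} \<theta>2"
    and pol2': "\<forall>d>0. \<rho>2 d > 0 \<and> R.shoot d (1/2) = \<rho>2 d * cos (\<theta>2 d) \<and> R.vel d (1/2) / 2 = \<rho>2 d * sin (\<theta>2 d)"
    and lim2: "filterlim \<rho>2 at_top at_top" "filterlim \<theta>2 at_bot at_top"
    and zer2': "\<forall>d>0. \<forall>j. \<theta>2 d \<le> - pi / 2 - real j * pi \<longrightarrow> at_least (Suc j) {s\<in>{0..1/2}. R.shoot d s = 0}"
    using R.shooting_curve by (elim exE conjE) (rule that, assumption+)
  note pol2 = pol2'[rule_format]
  \<comment> \<open>Large enough for \<open>k + 1\<close> zeros, and for both initial values to exceed the constant solutions.\<close>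
  define k' where "k' = max (real k + 2) (pi / 2 + real k * pi)"
  obtain d e and j :: nat where de: "d \<ge> k'" "e \<ge> k'" "\<theta>1 d \<le> - k'" "\<rho>1 d = \<rho>2 e" "\<theta>1 d + \<theta>2 e = - (2 * pi * real j)"
    by (rule spirals_meet[OF c1 c2 lim1(1) lim2(1) lim1(2) lim2(2), of k'])
  have de2: "d \<ge> 2" "e \<ge> 2" "d \<ge> real k" using de by (auto simp: k'_def)
  have zeros: "at_least (Suc k) {s\<in>{0..1/2}. L.shoot d s = 0}"
    by (rule zer1) (use de de2 in \<open>auto simp: k'_def\<close>)
  have \<theta>2: "\<theta>2 e = - \<theta>1 d - 2 * pi * real j" using de by simp
  have per: "cos (\<theta>2 e) = cos (\<theta>1 d)" "sin (\<theta>2 e) = - sin (\<theta>1 d)"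
  proof -
    have "cos (2 * pi * real j) = 1" "sin (2 * pi * real j) = 0"
      using cos_int_2pin[of "int j"] sin_int_2pin[of "int j"] by simp_all
    then show "cos (\<theta>2 e) = cos (\<theta>1 d)" "sin (\<theta>2 e) = - sin (\<theta>1 d)"
      unfolding \<theta>2 by (simp_all add: cos_diff sin_diff)
  qed
  have m1: "L.shoot d (1/2) = R.shoot e (1/2)" "L.vel d (1/2) = - R.vel e (1/2)"
    using pol1[of d] pol2[of e] de2 per de(4) by auto
  note solL = L.solution_derivs[OF L.shoot_solution[of d]] and solR = R.solution_derivs[OF R.shoot_solution[of e]]
  have m2: "L.acc d (1/2) = R.acc e (1/2)"
  proof -
    have h: "(1/2::real) \<in> {0..1/2}" by simp
    have "1/2 * (1 - 1/2) * L.acc d (1/2) = 1/2 * (1 - 1/2) * R.acc e (1/2)"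
      unfolding solL(3)[OF h] solR(3)[OF h] m1 by (simp add: algebra_simps)
    then show ?thesis by simp
  qed
  let ?A = "{0..1/2::real}" and ?B = "{1/2..1::real}"
  have refl: "((\<lambda>s. h (1 - s)) has_real_derivative - h' (1 - s)) (at s within ?B)"
    if "\<And>s. s \<in> {0..1/2} \<Longrightarrow> (h has_real_derivative h' s) (at s within {0..1/2})" "s \<in> ?B" for h h' :: "real \<Rightarrow> real" and s
  proof -
    have im: "(\<lambda>s. 1 - s) ` ?B = {0..1/2}"
    proof -
      have "x \<in> (\<lambda>s. 1 - s) ` ?B" if "x \<in> {0..1/2}" for x :: real using that by (intro image_eqI[of _ _ "1 - x"]) auto
      then show ?thesis by auto
    qed
    have "(h has_real_derivative h' (1 - s)) (at (1 - s) within (\<lambda>s. 1 - s) ` ?B)" unfolding im using that by auto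
    moreover have "((\<lambda>s. 1 - s) has_real_derivative -1) (at s within ?B)" by (auto intro!: derivative_eq_intros)
    ultimately show ?thesis using DERIV_image_chain[of h "h' (1 - s)" "\<lambda>s. 1 - s" s ?B "-1"] by (simp add: o_def)
  qed
  define f f1 f2 where "f s = (if s \<in> ?A then L.shoot d s else R.shoot e (1 - s))"
    and "f1 s = (if s \<in> ?A then L.vel d s else - R.vel e (1 - s))"
    and "f2 s = (if s \<in> ?A then L.acc d s else R.acc e (1 - s))" for s
  have AB: "?A \<union> ?B = {0..1}" by auto
  have half: "s = 1/2" if "s \<in> ?A" "s \<in> ?B" for s using that by auto
  have df: "(f has_real_derivative f1 s) (at s within {0..1})" if "s \<in> {0..1}" for s
    unfolding f_def[abs_def] f1_def AB[symmetric]
  proof (rule glue_deriv)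
    show "((\<lambda>s. R.shoot e (1 - s)) has_real_derivative - R.vel e (1 - s)) (at s within ?B)" if "s \<in> ?B" for s
      by (rule refl[OF solR(1) that])
    show "L.shoot d s = R.shoot e (1 - s) \<and> L.vel d s = - R.vel e (1 - s)" if "s \<in> ?A" "s \<in> ?B" for s
      unfolding half[OF that] using m1 by simp
  qed (use solL that AB in auto)
  have df1: "(f1 has_real_derivative f2 s) (at s within {0..1})" if "s \<in> {0..1}" for s
    unfolding f1_def[abs_def] f2_def AB[symmetric]
  proof (rule glue_deriv)
    show "((\<lambda>s. - R.vel e (1 - s)) has_real_derivative R.acc e (1 - s)) (at s within ?B)" if "s \<in> ?B" for s
      using DERIV_minus[OF refl[OF solR(2) that]] by simp
    show "L.vel d s = - R.vel e (1 - s) \<and> L.acc d s = R.acc e (1 - s)" if "s \<in> ?A" "s \<in> ?B" for s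
      unfolding half[OF that] using m1 m2 by simp
  qed (use solL that AB in auto)
  have cf2: "continuous_on {0..1} f2"
    unfolding f2_def[abs_def] AB[symmetric]
  proof (rule glue_continuous)
    show "continuous_on ?A (L.acc d)" by (rule L.solution_continuous(3)[OF L.shoot_solution])
    show "continuous_on ?B (\<lambda>s. R.acc e (1 - s))"
      by (rule continuous_on_compose2[OF R.solution_continuous(3)[OF R.shoot_solution]]) (auto intro!: continuous_intros)
    show "L.acc d s = R.acc e (1 - s)" if "s \<in> ?A" "s \<in> ?B" for s unfolding half[OF that] using m2 by simp
  qed auto
  have ode: "s * (1 - s) * f2 s + (\<alpha> * (1 - s) - \<beta> * s) * f1 s + \<mu> * nonlin p (f s) = 0" if s: "s \<in> {0..1}" for s
  proof (cases "s \<in> ?A")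
    case True
    then show ?thesis using solL(3)[of s] by (simp add: f_def f1_def f2_def algebra_simps)
  next
    case False
    then have "1 - s \<in> {0..1/2}" using s by auto
    from solR(3)[OF this] have "s * (1 - s) * R.acc e (1 - s) + (\<alpha> * (1 - s) - \<beta> * s) * - R.vel e (1 - s) + \<mu> * nonlin p (R.shoot e (1 - s)) = 0"
      by (simp add: algebra_simps)
    moreover have "f s = R.shoot e (1 - s)" "f1 s = - R.vel e (1 - s)" "f2 s = R.acc e (1 - s)"
      by (simp_all only: f_def f1_def f2_def if_not_P[OF False])
    ultimately show ?thesis by simp
  qed
  obtain W W1 W2 where W: "\<And>s. s \<in> {0..1} \<Longrightarrow> W s = f s" "\<And>s. s \<in> {0..1} \<Longrightarrow> W1 s = f1 s"
    "\<And>s. s \<in> {0..1} \<Longrightarrow> W2 s = f2 s" and dW: "\<And>s. (W has_real_derivative W1 s) (at s)"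
    "\<And>s. (W1 has_real_derivative W2 s) (at s)" "continuous_on UNIV W2"
    by (rule C2_extend[OF zero_le_one df df1 cf2]) (assumption | rule that)+
  have W0: "W 0 = d" using W(1)[of 0] by (simp add: f_def L.shoot_0)
  have W1: "W 1 = e" using W(1)[of 1] by (simp add: f_def R.shoot_0)
  have odeW: "s * (1 - s) * W2 s + (\<alpha> * (1 - s) - \<beta> * s) * W1 s + \<mu> * nonlin p (W s) = 0" if "s \<in> {0..1}" for s
    using ode[OF that] W[OF that] by simp
  \<comment> \<open>A constant solution of the equation takes one of the values \<open>0, 1, -1\<close>, but \<open>d, e \<ge> 2\<close>.\<close>
  have rigid: "W1 s \<noteq> 0" if s: "s \<in> {0<..<1}" and n: "nonlin p (W s) = 0" for s
  proof
    assume 0: "W1 s = 0"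
    have le: "\<bar>W s\<bar> \<le> 1" using n nonlin_zeros[OF L.p] by auto
    show False
    proof (cases "s \<in> ?A")
      case True
      then have "L.shoot d s = W s" "L.vel d s = 0" using W[of s] 0 s by (auto simp: f_def f1_def)
      then have "L.shoot d 0 = W s" using L.solution_rigid[OF L.shoot_solution n, of s d 0] s True by auto
      then show False using de2 le by (simp add: L.shoot_0)
    next
      case False
      then have "R.shoot e (1 - s) = W s" "R.vel e (1 - s) = 0" using W[of s] 0 s by (auto simp: f_def f1_def)
      then have "R.shoot e 0 = W s" using R.solution_rigid[OF R.shoot_solution n, of "1 - s" e 0] s False by auto
      then show False using de2 le by (simp add: R.shoot_0)
    qed
  qed
  have zW: "s \<in> {0<..<1}" if "s \<in> {0..1}" "W s = 0" for s
    using that W0 W1 de2 by (cases "s = 0"; cases "s = 1") auto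
  have nz: "nonlin p d \<noteq> 0" "nonlin p e \<noteq> 0" using nonlin_zeros[OF L.p] de2 by auto
  have zW1: "s \<in> {0<..<1}" if "s \<in> {0..1}" "W1 s = 0" for s
    using that odeW[of 0] odeW[of 1] W0 W1 nz L.\<mu> by (cases "s = 0"; cases "s = 1") auto
  have simple: "W1 s \<noteq> 0" if "s \<in> {0..1}" "W s = 0" for s
    using rigid[OF zW[OF that]] that nonlin_zeros[OF L.p] by auto
  have finW: "finite {s \<in> {0..1}. W s = 0}" by (rule simple_zeros_finite[OF dW(1)]) (rule simple)
  have finW1: "finite {s \<in> {0..1}. W1 s = 0}"
  proof (rule simple_zeros_finite[OF dW(2)])
    fix s assume s: "s \<in> {0..1::real}" "W1 s = 0"
    show "W2 s \<noteq> 0"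
      using rigid[OF zW1[OF s]] s odeW[OF s(1)] L.\<mu> by auto
  qed
  have least: "at_least (Suc k) {s \<in> {0<..<1}. W s = 0}"
  proof (rule at_least_mono[OF zeros order_refl], rule subsetI)
    fix s assume s: "s \<in> {s \<in> {0..1/2}. L.shoot d s = 0}"
    then have "s \<in> {0..1}" "W s = 0" using W(1)[of s] by (auto simp: f_def)
    then show "s \<in> {s \<in> {0<..<1}. W s = 0}" using zW by blast
  qed
  have least1: "at_least k {s \<in> {0<..<1}. W1 s = 0}" by (rule rolle_at_least[OF dW(1) least])
  have neg: "\<exists>s\<in>{0<..<1}. W s < 0"
  proof -
    obtain s where s: "s \<in> {0<..<1}" "W s = 0" using least by (force simp: at_least_def card_Suc_eq)
    have "W1 s \<noteq> 0" using simple s by auto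
    then consider "W1 s > 0" | "W1 s < 0" by linarith
    then show ?thesis
    proof cases
      case 1
      obtain \<delta> where \<delta>: "\<delta> > 0" "\<And>h. 0 < h \<Longrightarrow> h < \<delta> \<Longrightarrow> W (s - h) < W s" using DERIV_pos_inc_left[OF dW(1) 1] by blast
      define h where "h = min (\<delta> / 2) (s / 2)"
      have "0 < h" "h < \<delta>" "s - h \<in> {0<..<1}" using \<delta> s by (auto simp: h_def min_def)
      then show ?thesis using \<delta>(2)[of h] s by auto
    next
      case 2
      obtain \<delta> where \<delta>: "\<delta> > 0" "\<And>h. 0 < h \<Longrightarrow> h < \<delta> \<Longrightarrow> W (s + h) < W s" using DERIV_neg_dec_right[OF dW(1) 2] by blast
      define h where "h = min (\<delta> / 2) ((1 - s) / 2)"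
      have "0 < h" "h < \<delta>" "s + h \<in> {0<..<1}" using \<delta> s by (auto simp: h_def min_def field_simps)
      then show ?thesis using \<delta>(2)[of h] s by auto
    qed
  qed
  show ?thesis
    by (rule that[OF dW odeW _ _ finW zW least finW1 zW1 least1 neg]) (use W0 de2 in auto)
qed

end

section \<open>Polynomial functions on Euclidean space\<close>

text \<open>The structural induction produces gradient and Hessian together; the symmetry of the Hessian is then visible
  in the product rule.\<close>

lemma real_polynomial_derivatives:
  fixes f :: "'a::euclidean_space \<Rightarrow> real"
  assumes "real_polynomial_function f"
  shows "\<exists>G H. (\<forall>x. (f has_derivative (\<lambda>h. G x \<bullet> h)) (at x)) \<and>
    (\<forall>v. real_polynomial_function (\<lambda>x. G x \<bullet> v)) \<and>
    (\<forall>x. (G has_derivative H x) (at x)) \<and>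
    (\<forall>u v. real_polynomial_function (\<lambda>x. H x u \<bullet> v)) \<and>
    (\<forall>x u v. H x u \<bullet> v = u \<bullet> (H x v :: 'a))"
  using assms
proof (induction rule: real_polynomial_function.induct)
  case (linear f)
  then interpret bounded_linear f .
  have "f h = (\<Sum>b\<in>Basis. f b *\<^sub>R b) \<bullet> h" for h
  proof -
    have "f h = f (\<Sum>b\<in>Basis. (h \<bullet> b) *\<^sub>R b)" by (simp add: euclidean_representation)
    also have "\<dots> = (\<Sum>b\<in>Basis. f b *\<^sub>R b) \<bullet> h"
      unfolding inner_sum_left inner_scaleR_left by (simp add: sum scaleR inner_commute mult.commute)
    finally show ?thesis .
  qed
  then have f: "f = (\<lambda>h. (\<Sum>b\<in>Basis. f b *\<^sub>R b) \<bullet> h)" by blast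
  have "(f has_derivative (\<lambda>h. (\<Sum>b\<in>Basis. f b *\<^sub>R b) \<bullet> h)) (at x)" for x
    by (subst (1) f) (auto intro!: derivative_eq_intros)
  then show ?case
    by (intro exI[of _ "\<lambda>_. \<Sum>b\<in>Basis. f b *\<^sub>R b"] exI[of _ "\<lambda>_ _. 0"]) auto
next
  case (const c)
  show ?case by (intro exI[of _ "\<lambda>_. 0"] exI[of _ "\<lambda>_ _. 0"]) auto
next
  case (add f g)
  obtain G1 H1 where 1: "\<And>x. (f has_derivative (\<lambda>h. G1 x \<bullet> h)) (at x)" "\<And>v. real_polynomial_function (\<lambda>x. G1 x \<bullet> v)"
    "\<And>x. (G1 has_derivative H1 x) (at x)" "\<And>u v. real_polynomial_function (\<lambda>x. H1 x u \<bullet> v)"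
    "\<And>x u v. H1 x u \<bullet> v = u \<bullet> (H1 x v :: 'a)" using add.IH(1) by blast
  obtain G2 H2 where 2: "\<And>x. (g has_derivative (\<lambda>h. G2 x \<bullet> h)) (at x)" "\<And>v. real_polynomial_function (\<lambda>x. G2 x \<bullet> v)"
    "\<And>x. (G2 has_derivative H2 x) (at x)" "\<And>u v. real_polynomial_function (\<lambda>x. H2 x u \<bullet> v)"
    "\<And>x u v. H2 x u \<bullet> v = u \<bullet> (H2 x v :: 'a)" using add.IH(2) by blast
  show ?case
    by (rule exI[of _ "\<lambda>x. G1 x + G2 x"], rule exI[of _ "\<lambda>x h. H1 x h + H2 x h"])
      (auto simp: inner_add_left inner_add_right 1(5) 2(5) intro!: derivative_eq_intros 1(1-4) 2(1-4) 1(4)[unfolded 1(5)] 2(4)[unfolded 2(5)] real_polynomial_function.intros(3))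
next
  case (mult f g)
  obtain G1 H1 where 1: "\<And>x. (f has_derivative (\<lambda>h. G1 x \<bullet> h)) (at x)" "\<And>v. real_polynomial_function (\<lambda>x. G1 x \<bullet> v)"
    "\<And>x. (G1 has_derivative H1 x) (at x)" "\<And>u v. real_polynomial_function (\<lambda>x. H1 x u \<bullet> v)"
    "\<And>x u v. H1 x u \<bullet> v = u \<bullet> (H1 x v :: 'a)" using mult.IH(1) by blast
  obtain G2 H2 where 2: "\<And>x. (g has_derivative (\<lambda>h. G2 x \<bullet> h)) (at x)" "\<And>v. real_polynomial_function (\<lambda>x. G2 x \<bullet> v)"
    "\<And>x. (G2 has_derivative H2 x) (at x)" "\<And>u v. real_polynomial_function (\<lambda>x. H2 x u \<bullet> v)"
    "\<And>x u v. H2 x u \<bullet> v = u \<bullet> (H2 x v :: 'a)" using mult.IH(2) by blast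
  let ?G = "\<lambda>x. f x *\<^sub>R G2 x + g x *\<^sub>R G1 x"
  let ?H = "\<lambda>x h. f x *\<^sub>R H2 x h + (G1 x \<bullet> h) *\<^sub>R G2 x + (g x *\<^sub>R H1 x h + (G2 x \<bullet> h) *\<^sub>R G1 x)"
  have a1: "((\<lambda>x. f x * g x) has_derivative (\<lambda>h. ?G x \<bullet> h)) (at x)" for x
    by (rule has_derivative_eq_rhs[OF has_derivative_mult[OF 1(1) 2(1)]]) (auto simp: inner_add_left algebra_simps)
  have a2: "(?G has_derivative ?H x) (at x)" for x
    by (rule has_derivative_eq_rhs[OF has_derivative_add[OF has_derivative_scaleR[OF 1(1) 2(3)] has_derivative_scaleR[OF 2(1) 1(3)]]]) simp
  have a3: "real_polynomial_function (\<lambda>x. ?G x \<bullet> v)" for v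
    unfolding inner_add_left inner_scaleR_left
    by (intro real_polynomial_function.intros(3) real_polynomial_function.intros(4) 1 2 mult.hyps)
  have a4: "real_polynomial_function (\<lambda>x. ?H x u \<bullet> v)" for u v
    unfolding inner_add_left inner_scaleR_left
    by (intro real_polynomial_function.intros(3) real_polynomial_function.intros(4) 1 2 mult.hyps)
  have a5: "?H x u \<bullet> v = u \<bullet> ?H x v" for x u v
    by (simp add: inner_add_left inner_add_right 1(5) 2(5)) (simp add: inner_commute mult.commute)
  show ?case by (rule exI[of _ ?G], rule exI[of _ ?H]) (intro conjI allI a1 a2 a3 a4 a5)
qed

lemma polynomial_derivative:
  fixes f :: "'a::euclidean_space \<Rightarrow> 'b::euclidean_space"
  assumes f: "polynomial_function f"
  shows "\<exists>f'. (\<forall>x. (f has_derivative f' x) (at x)) \<and> (\<forall>v. polynomial_function (\<lambda>x. f' x v))"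
proof -
  have "\<exists>G. (\<forall>x. ((\<lambda>x. f x \<bullet> b) has_derivative (\<lambda>h. G x \<bullet> h)) (at x)) \<and>
    (\<forall>v. real_polynomial_function (\<lambda>x. G x \<bullet> v))" if b: "b \<in> Basis" for b
  proof -
    have "real_polynomial_function (\<lambda>x. f x \<bullet> b)"
      using f b unfolding polynomial_function_iff_Basis_inner by blast
    from real_polynomial_derivatives[OF this] show ?thesis by (elim exE conjE) (intro exI conjI)
  qed
  then obtain G where G: "\<And>b x. b \<in> Basis \<Longrightarrow> ((\<lambda>x. f x \<bullet> b) has_derivative (\<lambda>h. G b x \<bullet> h)) (at x)"
    "\<And>b v. b \<in> Basis \<Longrightarrow> real_polynomial_function (\<lambda>x. G b x \<bullet> v)" by metis
  let ?f' = "\<lambda>x h. \<Sum>b\<in>Basis. (G b x \<bullet> h) *\<^sub>R b"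
  have D: "(f has_derivative ?f' x) (at x)" for x
    unfolding has_derivative_componentwise_within[of f]
    using G(1) by (auto simp: inner_sum_left inner_Basis if_distrib[of "(*) _"] cong: if_cong)
  have P: "polynomial_function (\<lambda>x. ?f' x v)" for v
    unfolding polynomial_function_iff_Basis_inner
    using G(2) by (auto simp: inner_sum_left inner_Basis if_distrib[of "(*) _"] cong: if_cong)
  show ?thesis using D P by (intro exI[of _ ?f'] conjI allI)
qed

lemma polynomial_continuous: "polynomial_function (f :: 'a::euclidean_space \<Rightarrow> 'b::euclidean_space) \<Longrightarrow> continuous_on A f"
  by (rule continuous_on_polymonial_function)

lemma polynomial_Ck_open:
  fixes f :: "'a::euclidean_space \<Rightarrow> 'b::euclidean_space"
  shows "polynomial_function f \<Longrightarrow> Ck_open k U f"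
proof (induction k arbitrary: f)
  case 0
  then show ?case by (simp add: polynomial_continuous)
next
  case (Suc k)
  then show ?case using polynomial_derivative[OF Suc.prems] by auto
qed

lemma polynomial_smooth_on:
  fixes f g :: "'a::euclidean_space \<Rightarrow> 'b::euclidean_space"
  assumes "polynomial_function g" "\<And>x. x \<in> X \<Longrightarrow> f x = g x"
  shows "smooth_on X f"
  unfolding smooth_on_def
proof
  fix x assume "x \<in> X"
  show "\<exists>U h. open U \<and> x \<in> U \<and> smooth_open U h \<and> (\<forall>y\<in>X \<inter> U. h y = f y)"
    by (rule exI[of _ UNIV], rule exI[of _ g]) (use assms polynomial_Ck_open in \<open>auto simp: smooth_open_def\<close>)
qed

section \<open>Calculus on the unit sphere\<close>

lemma great_circle_in_sphere:
  fixes x e :: "'a::euclidean_space"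
  assumes "norm x = 1" "norm e = 1" "e \<bullet> x = 0"
  shows "norm (cos s *\<^sub>R x + sin s *\<^sub>R e) = 1"
proof -
  have "(norm (cos s *\<^sub>R x + sin s *\<^sub>R e))\<^sup>2 = (cos s)\<^sup>2 * (norm x)\<^sup>2 + (sin s)\<^sup>2 * (norm e)\<^sup>2"
    unfolding power2_norm_eq_inner using assms(3)
    by (simp add: inner_add_left inner_add_right inner_commute[of x e] power2_eq_square)
  then have "(norm (cos s *\<^sub>R x + sin s *\<^sub>R e))\<^sup>2 = 1\<^sup>2" using assms by simp
  then show ?thesis by (rule power2_eq_imp_eq) auto
qed

text \<open>Composition with the great circle in direction \<open>e\<close> reduces this to the uniqueness of derivatives on the line.\<close>

lemma sphere_derivative_unique:
  fixes f :: "'a::euclidean_space \<Rightarrow> 'b::real_normed_vector"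
  assumes x: "norm x = 1" and A: "(f has_derivative A) (at x within unit_sphere)"
    and B: "(f has_derivative B) (at x within unit_sphere)" and e: "e \<bullet> x = 0"
  shows "A e = B e"
proof (cases "e = 0")
  case True
  then show ?thesis using A B by (metis has_derivative_linear linear_0)
next
  case False
  define u where "u = e /\<^sub>R norm e"
  have u: "norm u = 1" "u \<bullet> x = 0" "e = norm e *\<^sub>R u" using False e by (auto simp: u_def)
  let ?\<gamma> = "\<lambda>s. cos s *\<^sub>R x + sin s *\<^sub>R u"
  have \<gamma>: "(?\<gamma> has_derivative (\<lambda>h. h *\<^sub>R u)) (at 0)"
    by (auto intro!: derivative_eq_intros)
  have im: "?\<gamma> ` UNIV \<subseteq> unit_sphere" using great_circle_in_sphere[OF x u(1,2)] by auto
  have ch: "((\<lambda>s. f (?\<gamma> s)) has_derivative (\<lambda>h. C (h *\<^sub>R u))) (at 0)" if C: "(f has_derivative C) (at x within unit_sphere)" for C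
  proof -
    have "(f has_derivative C) (at (?\<gamma> 0) within ?\<gamma> ` UNIV)"
      using has_derivative_subset[OF C im] by simp
    from has_derivative_in_compose[OF \<gamma> this] show ?thesis by simp
  qed
  have "(\<lambda>h. A (h *\<^sub>R u)) = (\<lambda>h. B (h *\<^sub>R u))"
    by (rule has_derivative_unique[OF ch[OF A] ch[OF B]])
  then have "A (norm e *\<^sub>R u) = B (norm e *\<^sub>R u)" by metis
  then show ?thesis using u by simp
qed

text \<open>On the sphere \<open>f\<close> agrees with \<open>f - (g \<bullet> x) (\<bar>y\<bar>\<^sup>2 - 1) / 2\<close>, whose ambient gradient at \<open>x\<close> is tangent.\<close>

lemma sphere_gradient_eq:
  fixes f :: "'a::euclidean_space \<Rightarrow> real"
  assumes x: "norm x = 1" and f: "(f has_derivative (\<lambda>h. g \<bullet> h)) (at x)"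
  shows "sphere_gradient f x = g - (g \<bullet> x) *\<^sub>R x"
proof -
  let ?v = "g - (g \<bullet> x) *\<^sub>R x"
  have xx: "x \<bullet> x = 1" using x by (simp add: norm_eq_1)
  have t: "?v \<in> sphere_tangent x" using xx by (simp add: sphere_tangent_def inner_diff_left)
  have "((\<lambda>y. f y - (g \<bullet> x) * (y \<bullet> y - 1) / 2) has_derivative (\<lambda>h. ?v \<bullet> h)) (at x within unit_sphere)"
    by (rule has_derivative_eq_rhs, (rule derivative_intros has_derivative_at_withinI[OF f])+)
      (auto simp: inner_diff_left inner_diff_right inner_commute)
  then have d: "(f has_derivative (\<lambda>h. ?v \<bullet> h)) (at x within unit_sphere)"
    by (rule has_derivative_transform[rotated 2]) (use x in \<open>auto simp: norm_eq_1\<close>)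
  show ?thesis
    unfolding sphere_gradient_def
  proof (rule the_equality)
    show "?v \<in> sphere_tangent x \<and> (f has_derivative (\<lambda>h. ?v \<bullet> h)) (at x within unit_sphere)" using t d by blast
    fix v assume v: "v \<in> sphere_tangent x \<and> (f has_derivative (\<lambda>h. v \<bullet> h)) (at x within unit_sphere)"
    have "(v - ?v) \<bullet> x = 0" using v t by (simp add: sphere_tangent_def inner_diff_left)
    then have "v \<bullet> (v - ?v) = ?v \<bullet> (v - ?v)"
      using sphere_derivative_unique[OF x] v d by blast
    then have "(v - ?v) \<bullet> (v - ?v) = 0" by (simp only: inner_diff_left)
    then show "v = ?v" by simp
  qed
qed

lemma subspace_sphere_tangent: "subspace (sphere_tangent x)"
  by (auto simp: sphere_tangent_def subspace_def inner_add_left)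

lemma onb_finite: "orthonormal_basis W B \<Longrightarrow> finite B"
  unfolding orthonormal_basis_def
  using pairwise_orthogonal_imp_finite by blast

lemma onb_expand:
  assumes "orthonormal_basis W B" "v \<in> W"
  shows "(\<Sum>e\<in>B. (v \<bullet> e) *\<^sub>R e) = v"
  using assms onb_finite[OF assms(1)] unfolding orthonormal_basis_def by (intro orthonormal_basis_expand) auto

lemma onb_card:
  assumes B: "orthonormal_basis W B"
  shows "card B = dim W"
proof -
  have "0 \<notin> B" using B by (auto simp: orthonormal_basis_def)
  then have "independent B" using B pairwise_orthogonal_independent unfolding orthonormal_basis_def by blast
  moreover have W: "W = span B" using B by (simp add: orthonormal_basis_def)
  ultimately show ?thesis unfolding W by (simp add: dim_eq_card_independent)
qed

lemma onb_extend:
  fixes T W :: "'a::euclidean_space set"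
  assumes T: "subspace T" and W: "subspace W" and TW: "T \<subseteq> W"
  obtains B1 B2 where "orthonormal_basis T B1" "orthonormal_basis W (B1 \<union> B2)" "B1 \<inter> B2 = {}"
proof -
  obtain B1 where B1: "B1 \<subseteq> T" "pairwise orthogonal B1" "\<And>x. x \<in> B1 \<Longrightarrow> norm x = 1" "span B1 = T"
    using orthonormal_basis_subspace[OF T] by metis
  define T2 where "T2 = {v \<in> W. \<forall>t\<in>T. t \<bullet> v = 0}"
  have sT2: "subspace T2" using W by (auto simp: T2_def subspace_def inner_add_right)
  obtain B2 where B2: "B2 \<subseteq> T2" "pairwise orthogonal B2" "\<And>x. x \<in> B2 \<Longrightarrow> norm x = 1" "span B2 = T2"
    using orthonormal_basis_subspace[OF sT2] by metis
  have oT: "orthonormal_basis T B1" using B1 by (auto simp: orthonormal_basis_def)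
  have perp: "a \<bullet> b = 0" if "a \<in> B1" "b \<in> B2" for a b using that B1(1) B2(1) by (auto simp: T2_def)
  have perp': "b \<bullet> a = 0" if "a \<in> B1" "b \<in> B2" for a b using perp[OF that] by (simp add: inner_commute)
  have "pairwise orthogonal (B1 \<union> B2)"
    using B1(2) B2(2) perp perp' by (auto simp: pairwise_def orthogonal_def)
  moreover have "span (B1 \<union> B2) = W"
  proof
    show "span (B1 \<union> B2) \<subseteq> W"
      by (rule span_minimal[OF _ W]) (use B1(1) B2(1) TW in \<open>auto simp: T2_def\<close>)
    show "W \<subseteq> span (B1 \<union> B2)"
    proof
      fix v assume v: "v \<in> W"
      let ?t = "\<Sum>e\<in>B1. (v \<bullet> e) *\<^sub>R e"
      have t: "?t \<in> span B1" by (intro span_sum span_scale span_base)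
      have "e \<bullet> (v - ?t) = 0" if e: "e \<in> B1" for e
      proof -
        have "e \<bullet> ?t = (\<Sum>b\<in>B1. if b = e then v \<bullet> e else 0)"
          unfolding inner_sum_right
          by (rule sum.cong) (use B1(2,3) e in \<open>auto simp: pairwise_def orthogonal_def norm_eq_1\<close>)
        also have "\<dots> = v \<bullet> e" using onb_finite[OF oT] e by simp
        finally show ?thesis by (simp add: inner_diff_right inner_commute)
      qed
      then have "orthogonal (v - ?t) t" if "t \<in> T" for t
        using orthogonal_to_span[of t B1 "v - ?t"] that B1(4) by (auto simp: orthogonal_def inner_commute)
      then have "v - ?t \<in> T2"
        using v t B1(4) TW W by (auto simp: T2_def orthogonal_def inner_commute intro!: subspace_diff)
      then have "v - ?t \<in> span (B1 \<union> B2)" using B2(4) span_mono[of B2 "B1 \<union> B2"] by blast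
      moreover have "?t \<in> span (B1 \<union> B2)" using t span_mono[of B1 "B1 \<union> B2"] by blast
      ultimately have "(v - ?t) + ?t \<in> span (B1 \<union> B2)" by (rule span_add)
      then show "v \<in> span (B1 \<union> B2)" by simp
    qed
  qed
  moreover have "B1 \<inter> B2 = {}"
  proof -
    have "False" if "e \<in> B1" "e \<in> B2" for e using perp[OF that] B1(3)[OF that(1)] by (auto simp: norm_eq_1)
    then show ?thesis by blast
  qed
  ultimately show ?thesis
    by (intro that[OF oT]) (use B1 B2 TW in \<open>auto simp: orthonormal_basis_def T2_def\<close>)
qed

lemma onb_exists: "subspace W \<Longrightarrow> \<exists>B. orthonormal_basis W B"
  unfolding orthonormal_basis_def by (metis orthonormal_basis_subspace)

lemma onb_insert_normal:
  fixes x :: "'a::euclidean_space"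
  assumes x: "norm x = 1" and B: "orthonormal_basis (sphere_tangent x) B"
  shows "orthonormal_basis UNIV (insert x B)" "x \<notin> B"
proof -
  have xx: "x \<bullet> x = 1" using x by (simp add: norm_eq_1)
  have tB: "e \<bullet> x = 0" if "e \<in> B" for e using B that by (auto simp: orthonormal_basis_def sphere_tangent_def)
  show "x \<notin> B" using tB xx by auto
  have "y \<in> span (insert x B)" for y
  proof -
    have "y - (y \<bullet> x) *\<^sub>R x \<in> sphere_tangent x" using xx by (simp add: sphere_tangent_def inner_diff_left)
    then have "y - (y \<bullet> x) *\<^sub>R x \<in> span B" using B by (simp add: orthonormal_basis_def)
    then show ?thesis using span_breakdown_eq by blast
  qed
  moreover have "pairwise orthogonal (insert x B)"
    using B tB by (auto simp: orthonormal_basis_def pairwise_insert orthogonal_def inner_commute)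
  ultimately show "orthonormal_basis UNIV (insert x B)" using B x by (auto simp: orthonormal_basis_def)
qed

text \<open>Parseval's identity, with the two summations exchanged.\<close>

lemma trace_onb:
  fixes A :: "'a::euclidean_space \<Rightarrow> 'a"
  assumes A: "linear A" and B: "orthonormal_basis UNIV B"
  shows "(\<Sum>b\<in>Basis. A b \<bullet> b) = (\<Sum>e\<in>B. A e \<bullet> e)"
proof -
  have fB: "finite B" by (rule onb_finite[OF B])
  have "A b \<bullet> b = (\<Sum>e\<in>B. (b \<bullet> e) * (A e \<bullet> b))" for b
  proof -
    have "A b = A (\<Sum>e\<in>B. (b \<bullet> e) *\<^sub>R e)" using onb_expand[OF B, of b] by simp
    also have "\<dots> = (\<Sum>e\<in>B. (b \<bullet> e) *\<^sub>R A e)" by (simp add: linear_sum[OF A] linear_scale[OF A])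
    finally show ?thesis by (simp add: inner_sum_left)
  qed
  then have "(\<Sum>b\<in>Basis. A b \<bullet> b) = (\<Sum>e\<in>B. \<Sum>b\<in>Basis. (b \<bullet> e) * (A e \<bullet> b))"
    by (simp add: sum.swap[of _ Basis])
  also have "\<dots> = (\<Sum>e\<in>B. A e \<bullet> e)"
    by (rule sum.cong[OF refl]) (subst (2) euclidean_inner, simp add: inner_commute mult.commute)
  finally show ?thesis .
qed

lemma sphere_laplacian_eq:
  fixes u :: "'a::euclidean_space \<Rightarrow> real"
  assumes x: "norm x = 1" and X: "\<And>y. norm y = 1 \<Longrightarrow> sphere_gradient u y = X y"
    and X': "(X has_derivative X') (at x)"
  shows "\<exists>B. orthonormal_basis (sphere_tangent x) B \<and> sphere_laplacian u x = (\<Sum>e\<in>B. X' e \<bullet> e)"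
proof (intro exI conjI)
  let ?B = "SOME B. orthonormal_basis (sphere_tangent x) B"
  show B: "orthonormal_basis (sphere_tangent x) ?B"
    by (rule someI_ex) (rule onb_exists[OF subspace_sphere_tangent])
  have d: "(sphere_gradient u has_derivative X') (at x within unit_sphere)"
    by (rule has_derivative_transform[OF _ _ has_derivative_at_withinI[OF X']]) (use x X in auto)
  then have "(sphere_gradient u has_derivative frechet_derivative (sphere_gradient u) (at x within unit_sphere)) (at x within unit_sphere)"
    using frechet_derivative_works differentiable_def by blast
  then have "frechet_derivative (sphere_gradient u) (at x within unit_sphere) e = X' e" if "e \<in> ?B" for e
    using sphere_derivative_unique[OF x _ d] that B by (auto simp: orthonormal_basis_def sphere_tangent_def)
  then show "sphere_laplacian u x = (\<Sum>e\<in>?B. X' e \<bullet> e)"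
    unfolding sphere_laplacian_def sphere_divergence_def by (intro sum.cong) auto
qed

section \<open>Geometry of Cartan--Muenzner polynomials\<close>

lemma ray_derivative: "((\<lambda>r. r *\<^sub>R x) has_derivative (\<lambda>h. h *\<^sub>R x)) (at (1::real))"
  for x :: "'a::real_normed_vector"
  by (auto intro!: derivative_eq_intros)

text \<open>\<open>G\<close> and \<open>H\<close> are the gradient and the Hessian of \<open>F\<close>, and \<open>c\<close> is the constant value of the Laplacian on the unit
  sphere.\<close>

locale cartan_muenzner_data =
  fixes F :: "'a::euclidean_space \<Rightarrow> real" and G :: "'a \<Rightarrow> 'a" and H :: "'a \<Rightarrow> 'a \<Rightarrow> 'a"
    and l n :: nat and c :: real
  assumes dim: "DIM('a) = n + 1" and l: "l \<ge> 1"
    and polyF: "real_polynomial_function F"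
    and dF: "\<And>x. (F has_derivative (\<lambda>h. G x \<bullet> h)) (at x)"
    and polyG: "\<And>v. real_polynomial_function (\<lambda>x. G x \<bullet> v)"
    and dG: "\<And>x. (G has_derivative H x) (at x)"
    and polyH: "\<And>u v. real_polynomial_function (\<lambda>x. H x u \<bullet> v)"
    and sym: "\<And>x u v. H x u \<bullet> v = u \<bullet> H x v"
    and homog: "\<And>r x. F (r *\<^sub>R x) = r ^ l * F x"
    and gradsq: "\<And>x. G x \<bullet> G x = (real l)\<^sup>2 * (x \<bullet> x) ^ (l - 1)"
    and trace: "\<And>x. norm x = 1 \<Longrightarrow> (\<Sum>b\<in>Basis. H x b \<bullet> b) = c"

lemma cartan_muenzner_imp_data:
  fixes F :: "'a::euclidean_space \<Rightarrow> real"
  assumes cm: "cartan_muenzner F l" and dim: "DIM('a) = n + 1"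
  shows "\<exists>G H c. cartan_muenzner_data F G H l n c"
proof -
  have poly: "real_polynomial_function F" and homog: "\<And>r x. F (r *\<^sub>R x) = r ^ l * F x"
    and grad: "\<And>x. (norm (euclidean_gradient F x))\<^sup>2 = (real l)\<^sup>2 * norm x ^ (2 * l - 2)"
    and nc: "\<not> F constant_on unit_sphere"
    using cm by (auto simp: cartan_muenzner_def)
  obtain c where c: "\<And>x. euclidean_laplacian F x = c * norm x powi (int l - 2)"
    using cm by (auto simp: cartan_muenzner_def)
  obtain G H where G: "\<And>x. (F has_derivative (\<lambda>h. G x \<bullet> h)) (at x)" "\<And>v. real_polynomial_function (\<lambda>x. G x \<bullet> v)"
    and H: "\<And>x. (G has_derivative H x) (at x)" "\<And>u v. real_polynomial_function (\<lambda>x. H x u \<bullet> v)"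
    "\<And>x u v. H x u \<bullet> v = u \<bullet> (H x v :: 'a)"
    using real_polynomial_derivatives[OF poly] by blast
  have l: "l \<ge> 1"
  proof (rule ccontr)
    assume "\<not> l \<ge> 1"
    then have "l = 0" by simp
    then have "F x = F 0" for x using homog[of 0 x] by simp
    then show False using nc by (auto simp: constant_on_def)
  qed
  have gr: "euclidean_gradient F x = G x" for x
    unfolding euclidean_gradient_def
  proof (rule the_equality)
    show "GDERIV F x :> G x" unfolding gderiv_def using G(1) by (simp add: inner_commute)
    fix D assume "GDERIV F x :> D"
    then have "(\<lambda>h. h \<bullet> D) = (\<lambda>h. G x \<bullet> h)" unfolding gderiv_def using has_derivative_unique G(1) by blast
    then have "(D - G x) \<bullet> D = G x \<bullet> (D - G x)" by metis
    then have "(D - G x) \<bullet> (D - G x) = 0" by (simp add: inner_diff_left inner_diff_right inner_commute)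
    then show "D = G x" by simp
  qed
  have lap: "euclidean_laplacian F x = (\<Sum>b\<in>Basis. H x b \<bullet> b)" for x
  proof -
    have "frechet_derivative F (at y) b = G y \<bullet> b" for y b
      using frechet_derivative_at[OF G(1)[of y]] by metis
    moreover have "frechet_derivative (\<lambda>y. G y \<bullet> b) (at x) b = H x b \<bullet> b" for b
    proof -
      have "((\<lambda>y. G y \<bullet> b) has_derivative (\<lambda>h. H x h \<bullet> b)) (at x)"
        by (auto intro!: derivative_eq_intros H(1))
      from frechet_derivative_at[OF this] show ?thesis by metis
    qed
    ultimately show ?thesis by (simp add: euclidean_laplacian_def)
  qed
  have "cartan_muenzner_data F G H l n c"
  proof
    show "G x \<bullet> G x = (real l)\<^sup>2 * (x \<bullet> x) ^ (l - 1)" for x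
    proof -
      have "2 * l - 2 = 2 * (l - 1)" using l by simp
      then have "norm x ^ (2 * l - 2) = (x \<bullet> x) ^ (l - 1)" by (simp only: power_mult power2_norm_eq_inner)
      then show ?thesis using grad[of x] by (simp add: gr power2_norm_eq_inner)
    qed
    show "(\<Sum>b\<in>Basis. H x b \<bullet> b) = c" if "norm x = 1" for x
      using c[of x] lap[of x] that by simp
  qed (use dim l poly G H homog in auto)
  then show ?thesis by blast
qed

context cartan_muenzner_data
begin

lemma H_linear: "linear (H x)" by (rule has_derivative_linear[OF dG])

lemma polynomial_G: "polynomial_function G"
  unfolding polynomial_function_iff_Basis_inner using polyG by blast

lemma polynomial_H: "polynomial_function (\<lambda>x. H x u)"
  unfolding polynomial_function_iff_Basis_inner using polyH by blast

lemma F_continuous: "continuous_on A F"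
  using polynomial_continuous polyF real_polynomial_function_eq by blast

lemma G_continuous: "continuous_on A G" by (rule polynomial_continuous[OF polynomial_G])

text \<open>This exchanges the focal submanifolds \<open>F = 1\<close> and \<open>F = -1\<close>.\<close>

lemma negate: "cartan_muenzner_data (\<lambda>x. - F x) (\<lambda>x. - G x) (\<lambda>x h. - H x h) l n (- c)"
proof
  show "((\<lambda>x. - F x) has_derivative (\<lambda>h. - G x \<bullet> h)) (at x)" for x
    using has_derivative_minus[OF dF] by simp
  show "((\<lambda>x. - G x) has_derivative (\<lambda>h. - H x h)) (at x)" for x
    using has_derivative_minus[OF dG] by simp
  show "(\<Sum>b\<in>Basis. - H x b \<bullet> b) = - c" if "norm x = 1" for x
    using trace[OF that] by (simp add: sum_negf)
qed (use dim l polyF polyG polyH sym homog gradsq in auto)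

lemma euler: "G x \<bullet> x = real l * F x"
proof -
  have "((\<lambda>r. F (r *\<^sub>R x)) has_derivative (\<lambda>h. G x \<bullet> (h *\<^sub>R x))) (at 1)"
    using has_derivative_compose[OF ray_derivative, of F "\<lambda>h. G x \<bullet> h"] dF[of x] by simp
  moreover have "((\<lambda>r. F (r *\<^sub>R x)) has_derivative (\<lambda>h. h * (real l * F x))) (at 1)"
    unfolding homog by (auto intro!: derivative_eq_intros)
  ultimately have "(\<lambda>h. G x \<bullet> (h *\<^sub>R x)) = (\<lambda>h. h * (real l * F x))"
    by (rule has_derivative_unique)
  from fun_cong[OF this, of 1] show ?thesis by simp
qed

lemma G_homog:
  assumes r: "r > 0"
  shows "G (r *\<^sub>R x) = r ^ (l - 1) *\<^sub>R G x"
proof -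
  have dil: "((\<lambda>x. r *\<^sub>R x) has_derivative (\<lambda>h. r *\<^sub>R h)) (at x)"
    by (auto intro!: derivative_eq_intros)
  have "((\<lambda>x. F (r *\<^sub>R x)) has_derivative (\<lambda>h. G (r *\<^sub>R x) \<bullet> (r *\<^sub>R h))) (at x)"
    using has_derivative_compose[OF dil, of F "\<lambda>h. G (r *\<^sub>R x) \<bullet> h"] dF[of "r *\<^sub>R x"] by simp
  moreover have "((\<lambda>x. F (r *\<^sub>R x)) has_derivative (\<lambda>h. r ^ l * (G x \<bullet> h))) (at x)"
    unfolding homog by (auto intro!: derivative_eq_intros dF)
  ultimately have "(\<lambda>h. G (r *\<^sub>R x) \<bullet> (r *\<^sub>R h)) = (\<lambda>h. r ^ l * (G x \<bullet> h))"
    by (rule has_derivative_unique)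
  then have e: "r * (G (r *\<^sub>R x) \<bullet> h) = r ^ l * (G x \<bullet> h)" for h by (auto dest: fun_cong[of _ _ h])
  have "r ^ l = r * r ^ (l - 1)" using l by (cases l) auto
  then have "G (r *\<^sub>R x) \<bullet> h = (r ^ (l - 1) *\<^sub>R G x) \<bullet> h" for h using e[of h] r by simp
  then show ?thesis by (metis vector_eq_rdot)
qed

lemma H_radial: "H x x = (real l - 1) *\<^sub>R G x"
proof -
  have "((\<lambda>r. G (r *\<^sub>R x)) has_derivative (\<lambda>h. H x (h *\<^sub>R x))) (at 1)"
    using has_derivative_compose[OF ray_derivative, of G "H x"] dG[of x] by simp
  moreover have "((\<lambda>r. G (r *\<^sub>R x)) has_derivative (\<lambda>h. (h * (real l - 1)) *\<^sub>R G x)) (at 1)"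
  proof (rule has_derivative_transform_within_open[of _ _ 1 UNIV "{0<..}"])
    show "((\<lambda>r. r ^ (l - 1) *\<^sub>R G x) has_derivative (\<lambda>h. (h * (real l - 1)) *\<^sub>R G x)) (at 1)"
      using l by (auto intro!: derivative_eq_intros simp: of_nat_diff)
  qed (use G_homog in auto)
  ultimately have "(\<lambda>h. H x (h *\<^sub>R x)) = (\<lambda>h. (h * (real l - 1)) *\<^sub>R G x)"
    by (rule has_derivative_unique)
  from fun_cong[OF this, of 1] show ?thesis by simp
qed

lemma G_norm: "norm x = 1 \<Longrightarrow> G x \<bullet> G x = (real l)\<^sup>2"
  using gradsq[of x] by (simp add: norm_eq_1)

text \<open>Differentiating \<open>gradsq\<close> and using that \<open>H x\<close> is self-adjoint.\<close>

lemma H_grad: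
  assumes x: "norm x = 1"
  shows "H x (G x) = ((real l)\<^sup>2 * (real l - 1)) *\<^sub>R x"
proof -
  have xx: "x \<bullet> x = 1" using x by (simp add: norm_eq_1)
  have "((\<lambda>x. G x \<bullet> G x) has_derivative (\<lambda>h. G x \<bullet> H x h + H x h \<bullet> G x)) (at x)"
    by (rule has_derivative_inner[OF dG dG])
  moreover have "((\<lambda>x. G x \<bullet> G x) has_derivative (\<lambda>h. (real l)\<^sup>2 * (real l - 1) * (2 * (x \<bullet> h)))) (at x)"
    unfolding gradsq
    by (rule has_derivative_eq_rhs, (rule derivative_intros)+) (use xx l in \<open>auto simp: of_nat_diff inner_commute\<close>)
  ultimately have e: "(\<lambda>h. G x \<bullet> H x h + H x h \<bullet> G x) = (\<lambda>h. (real l)\<^sup>2 * (real l - 1) * (2 * (x \<bullet> h)))"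
    by (rule has_derivative_unique)
  have "H x (G x) \<bullet> h = (((real l)\<^sup>2 * (real l - 1)) *\<^sub>R x) \<bullet> h" for h
  proof -
    have "H x (G x) \<bullet> h = G x \<bullet> H x h" by (rule sym)
    moreover have "H x h \<bullet> G x = G x \<bullet> H x h" by (rule inner_commute)
    ultimately show ?thesis using fun_cong[OF e, of h] by simp
  qed
  then show ?thesis by (metis vector_eq_rdot)
qed

text \<open>The gradient of \<open>F\<close> on the sphere: by Euler's identity \<open>l * F x\<close> is the radial component of \<open>G x\<close>.\<close>

definition tangrad :: "'a \<Rightarrow> 'a" where "tangrad x = G x - (real l * F x) *\<^sub>R x"

lemma tangrad_tangent: "norm x = 1 \<Longrightarrow> tangrad x \<bullet> x = 0"
  by (simp add: tangrad_def inner_diff_left euler norm_eq_1)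

lemma tangrad_norm:
  assumes x: "norm x = 1"
  shows "tangrad x \<bullet> tangrad x = (real l)\<^sup>2 * (1 - (F x)\<^sup>2)"
proof -
  have "x \<bullet> x = 1" using x by (simp add: norm_eq_1)
  moreover have "x \<bullet> G x = real l * F x" by (metis euler inner_commute)
  ultimately show ?thesis
    by (simp add: tangrad_def inner_diff_left inner_diff_right euler G_norm[OF x] power2_eq_square algebra_simps)
qed

lemma F_range: "norm x = 1 \<Longrightarrow> F x \<in> {-1..1}"
proof -
  assume x: "norm x = 1"
  have "0 \<le> (real l)\<^sup>2 * (1 - (F x)\<^sup>2)" unfolding tangrad_norm[OF x, symmetric] by simp
  then have "(F x)\<^sup>2 \<le> 1" using l by (simp add: zero_le_mult_iff)
  then show ?thesis by (simp add: abs_square_le_1 abs_le_iff)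
qed

lemma sphere_gradient_comp:
  assumes x: "norm x = 1" and w: "(w has_real_derivative w') (at (F x))"
  shows "sphere_gradient (\<lambda>y. w (F y)) x = w' *\<^sub>R tangrad x"
proof -
  have "((\<lambda>y. w (F y)) has_derivative (\<lambda>h. w' * (G x \<bullet> h))) (at x)"
    using has_derivative_compose[OF dF, of w "\<lambda>h. w' * h" x] w by (simp add: has_field_derivative_def)
  then have "((\<lambda>y. w (F y)) has_derivative (\<lambda>h. (w' *\<^sub>R G x) \<bullet> h)) (at x)" by simp
  from sphere_gradient_eq[OF x this] show ?thesis
    by (simp add: tangrad_def euler scaleR_diff_right)
qed

lemma onb_card_trace:
  assumes x: "norm x = 1" and B: "orthonormal_basis (sphere_tangent x) B"
  shows "card B = n" "(\<Sum>e\<in>B. H x e \<bullet> e) = c - real l * (real l - 1) * F x"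
proof -
  note ins = onb_insert_normal[OF x B] and fB = onb_finite[OF B]
  have "card (insert x B) = n + 1" using onb_card[OF ins(1)] dim by simp
  then show "card B = n" using ins(2) fB by simp
  have "(\<Sum>e\<in>insert x B. H x e \<bullet> e) = c" using trace_onb[OF H_linear ins(1), of x] trace[OF x] by simp
  moreover have "H x x \<bullet> x = real l * (real l - 1) * F x" by (simp add: H_radial euler)
  ultimately show "(\<Sum>e\<in>B. H x e \<bullet> e) = c - real l * (real l - 1) * F x" using ins(2) fB by simp
qed

text \<open>Over the tangent space \<open>H x\<close> has trace \<open>c\<close> minus the radial entry known from Euler's identity, and the gradient
  condition gives the norm of \<open>tangrad\<close>; so only \<open>F\<close> itself is left.\<close>

lemma sphere_laplacian_comp:
  assumes x: "norm x = 1" and w: "\<And>t. (w has_real_derivative w1 t) (at t)" "\<And>t. (w1 has_real_derivative w2 t) (at t)"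
  shows "sphere_laplacian (\<lambda>y. w (F y)) x =
    w2 (F x) * ((real l)\<^sup>2 * (1 - (F x)\<^sup>2)) + w1 (F x) * (c - real l * (real n + real l - 1) * F x)"
proof -
  have xx: "x \<bullet> x = 1" using x by (simp add: norm_eq_1)
  let ?X' = "\<lambda>h. w1 (F x) *\<^sub>R (H x h - ((real l * F x) *\<^sub>R h + (real l * (G x \<bullet> h)) *\<^sub>R x)) + (w2 (F x) * (G x \<bullet> h)) *\<^sub>R tangrad x"
  have d1: "((\<lambda>y. w1 (F y)) has_derivative (\<lambda>h. w2 (F x) * (G x \<bullet> h))) (at x)"
    using has_derivative_compose[OF dF, of w1 "\<lambda>h. w2 (F x) * h" x] w(2)[of "F x"] by (simp add: has_field_derivative_def)
  have d2: "(tangrad has_derivative (\<lambda>h. H x h - ((real l * F x) *\<^sub>R h + (real l * (G x \<bullet> h)) *\<^sub>R x))) (at x)"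
    unfolding tangrad_def[abs_def] by (auto intro!: derivative_eq_intros dF dG)
  have X': "((\<lambda>y. w1 (F y) *\<^sub>R tangrad y) has_derivative ?X') (at x)"
    by (rule has_derivative_scaleR[OF d1 d2])
  obtain B where B: "orthonormal_basis (sphere_tangent x) B" "sphere_laplacian (\<lambda>y. w (F y)) x = (\<Sum>e\<in>B. ?X' e \<bullet> e)"
    using sphere_laplacian_eq[OF x sphere_gradient_comp[OF _ w(1)] X'] by blast
  have fB: "finite B" by (rule onb_finite[OF B(1)])
  have Be: "e \<bullet> x = 0" "x \<bullet> e = 0" "e \<bullet> e = 1" if "e \<in> B" for e
    using B(1) that by (auto simp: orthonormal_basis_def sphere_tangent_def norm_eq_1 inner_commute)
  have te: "tangrad x \<bullet> e = G x \<bullet> e" if "e \<in> B" for e using Be[OF that] by (simp add: tangrad_def inner_diff_left)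
  have "?X' e \<bullet> e = w1 (F x) * (H x e \<bullet> e - real l * F x) + w2 (F x) * (tangrad x \<bullet> e)\<^sup>2" if "e \<in> B" for e
    using Be[OF that] te[OF that] by (simp add: inner_add_left inner_diff_left power2_eq_square algebra_simps)
  then have "(\<Sum>e\<in>B. ?X' e \<bullet> e) = (\<Sum>e\<in>B. w1 (F x) * (H x e \<bullet> e - real l * F x) + w2 (F x) * (tangrad x \<bullet> e)\<^sup>2)"
    by (intro sum.cong) auto
  also have "\<dots> = w1 (F x) * ((\<Sum>e\<in>B. H x e \<bullet> e) - real (card B) * (real l * F x)) + w2 (F x) * (\<Sum>e\<in>B. (tangrad x \<bullet> e)\<^sup>2)"
    by (simp add: sum.distrib sum_distrib_left[symmetric] sum_subtractf)
  also have "(\<Sum>e\<in>B. (tangrad x \<bullet> e)\<^sup>2) = tangrad x \<bullet> tangrad x"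
  proof -
    have "tangrad x \<in> sphere_tangent x" using tangrad_tangent[OF x] by (simp add: sphere_tangent_def)
    from onb_expand[OF B(1) this] have "tangrad x \<bullet> tangrad x = tangrad x \<bullet> (\<Sum>e\<in>B. (tangrad x \<bullet> e) *\<^sub>R e)" by simp
    then show ?thesis by (simp add: inner_sum_right power2_eq_square)
  qed
  finally show ?thesis
    unfolding B(2) tangrad_norm[OF x] onb_card_trace[OF x B(1)] by (simp add: algebra_simps)
qed

subsection \<open>The normal geodesic flow\<close>

lemma H_bound: "\<exists>K. \<forall>x v. norm x = 1 \<longrightarrow> norm (H x v) \<le> K * norm v"
proof -
  have "continuous_on (sphere 0 1) (\<lambda>x. \<Sum>b\<in>Basis. norm (H x b))"
    by (intro continuous_intros polynomial_continuous[OF polynomial_H])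
  then have "bounded ((\<lambda>x. \<Sum>b\<in>Basis. norm (H x b)) ` sphere 0 1)"
    by (intro compact_imp_bounded compact_continuous_image compact_sphere)
  then obtain K where K: "\<forall>y\<in>(\<lambda>x. \<Sum>b\<in>Basis. norm (H x b)) ` sphere 0 1. norm y \<le> K"
    unfolding bounded_iff by blast
  have "norm (H x v) \<le> K * norm v" if x: "norm x = 1" for x v
  proof -
    have "H x v = H x (\<Sum>b\<in>Basis. (v \<bullet> b) *\<^sub>R b)" by (simp add: euclidean_representation)
    also have "\<dots> = (\<Sum>b\<in>Basis. (v \<bullet> b) *\<^sub>R H x b)"
      by (simp add: linear_sum[OF H_linear] linear_scale[OF H_linear])
    also have "norm \<dots> \<le> (\<Sum>b\<in>Basis. norm v * norm (H x b))"
      by (rule sum_norm_le) (auto intro!: mult_right_mono Basis_le_norm)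
    also have "\<dots> = (\<Sum>b\<in>Basis. norm (H x b)) * norm v" by (simp add: sum_distrib_left mult.commute)
    also have "\<dots> \<le> K * norm v"
    proof (rule mult_right_mono)
      have "norm (\<Sum>b\<in>Basis. norm (H x b)) \<le> K" using K x by auto
      then show "(\<Sum>b\<in>Basis. norm (H x b)) \<le> K" by simp
    qed simp
    finally show ?thesis .
  qed
  then show ?thesis by blast
qed

definition geo :: "'a \<Rightarrow> 'a \<Rightarrow> real \<Rightarrow> 'a" where "geo x v s = cos s *\<^sub>R x + sin s *\<^sub>R v"
definition geo' :: "'a \<Rightarrow> 'a \<Rightarrow> real \<Rightarrow> 'a" where "geo' x v s = cos s *\<^sub>R v - sin s *\<^sub>R x"

lemma geo_0: "geo x v 0 = x" "geo' x v 0 = v"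
  by (simp_all add: geo_def geo'_def)

lemma geo_deriv:
  "(geo x v has_vector_derivative geo' x v s) (at s within A)"
  "(geo' x v has_vector_derivative - geo x v s) (at s within A)"
proof -
  have c: "(cos has_vector_derivative - sin s) (at s within A)" "(sin has_vector_derivative cos s) (at s within A)"
    by (auto simp: has_real_derivative_iff_has_vector_derivative[symmetric] intro!: derivative_eq_intros)
  show "(geo x v has_vector_derivative geo' x v s) (at s within A)"
    unfolding geo_def[abs_def] geo'_def by (auto intro!: derivative_eq_intros c)
  show "(geo' x v has_vector_derivative - geo x v s) (at s within A)"
    unfolding geo_def geo'_def[abs_def] by (auto intro!: derivative_eq_intros c)
qed

lemma geo_continuous: "continuous_on A (geo x v)" "continuous_on A (geo' x v)"
  unfolding geo_def[abs_def] geo'_def[abs_def] by (intro continuous_intros)+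

lemma geo_inner:
  assumes "norm x = 1" "norm v = 1" "v \<bullet> x = 0"
  shows "geo x v s \<bullet> geo x v s = 1" "geo' x v s \<bullet> geo x v s = 0" "geo' x v s \<bullet> geo' x v s = 1" "norm (geo x v s) = 1"
proof -
  have i: "x \<bullet> x = 1" "v \<bullet> v = 1" "x \<bullet> v = 0" using assms by (auto simp: norm_eq_1 inner_commute)
  show "geo x v s \<bullet> geo x v s = 1" "geo' x v s \<bullet> geo x v s = 0" "geo' x v s \<bullet> geo' x v s = 1"
    using i assms(3) sin_cos_squared_add[of s]
    by (simp_all add: geo_def geo'_def inner_add_left inner_add_right inner_diff_left inner_diff_right power2_eq_square algebra_simps)
  then show "norm (geo x v s) = 1" by (simp add: norm_eq_1)
qed

lemma G_geo_deriv: "((\<lambda>s. G (geo x v s)) has_vector_derivative H (geo x v s) (geo' x v s)) (at s within A)"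
proof -
  have "(geo x v has_derivative (\<lambda>h. h *\<^sub>R geo' x v s)) (at s within A)"
    using geo_deriv(1) by (simp add: has_vector_derivative_def)
  from has_derivative_compose[OF this dG] show ?thesis
    by (simp add: has_vector_derivative_def linear_scale[OF H_linear])
qed

definition normal :: "real \<Rightarrow> 'a \<Rightarrow> 'a" where "normal a x = (1 / (real l * sin a)) *\<^sub>R tangrad x"

lemma normal_props:
  assumes x: "norm x = 1" "F x = cos a" and a: "0 < a" "a < pi"
  shows "norm (normal a x) = 1" "normal a x \<bullet> x = 0"
    "G x = (real l * cos a) *\<^sub>R x + (real l * sin a) *\<^sub>R normal a x"
proof -
  have sa: "sin a > 0" using a by (intro sin_gt_zero)
  have ls: "real l * sin a > 0" using sa l by simp
  have "tangrad x \<bullet> tangrad x = (real l * sin a)\<^sup>2"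
    using tangrad_norm[OF x(1)] x(2) by (simp add: sin_squared_eq power_mult_distrib)
  then have "norm (tangrad x) = real l * sin a"
    using ls by (simp add: norm_eq_sqrt_inner)
  then show "norm (normal a x) = 1" using sa l by (simp add: normal_def)
  show "normal a x \<bullet> x = 0" using tangrad_tangent[OF x(1)] by (simp add: normal_def)
  show "G x = (real l * cos a) *\<^sub>R x + (real l * sin a) *\<^sub>R normal a x"
    using sa l x by (simp add: normal_def tangrad_def)
qed

text \<open>Along the great circle starting at \<open>x\<close> in the normal direction, the defect \<open>V\<close> between the gradient and
  its expected value satisfies a linear differential equation and vanishes at the start. The equation
  follows from \<open>H_radial\<close> and \<open>H_grad\<close>, which express \<open>H\<close> on the position vector and on the gradient.\<close>

lemma gradient_along_normal_open:
  assumes x: "norm x = 1" "F x = cos a" and a: "0 < a" "a < pi" and s: "0 < a - real l * s" "a - real l * s < pi"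
  shows "G (geo x (normal a x) s) = (real l * cos (a - real l * s)) *\<^sub>R geo x (normal a x) s
    + (real l * sin (a - real l * s)) *\<^sub>R geo' x (normal a x) s"
proof -
  let ?v = "normal a x" and ?L = "real l"
  note np = normal_props[OF x a]
  let ?g = "geo x ?v" and ?g' = "geo' x ?v"
  note gi = geo_inner[OF x(1) np(1,2)]
  define p q where "p = min s 0" and "q = max s 0"
  have pq: "p \<le> q" "0 \<in> {p..q}" "s \<in> {p..q}" by (auto simp: p_def q_def)
  have range: "0 < a - ?L * r" "a - ?L * r < pi" if "r \<in> {p..q}" for r
  proof -
    have "?L * p \<le> ?L * r" "?L * r \<le> ?L * q" using that by (auto intro!: mult_left_mono)
    then show "0 < a - ?L * r" "a - ?L * r < pi"
      using s a by (auto simp: p_def q_def min_def max_def split: if_splits)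
  qed
  have "continuous_on {p..q} (\<lambda>r. sin (a - ?L * r))" by (intro continuous_intros)
  then obtain r0 where r0: "r0 \<in> {p..q}" "\<And>r. r \<in> {p..q} \<Longrightarrow> sin (a - ?L * r0) \<le> sin (a - ?L * r)"
    using continuous_attains_inf[of "{p..q}" "\<lambda>r. sin (a - ?L * r)"] pq by auto
  define m where "m = ?L * sin (a - ?L * r0)"
  have m: "m > 0" unfolding m_def using sin_gt_zero[OF range[OF r0(1)]] l by simp
  obtain K where K: "\<And>x v. norm x = 1 \<Longrightarrow> norm (H x v) \<le> K * norm v" using H_bound by blast
  define Z where "Z r = (?L * cos (a - ?L * r)) *\<^sub>R ?g r + (?L * sin (a - ?L * r)) *\<^sub>R ?g' r" for r
  define V where "V r = G (?g r) - Z r" for r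
  define V' where "V' r = H (?g r) (?g' r) - (?L * (?L - 1)) *\<^sub>R (sin (a - ?L * r) *\<^sub>R ?g r - cos (a - ?L * r) *\<^sub>R ?g' r)" for r
  have cs: "((\<lambda>r. ?L * cos (a - ?L * r)) has_vector_derivative ?L * (?L * sin (a - ?L * r))) (at r within A)"
    "((\<lambda>r. ?L * sin (a - ?L * r)) has_vector_derivative - (?L * (?L * cos (a - ?L * r)))) (at r within A)" for r A
    by (auto simp: has_real_derivative_iff_has_vector_derivative[symmetric] intro!: derivative_eq_intros)
  have dV: "(V has_vector_derivative V' r) (at r within A)" for r A
    unfolding V_def[abs_def] Z_def[abs_def] V'_def
    by (rule has_vector_derivative_eq_rhs, (rule derivative_intros G_geo_deriv geo_deriv cs)+) (simp add: algebra_simps)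
  have ode: "(?L * sin (a - ?L * r)) *\<^sub>R V' r = - H (?g r) (V r) - (?L * (?L - 1) * cos (a - ?L * r)) *\<^sub>R V r" for r
  proof -
    let ?y = "?g r" and ?y' = "?g' r"
    define C S where "C = cos (a - ?L * r)" and "S = sin (a - ?L * r)"
    have CS: "C * C + S * S = 1" unfolding C_def S_def by (metis sin_cos_squared_add3)
    have HV: "H ?y (V r) = (?L\<^sup>2 * (?L - 1)) *\<^sub>R ?y - (?L * C) *\<^sub>R ((?L - 1) *\<^sub>R G ?y) - (?L * S) *\<^sub>R H ?y ?y'"
      unfolding V_def Z_def C_def[symmetric] S_def[symmetric]
      by (simp add: linear_diff[OF H_linear] linear_add[OF H_linear] linear_scale[OF H_linear] H_grad[OF gi(4)] H_radial)
    have "(?L * S) * (V' r \<bullet> h) = - (H ?y (V r) \<bullet> h) - (?L * (?L - 1) * C) * (V r \<bullet> h)" for h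
    proof -
      define y y' g k where "y = ?y \<bullet> h" and "y' = ?y' \<bullet> h" and "g = G ?y \<bullet> h" and "k = H ?y ?y' \<bullet> h"
      have 1: "V' r \<bullet> h = k - ?L * (?L - 1) * (S * y - C * y')"
        by (simp add: V'_def C_def S_def y_def y'_def k_def inner_diff_left)
      have 2: "V r \<bullet> h = g - (?L * C * y + ?L * S * y')"
        by (simp add: V_def Z_def C_def S_def y_def y'_def g_def inner_diff_left inner_add_left)
      have 3: "H ?y (V r) \<bullet> h = ?L\<^sup>2 * (?L - 1) * y - ?L * C * ((?L - 1) * g) - ?L * S * k"
        unfolding HV by (simp add: y_def g_def k_def inner_diff_left)
      show ?thesis unfolding 1 2 3 using CS by algebra
    qed
    then have "((?L * S) *\<^sub>R V' r) \<bullet> h = (- H ?y (V r) - (?L * (?L - 1) * C) *\<^sub>R V r) \<bullet> h" for h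
      by (simp add: inner_diff_left)
    then show ?thesis unfolding C_def S_def by (metis vector_eq_rdot)
  qed
  have "V s \<bullet> V s = 0"
  proof (rule gronwall_eq_0[of p q "\<lambda>r. V r \<bullet> V r" "\<lambda>r. V r \<bullet> V' r + V' r \<bullet> V r" "2 * ((\<bar>K\<bar> + ?L * (?L - 1)) / m)" 0 s])
    fix r assume r: "r \<in> {p..q}"
    have dV2: "(V has_derivative (\<lambda>h. h *\<^sub>R V' r)) (at r within {p..q})"
      using dV by (simp add: has_vector_derivative_def)
    show "((\<lambda>r. V r \<bullet> V r) has_real_derivative V r \<bullet> V' r + V' r \<bullet> V r) (at r within {p..q})"
      unfolding has_field_derivative_def
      by (rule has_derivative_eq_rhs[OF has_derivative_inner[OF dV2 dV2]]) (auto simp: algebra_simps)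
    have "m * norm (V' r) \<le> (?L * sin (a - ?L * r)) * norm (V' r)"
      using r0(2)[OF r] unfolding m_def by (intro mult_right_mono mult_left_mono) auto
    also have "\<dots> = norm ((?L * sin (a - ?L * r)) *\<^sub>R V' r)"
      using sin_gt_zero[OF range[OF r]] by simp
    also have "\<dots> \<le> norm (H (?g r) (V r)) + norm ((?L * (?L - 1) * cos (a - ?L * r)) *\<^sub>R V r)"
      unfolding ode using norm_triangle_ineq4[of "- H (?g r) (V r)" "(?L * (?L - 1) * cos (a - ?L * r)) *\<^sub>R V r"] by simp
    also have "\<dots> \<le> \<bar>K\<bar> * norm (V r) + ?L * (?L - 1) * norm (V r)"
    proof (rule add_mono)
      have "norm (H (?g r) (V r)) \<le> K * norm (V r)" by (rule K[OF gi(4)])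
      also have "\<dots> \<le> \<bar>K\<bar> * norm (V r)" by (intro mult_right_mono) auto
      finally show "norm (H (?g r) (V r)) \<le> \<bar>K\<bar> * norm (V r)" .
      have "?L * (?L - 1) * \<bar>cos (a - ?L * r)\<bar> \<le> ?L * (?L - 1) * 1" using l by (intro mult_left_mono) auto
      then show "norm ((?L * (?L - 1) * cos (a - ?L * r)) *\<^sub>R V r) \<le> ?L * (?L - 1) * norm (V r)"
        using l by (simp add: abs_mult mult_right_mono)
    qed
    finally have "norm (V' r) \<le> (\<bar>K\<bar> + ?L * (?L - 1)) / m * norm (V r)"
      using m by (simp add: field_simps)
    then have b: "norm (V r) * norm (V' r) \<le> norm (V r) * ((\<bar>K\<bar> + ?L * (?L - 1)) / m * norm (V r))"
      by (intro mult_left_mono) auto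
    have "\<bar>V r \<bullet> V' r + V' r \<bullet> V r\<bar> \<le> 2 * (norm (V r) * norm (V' r))"
      using Cauchy_Schwarz_ineq2[of "V r" "V' r"] by (simp add: inner_commute)
    also have "\<dots> \<le> 2 * (norm (V r) * ((\<bar>K\<bar> + ?L * (?L - 1)) / m * norm (V r)))" using b by simp
    also have "\<dots> = 2 * ((\<bar>K\<bar> + ?L * (?L - 1)) / m) * (V r \<bullet> V r)"
      by (simp add: power2_norm_eq_inner[symmetric] power2_eq_square)
    finally show "\<bar>V r \<bullet> V' r + V' r \<bullet> V r\<bar> \<le> 2 * ((\<bar>K\<bar> + ?L * (?L - 1)) / m) * (V r \<bullet> V r)" .
  next
    show "V 0 \<bullet> V 0 = 0" using np(3) by (simp add: V_def Z_def geo_0)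
  qed (use pq in auto)
  then show ?thesis by (simp add: V_def Z_def)
qed

text \<open>The identity is closed, so it persists at the two ends, where the great circle meets the focal submanifolds.\<close>

lemma gradient_along_normal:
  assumes x: "norm x = 1" "F x = cos a" and a: "0 < a" "a < pi" and s: "0 \<le> a - real l * s" "a - real l * s \<le> pi"
  shows "G (geo x (normal a x) s) = (real l * cos (a - real l * s)) *\<^sub>R geo x (normal a x) s
    + (real l * sin (a - real l * s)) *\<^sub>R geo' x (normal a x) s"
proof -
  have lp: "real l > 0" using l by simp
  let ?V = "\<lambda>s. G (geo x (normal a x) s) - ((real l * cos (a - real l * s)) *\<^sub>R geo x (normal a x) s
    + (real l * sin (a - real l * s)) *\<^sub>R geo' x (normal a x) s)"
  let ?I = "{(a - pi) / real l<..<a / real l}"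
  have "continuous_on UNIV ?V"
    by (intro continuous_intros geo_continuous continuous_on_compose2[OF G_continuous[of UNIV] geo_continuous(1)]) auto
  then have "closed (UNIV \<inter> ?V -` {0})" by (intro continuous_closed_preimage) auto
  moreover have "?I \<subseteq> UNIV \<inter> ?V -` {0}"
    using gradient_along_normal_open[OF x a] lp by (auto simp: field_simps)
  ultimately have "closure ?I \<subseteq> UNIV \<inter> ?V -` {0}" by (rule closure_minimal[rotated])
  moreover have "closure ?I = {(a - pi) / real l..a / real l}"
    using lp by (intro closure_greaterThanLessThan) (auto simp: divide_strict_right_mono)
  moreover have "s \<in> {(a - pi) / real l..a / real l}" using s lp by (auto simp: field_simps)
  ultimately show ?thesis by auto
qed

lemma F_along_normal:
  assumes x: "norm x = 1" "F x = cos a" and a: "0 < a" "a < pi" and s: "0 \<le> a - real l * s" "a - real l * s \<le> pi"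
  shows "F (geo x (normal a x) s) = cos (a - real l * s)"
proof -
  note gi = geo_inner[OF x(1) normal_props(1,2)[OF x a]]
  have "real l * F (geo x (normal a x) s) = G (geo x (normal a x) s) \<bullet> geo x (normal a x) s" by (rule euler[symmetric])
  also have "\<dots> = real l * cos (a - real l * s)"
    unfolding gradient_along_normal[OF x a s] by (simp add: inner_add_left gi)
  finally show ?thesis using l by simp
qed

text \<open>The point at distance \<open>s\<close> on the normal great circle of a point of the level \<open>cos a\<close>. As a map of the ambient space it
  is polynomial, hence smooth.\<close>

definition level_flow :: "real \<Rightarrow> real \<Rightarrow> 'a \<Rightarrow> 'a" where
  "level_flow a s x = (cos s - sin s * cos a / sin a) *\<^sub>R x + (sin s / (real l * sin a)) *\<^sub>R G x"

lemma level_flow_polynomial: "polynomial_function (level_flow a s)"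
  unfolding level_flow_def[abs_def]
  by (intro polynomial_function_add polynomial_function_cmul polynomial_G polynomial_function_id[unfolded id_def])

lemma level_flow_eq:
  assumes x: "F x = cos a" and a: "0 < a" "a < pi"
  shows "level_flow a s x = geo x (normal a x) s"
proof -
  have "sin a > 0" using a by (intro sin_gt_zero)
  then show ?thesis using l
    by (simp add: level_flow_def geo_def normal_def tangrad_def x scaleR_diff_right scaleR_diff_left)
qed

lemma level_flow_inverse:
  assumes x: "x \<in> sphere_level F (cos a)" and a: "0 < a" "a < pi" and b: "0 < b" "b < pi" and s: "s = (a - b) / real l"
  shows "level_flow a s x \<in> sphere_level F (cos b)" "level_flow b (- s) (level_flow a s x) = x"
proof -
  have x': "norm x = 1" "F x = cos a" using x by (auto simp: sphere_level_def)
  have sb: "sin b > 0" using b by (intro sin_gt_zero)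
  let ?v = "normal a x"
  have als: "a - real l * s = b" using s l by simp
  note gi = geo_inner[OF x'(1) normal_props(1,2)[OF x' a]]
  have Fy: "F (geo x ?v s) = cos b" using F_along_normal[OF x' a, of s] als b by simp
  have G: "G (geo x ?v s) = (real l * cos b) *\<^sub>R geo x ?v s + (real l * sin b) *\<^sub>R geo' x ?v s"
    using gradient_along_normal[OF x' a, of s] als b by simp
  have n: "normal b (geo x ?v s) = geo' x ?v s"
  proof -
    have tg: "tangrad (geo x ?v s) = (real l * sin b) *\<^sub>R geo' x ?v s"
      unfolding tangrad_def[of "geo x ?v s"] Fy G by simp
    show ?thesis unfolding normal_def[of b "geo x ?v s"] tg using sb l by simp
  qed
  show "level_flow a s x \<in> sphere_level F (cos b)"
    unfolding level_flow_eq[OF x'(2) a] using gi Fy by (simp add: sphere_level_def)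
  have "(cos s * cos s + sin s * sin s) = 1" by (metis sin_cos_squared_add3)
  then have "geo (geo x ?v s) (geo' x ?v s) (- s) = x"
    by (simp add: geo_def geo'_def algebra_simps scaleR_left_distrib[symmetric])
  then show "level_flow b (- s) (level_flow a s x) = x"
    unfolding level_flow_eq[OF x'(2) a] level_flow_eq[OF Fy b] n .
qed

lemma levels_diffeomorphic:
  assumes t: "-1 < t" "t < 1" "-1 < t'" "t' < 1"
  shows "diffeomorphic (sphere_level F t) (sphere_level F t')"
proof -
  define a b where "a = arccos t" and "b = arccos t'"
  have a: "0 < a" "a < pi" "cos a = t" and b: "0 < b" "b < pi" "cos b = t'"
    using arccos_lt_bounded[of t] arccos_lt_bounded[of t'] t by (auto simp: a_def b_def)
  define s where "s = (a - b) / real l"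
  have s': "- s = (b - a) / real l" by (simp add: s_def minus_divide_left)
  note f = level_flow_inverse[OF _ a(1,2) b(1,2) s_def, unfolded a b]
  note g = level_flow_inverse[OF _ b(1,2) a(1,2) s', unfolded a b minus_minus]
  have "homeomorphism (sphere_level F t) (sphere_level F t') (level_flow a s) (level_flow b (- s))"
    unfolding homeomorphism_def
  proof (intro conjI ballI)
    show "level_flow a s ` sphere_level F t = sphere_level F t'" using f g by force
    show "level_flow b (- s) ` sphere_level F t' = sphere_level F t" using f g by force
  qed (use f g polynomial_continuous[OF level_flow_polynomial] in auto)
  moreover have "smooth_on (sphere_level F t) (level_flow a s)" "smooth_on (sphere_level F t') (level_flow b (- s))"
    by (rule polynomial_smooth_on[OF level_flow_polynomial], simp)+
  ultimately show ?thesis unfolding diffeomorphic_def by blast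
qed

lemma level_nonempty:
  assumes t: "-1 < t" "t < 1" "sphere_level F t \<noteq> {}" and t': "t' \<in> {-1..1}"
  shows "sphere_level F t' \<noteq> {}"
proof -
  obtain x where x: "norm x = 1" "F x = t" using t by (auto simp: sphere_level_def)
  define a b where "a = arccos t" and "b = arccos t'"
  have a: "0 < a" "a < pi" "cos a = t" and b: "0 \<le> b" "b \<le> pi" "cos b = t'"
    using arccos_lt_bounded[of t] arccos_bounded[of t'] t t' by (auto simp: a_def b_def)
  have x': "F x = cos a" using x a by simp
  have e: "a - real l * ((a - b) / real l) = b" using l by simp
  have "F (geo x (normal a x) ((a - b) / real l)) = t'"
    using F_along_normal[OF x(1) x' a(1,2), of "(a - b) / real l"] b unfolding e by simp
  moreover have "norm (geo x (normal a x) ((a - b) / real l)) = 1"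
    by (rule geo_inner(4)[OF x(1) normal_props(1,2)[OF x(1) x' a(1,2)]])
  ultimately show ?thesis unfolding sphere_level_def by force
qed

lemma sphere_gradient_F: "norm x = 1 \<Longrightarrow> sphere_gradient F x = tangrad x"
  using sphere_gradient_comp[of x "\<lambda>t. t" 1] by simp

lemma tangrad_zero_iff: "norm x = 1 \<Longrightarrow> tangrad x = 0 \<longleftrightarrow> F x = 1 \<or> F x = -1"
proof -
  assume x: "norm x = 1"
  have "tangrad x = 0 \<longleftrightarrow> (real l)\<^sup>2 * (1 - (F x)\<^sup>2) = 0" using tangrad_norm[OF x] by (metis inner_eq_zero_iff)
  also have "\<dots> \<longleftrightarrow> (F x)\<^sup>2 = 1" using l by auto
  finally show ?thesis by (simp add: power2_eq_1_iff)
qed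

lemma isoparametric_F: "isoparametric_function F"
  unfolding isoparametric_function_def
proof (rule conjI, goal_cases)
  case 1
  show "smooth_on unit_sphere F"
    by (rule polynomial_smooth_on) (use polyF real_polynomial_function_eq in auto)
next
  case 2
  show ?case
  proof (rule exI[of _ "\<lambda>t. c - real l * (real n + real l - 1) * t"], rule exI[of _ "\<lambda>t. (real l)\<^sup>2 * (1 - t * t)"], intro conjI ballI)
    have id: "real_polynomial_function (\<lambda>t::real. t)" by (intro real_polynomial_function.intros bounded_linear_ident)
    have sm: "smooth_open UNIV f" if "real_polynomial_function f" for f :: "real \<Rightarrow> real"
      using that polynomial_Ck_open real_polynomial_function_eq unfolding smooth_open_def by blast
    show "smooth_open UNIV (\<lambda>t. c - real l * (real n + real l - 1) * t)"
      by (intro sm real_polynomial_function_diff real_polynomial_function.intros(2,4) id)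
    show "smooth_open UNIV (\<lambda>t. (real l)\<^sup>2 * (1 - t * t))"
      by (intro sm real_polynomial_function_diff real_polynomial_function.intros(2,4) id)
    fix x :: 'a assume "x \<in> unit_sphere"
    then have x: "norm x = 1" by simp
    show "(norm (sphere_gradient F x))\<^sup>2 = (real l)\<^sup>2 * (1 - F x * F x)"
      unfolding sphere_gradient_F[OF x] power2_norm_eq_inner tangrad_norm[OF x] by (simp add: power2_eq_square)
    show "sphere_laplacian F x = c - real l * (real n + real l - 1) * F x"
      using sphere_laplacian_comp[OF x, of "\<lambda>t. t" "\<lambda>_. 1" "\<lambda>_. 0"] by (auto intro!: derivative_eq_intros)
  qed
qed

lemma level_isoparametric:
  assumes t: "-1 < t" "t < 1" "-1 < t'" "t' < 1" and ne: "sphere_level F t \<noteq> {}" and conn: "connected (sphere_level F t)"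
  shows "isoparametric_hypersurface (sphere_level F t')"
proof -
  obtain \<phi> \<psi> where "homeomorphism (sphere_level F t) (sphere_level F t') \<phi> \<psi>"
    using levels_diffeomorphic[OF t] unfolding diffeomorphic_def by blast
  then have "connected (sphere_level F t')"
    using connected_continuous_image[OF _ conn] unfolding homeomorphism_def by metis
  moreover have "sphere_level F t' \<noteq> {}" by (rule level_nonempty[OF t(1,2) ne]) (use t in auto)
  moreover have "sphere_level F t' \<inter> sphere_critical_set F = {}"
    using t sphere_gradient_F tangrad_zero_iff by (fastforce simp: sphere_level_def sphere_critical_set_def)
  ultimately show ?thesis
    unfolding isoparametric_hypersurface_def regular_level_set_def using isoparametric_F by blast
qed

subsection \<open>The Hessian on a focal submanifold\<close>

lemma grad_focal:
  assumes x: "norm x = 1" "F x = 1"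
  shows "G x = real l *\<^sub>R x"
proof -
  have "tangrad x = 0" using tangrad_zero_iff[OF x(1)] x(2) by blast
  then show ?thesis using x by (simp add: tangrad_def)
qed

text \<open>On a focal submanifold \<open>H - l\<close> acts on tangent vectors of the sphere with eigenvalues \<open>0\<close> and \<open>- l\<^sup>2\<close>.
  The quadratic identity behind this is the second order expansion, along a great circle, of
  \<open>\<bar>tangrad\<bar>\<^sup>2 = l\<^sup>2 (1 - F\<^sup>2)\<close>, both sides of which vanish to second order at a focal point.\<close>

lemma focal_hessian:
  assumes x: "norm x = 1" "F x = 1" and e: "norm e = 1" "e \<bullet> x = 0"
  defines "A \<equiv> H x e - real l *\<^sub>R e"
  shows "A \<bullet> A = - ((real l)\<^sup>2 * (A \<bullet> e))"
proof -
  let ?L = "real l" and ?g = "geo x e" and ?g' = "geo' x e"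
  note gi = geo_inner[OF x(1) e]
  note Gx = grad_focal[OF x]
  define q where "q s = G (?g s) \<bullet> ?g' s" for s
  define X where "X s = tangrad (?g s)" for s
  define X' where "X' s = H (?g s) (?g' s) - ((?L * F (?g s)) *\<^sub>R ?g' s + (?L * q s) *\<^sub>R ?g s)" for s
  have gd: "(?g has_derivative (\<lambda>h. h *\<^sub>R ?g' s)) (at s)" for s
    using geo_deriv(1) by (simp add: has_vector_derivative_def)
  have dFg: "((\<lambda>s. F (?g s)) has_real_derivative q s) (at s)" for s
  proof -
    have "((\<lambda>s. F (?g s)) has_derivative (\<lambda>h. G (?g s) \<bullet> (h *\<^sub>R ?g' s))) (at s)"
      by (rule has_derivative_compose[OF gd dF])
    then show ?thesis by (simp add: has_field_derivative_def q_def mult_commute_abs)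
  qed
  have X_deriv: "(X has_vector_derivative X' s) (at s)" for s
  proof -
    have "((\<lambda>s. ?L * F (?g s)) has_real_derivative ?L * q s) (at s)" by (rule DERIV_cmult[OF dFg])
    then show ?thesis
      unfolding X_def[abs_def] tangrad_def X'_def
      by (intro has_vector_derivative_diff G_geo_deriv has_vector_derivative_scaleR geo_deriv)
  qed
  have xe: "x \<bullet> e = 0" using e by (simp add: inner_commute)
  have q0: "q 0 = 0" using Gx xe by (simp add: q_def geo_0)
  have X0: "X 0 = 0" using Gx x by (simp add: X_def geo_0 tangrad_def)
  have X'0: "X' 0 = A" using x q0 by (simp add: X'_def geo_0 A_def)
  have dq: "(q has_real_derivative A \<bullet> e) (at 0)"
  proof -
    have g'd: "(?g' has_derivative (\<lambda>h. h *\<^sub>R (- ?g 0))) (at 0)"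
      using geo_deriv(2)[of x e 0 UNIV] unfolding has_vector_derivative_def by simp
    have Gd: "((\<lambda>s. G (?g s)) has_derivative (\<lambda>h. h *\<^sub>R H (?g 0) (?g' 0))) (at 0)"
      using G_geo_deriv[of x e 0 UNIV] by (simp add: has_vector_derivative_def)
    have "(q has_derivative (\<lambda>h. h * (A \<bullet> e))) (at 0)"
      unfolding q_def[abs_def]
      by (rule has_derivative_eq_rhs[OF has_derivative_inner[OF Gd g'd]])
        (use Gx x e xe in \<open>auto simp: fun_eq_iff geo_0 A_def inner_diff_left norm_eq_1 algebra_simps\<close>)
    then show ?thesis by (simp add: has_field_derivative_def mult_commute_abs)
  qed
  have ident: "X s \<bullet> X' s = - (?L\<^sup>2 * F (?g s) * q s)" for s
  proof -
    let ?y = "?g s" and ?y' = "?g' s"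
    have 1: "G ?y \<bullet> H ?y ?y' = 0"
      using sym[of ?y "G ?y" ?y'] H_grad[OF gi(4)] gi(2) by (simp add: inner_commute)
    have 2: "?y \<bullet> H ?y ?y' = (?L - 1) * q s"
      using sym[of ?y ?y ?y'] H_radial[of ?y] by (simp add: q_def)
    have 3: "G ?y \<bullet> ?y = ?L * F ?y" by (rule euler)
    have 4: "?y \<bullet> ?y' = 0" using gi(2) by (simp add: inner_commute)
    have "X s \<bullet> X' s = G ?y \<bullet> H ?y ?y' - ((?L * F ?y) * (G ?y \<bullet> ?y') + (?L * q s) * (G ?y \<bullet> ?y))
      - (?L * F ?y) * (?y \<bullet> H ?y ?y' - ((?L * F ?y) * (?y \<bullet> ?y') + (?L * q s) * (?y \<bullet> ?y)))"
      by (simp add: X_def tangrad_def X'_def inner_diff_left inner_diff_right inner_add_right algebra_simps)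
    also have "\<dots> = - (?L\<^sup>2 * F ?y * q s)"
      unfolding 1 2 3 4 gi(1) q_def[symmetric] by (simp add: power2_eq_square algebra_simps)
    finally show ?thesis .
  qed
  have X'c: "((\<lambda>s. X' s \<bullet> b) \<longlongrightarrow> A \<bullet> b) (at 0)" for b
  proof -
    have Fc: "isCont (\<lambda>s. F (?g s)) 0" by (rule DERIV_isCont[OF dFg])
    have qc: "isCont q 0" by (rule DERIV_isCont[OF dq])
    have gc: "isCont ?g 0" "isCont ?g' 0"
      using geo_continuous[of UNIV x e] by (auto simp: continuous_on_eq_continuous_at)
    have Hc: "isCont (\<lambda>s. H (?g s) u) 0" for u
      using continuous_on_compose2[OF polynomial_continuous[OF polynomial_H, of UNIV u] geo_continuous(1)[of UNIV x e]]
      by (auto simp: continuous_on_eq_continuous_at)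
    have "X' = (\<lambda>s. cos s *\<^sub>R H (?g s) e - sin s *\<^sub>R H (?g s) x - ((?L * F (?g s)) *\<^sub>R ?g' s + (?L * q s) *\<^sub>R ?g s))"
      by (rule ext) (simp add: X'_def geo'_def linear_diff[OF H_linear] linear_scale[OF H_linear])
    then have "isCont X' 0" using Fc qc gc Hc by (auto intro!: continuous_intros)
    then have "isCont (\<lambda>s. X' s \<bullet> b) 0" by (intro continuous_intros)
    then show ?thesis using X'0 by (simp add: isCont_def)
  qed
  have Xb: "((\<lambda>s. (X s \<bullet> b) / s) \<longlongrightarrow> A \<bullet> b) (at 0)" for b
  proof (rule real_quotient_limit)
    have "(X has_derivative (\<lambda>h. h *\<^sub>R A)) (at 0)" using X_deriv[of 0] X'0 by (simp add: has_vector_derivative_def)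
    then have "((\<lambda>s. X s \<bullet> b) has_derivative (\<lambda>h. (h *\<^sub>R A) \<bullet> b)) (at 0)" by (intro has_derivative_inner_left)
    then show "((\<lambda>s. X s \<bullet> b) has_real_derivative A \<bullet> b) (at 0)"
      by (simp add: has_field_derivative_def mult_commute_abs)
    show "X 0 \<bullet> b = 0" using X0 by simp
  qed
  have "((\<lambda>s. \<Sum>b\<in>Basis. (X s \<bullet> b) / s * (X' s \<bullet> b)) \<longlongrightarrow> (\<Sum>b\<in>Basis. (A \<bullet> b) * (A \<bullet> b))) (at 0)"
    by (intro tendsto_intros Xb X'c)
  moreover have "(\<Sum>b\<in>Basis. (X s \<bullet> b) / s * (X' s \<bullet> b)) = - (?L\<^sup>2 * F (?g s)) * (q s / s)" for s
  proof -
    have "(\<Sum>b\<in>Basis. (X s \<bullet> b) / s * (X' s \<bullet> b)) = (\<Sum>b\<in>Basis. (X s \<bullet> b) * (X' s \<bullet> b)) / s"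
      by (simp add: sum_divide_distrib)
    also have "(\<Sum>b\<in>Basis. (X s \<bullet> b) * (X' s \<bullet> b)) = X s \<bullet> X' s" by (rule euclidean_inner[symmetric])
    finally show ?thesis unfolding ident by simp
  qed
  moreover have "((\<lambda>s. - (?L\<^sup>2 * F (?g s)) * (q s / s)) \<longlongrightarrow> - (?L\<^sup>2 * F (?g 0)) * (A \<bullet> e)) (at 0)"
    using DERIV_isCont[OF dFg[of 0]] by (intro tendsto_intros real_quotient_limit[OF dq q0]) (simp add: isCont_def)
  ultimately have "(\<Sum>b\<in>Basis. (A \<bullet> b) * (A \<bullet> b)) = - (?L\<^sup>2 * F (?g 0)) * (A \<bullet> e)"
    using tendsto_unique[of "at (0::real)"] by fastforce
  then show ?thesis using x by (simp add: euclidean_inner[of A A] geo_0)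
qed

text \<open>With \<open>k = l - H x e \<bullet> e\<close> the quadratic identity and the Cauchy--Schwarz inequality give \<open>0 \<le> k\<close> and \<open>k\<^sup>2 \<le> l\<^sup>2 k\<close>.\<close>

lemma focal_hessian_bounds:
  assumes x: "norm x = 1" "F x = 1" and e: "norm e = 1" "e \<bullet> x = 0"
  shows "0 \<le> real l - H x e \<bullet> e" "real l - H x e \<bullet> e \<le> (real l)\<^sup>2"
proof -
  let ?A = "H x e - real l *\<^sub>R e" and ?k = "real l - H x e \<bullet> e"
  have ee: "e \<bullet> e = 1" using e by (simp add: norm_eq_1)
  have Ae: "?A \<bullet> e = - ?k" using ee by (simp add: inner_diff_left)
  have AA: "?A \<bullet> ?A = (real l)\<^sup>2 * ?k" unfolding focal_hessian[OF x e] Ae by (simp add: algebra_simps)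
  have "0 \<le> (real l)\<^sup>2 * ?k" unfolding AA[symmetric] by simp
  then show k: "0 \<le> ?k" using l by (simp add: zero_le_mult_iff)
  have "(?A \<bullet> e)\<^sup>2 \<le> (?A \<bullet> ?A) * (e \<bullet> e)" by (rule Cauchy_Schwarz_ineq)
  then have "?k\<^sup>2 \<le> (real l)\<^sup>2 * ?k * 1" unfolding Ae AA ee power2_minus .
  then have "?k * ?k \<le> (real l)\<^sup>2 * ?k" by (simp only: power2_eq_square[of ?k] mult_1_right)
  then show "?k \<le> (real l)\<^sup>2" using k by (cases "?k = 0") auto
qed

text \<open>The number of eigenvalues \<open>- l\<^sup>2\<close> of the spherical Hessian along \<open>F = 1\<close>, as determined by its trace; this is the
  expected codimension of that focal submanifold.\<close>

definition codim_const :: real where "codim_const = (real l * (real n + real l - 1) - c) / (real l)\<^sup>2"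

lemma focal_trace:
  assumes x: "norm x = 1" "F x = 1" and B: "orthonormal_basis (sphere_tangent x) B"
  shows "(\<Sum>e\<in>B. real l - H x e \<bullet> e) = (real l)\<^sup>2 * codim_const"
proof -
  have "(\<Sum>e\<in>B. real l - H x e \<bullet> e) = real n * real l - (c - real l * (real l - 1))"
    using onb_card_trace[OF x(1) B] x(2) by (simp add: sum_subtractf)
  also have "\<dots> = real l * (real n + real l - 1) - c" by (simp add: algebra_simps)
  also have "\<dots> = (real l)\<^sup>2 * codim_const" using l by (simp add: codim_const_def)
  finally show ?thesis .
qed

lemma onb_tangent_vector:
  assumes "orthonormal_basis (sphere_tangent x) B" "e \<in> B"
  shows "norm e = 1" "e \<bullet> x = 0"
  using assms by (auto simp: orthonormal_basis_def sphere_tangent_def)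

text \<open>The tangent of a normal great circle is an eigenvector of \<open>H\<close> with eigenvalue \<open>- l (l - 1)\<close>. It contributes \<open>l\<^sup>2\<close> to the
  trace of \<open>l - H\<close>, and no other direction contributes a negative amount.\<close>

lemma codim_const_ge_1:
  assumes y: "norm y = 1" "-1 < F y" "F y < 1"
  shows "codim_const \<ge> 1"
proof -
  define a where "a = arccos (F y)"
  have a: "0 < a" "a < pi" "F y = cos a" using arccos_lt_bounded[of "F y"] y by (auto simp: a_def)
  let ?L = "real l"
  have L: "?L > 0" using l by simp
  define v where "v = normal a y"
  note np = normal_props[OF y(1) a(3,1,2), folded v_def]
  note gi = geo_inner[OF y(1) np(1,2)]
  define s where "s = a / ?L"
  have ls: "?L * s = a" using L by (simp add: s_def)
  have s0: "s > 0" using a L by (simp add: s_def)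
  let ?x = "geo y v s" and ?e = "geo' y v s"
  have x: "norm ?x = 1" "F ?x = 1"
    using gi(4) F_along_normal[OF y(1) a(3,1,2), of s] ls a by (auto simp: v_def)
  have e: "norm ?e = 1" "?e \<bullet> ?x = 0" using gi by (auto simp: norm_eq_1)
  let ?Z = "\<lambda>r. (?L * cos (a - ?L * r)) *\<^sub>R geo y v r + (?L * sin (a - ?L * r)) *\<^sub>R geo' y v r"
  have cs: "((\<lambda>r. ?L * cos (a - ?L * r)) has_vector_derivative 0) (at s within {0..s})"
    "((\<lambda>r. ?L * sin (a - ?L * r)) has_vector_derivative - (?L * ?L)) (at s within {0..s})"
    using ls by (auto simp: has_real_derivative_iff_has_vector_derivative[symmetric] intro!: derivative_eq_intros)
  have Z: "(?Z has_vector_derivative (?L - ?L * ?L) *\<^sub>R ?e) (at s within {0..s})"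
    by (rule has_vector_derivative_eq_rhs, (rule derivative_intros geo_deriv cs)+) (simp add: ls scaleR_diff_left)
  have "((\<lambda>r. G (geo y v r)) has_vector_derivative (?L - ?L * ?L) *\<^sub>R ?e) (at s within {0..s})"
  proof (rule has_vector_derivative_transform[OF _ _ Z])
    fix r assume r: "r \<in> {0..s}"
    have "?L * r \<le> ?L * s" "0 \<le> ?L * r" using r L by (auto intro!: mult_left_mono)
    then show "G (geo y v r) = ?Z r"
      using gradient_along_normal[OF y(1) a(3,1,2), of r] ls a by (simp add: v_def)
  qed (use s0 in auto)
  then have He: "H ?x ?e = (?L - ?L * ?L) *\<^sub>R ?e"
    using vector_derivative_unique_within[OF _ G_geo_deriv] s0
    by (metis atLeastAtMost_iff at_within_Icc_at_left less_eq_real_def trivial_limit_at_left_real)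
  have Te: "span {?e} \<subseteq> sphere_tangent ?x"
    by (rule span_minimal) (use e subspace_sphere_tangent in \<open>auto simp: sphere_tangent_def\<close>)
  obtain B1 B2 where B: "orthonormal_basis (span {?e}) B1" "orthonormal_basis (sphere_tangent ?x) (B1 \<union> B2)" "B1 \<inter> B2 = {}"
    by (rule onb_extend[OF subspace_span subspace_sphere_tangent Te])
  have fB: "finite B1" "finite B2" using onb_finite[OF B(2)] by auto
  note tB = onb_tangent_vector[OF B(2)]
  have k1: "?L - H ?x b \<bullet> b = ?L\<^sup>2" if b: "b \<in> B1" for b
  proof -
    have "b \<in> span {?e}" using B(1) b by (auto simp: orthonormal_basis_def)
    then obtain t where t: "b = t *\<^sub>R ?e" by (auto simp: span_singleton)
    have bb: "b \<bullet> b = 1" using tB(1)[of b] b by (auto simp: norm_eq_1)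
    have "H ?x b = (?L - ?L * ?L) *\<^sub>R b" unfolding t linear_scale[OF H_linear] He by (simp add: mult.commute)
    then show ?thesis using bb by (simp add: power2_eq_square)
  qed
  have "norm ?e \<noteq> 0" using e by simp
  then have "B1 \<noteq> {}" using B(1) span_base[of ?e "{?e}"] by (auto simp: orthonormal_basis_def)
  then have "1 \<le> card B1" using fB by (simp add: Suc_le_eq card_gt_0_iff)
  then have "?L\<^sup>2 * 1 \<le> ?L\<^sup>2 * real (card B1)" by (intro mult_left_mono) auto
  also have "\<dots> = (\<Sum>b\<in>B1. ?L - H ?x b \<bullet> b)" using k1 by simp
  also have "\<dots> \<le> (\<Sum>b\<in>B1. ?L - H ?x b \<bullet> b) + (\<Sum>b\<in>B2. ?L - H ?x b \<bullet> b)"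
    using focal_hessian_bounds(1)[OF x tB] by (auto intro!: sum_nonneg)
  also have "\<dots> = (\<Sum>b\<in>B1 \<union> B2. ?L - H ?x b \<bullet> b)" using fB B(3) by (simp add: sum.union_disjoint)
  also have "\<dots> = ?L\<^sup>2 * codim_const" by (rule focal_trace[OF x B(2)])
  finally show ?thesis using L by simp
qed

text \<open>Differentiating \<open>G y = l y\<close> along curves in the focal submanifold shows that its tangent vectors lie in the
  kernel of \<open>H - l\<close>, so its codimension bounds the trace of \<open>l - H\<close>.\<close>

lemma codim_const_le:
  assumes M: "smooth_submanifold d (sphere_level F 1)" and ne: "sphere_level F 1 \<noteq> {}"
  shows "codim_const \<le> real n - real d"
proof -
  obtain x where xM: "x \<in> sphere_level F 1" using ne by blast
  then have x: "norm x = 1" "F x = 1" by (auto simp: sphere_level_def)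
  obtain U V W \<phi> \<psi> where ch: "open U" "open (V :: 'a set)" "x \<in> U" "homeomorphism U V \<phi> \<psi>"
    "smooth_open U \<phi>" "smooth_open V \<psi>" "subspace W" "dim W = d" "\<phi> ` (sphere_level F 1 \<inter> U) = W \<inter> V"
    using M xM unfolding smooth_submanifold_def by meson
  have "Ck_open (Suc 0) U \<phi>" "Ck_open (Suc 0) V \<psi>" using ch(5,6) by (auto simp: smooth_open_def simp del: Ck_open.simps)
  then obtain \<phi>' \<psi>' where d: "\<And>y. y \<in> U \<Longrightarrow> (\<phi> has_derivative \<phi>' y) (at y)" "\<And>y. y \<in> V \<Longrightarrow> (\<psi> has_derivative \<psi>' y) (at y)"
    unfolding Ck_open.simps by blast
  define q where "q = \<phi> x"
  have q: "q \<in> W" "q \<in> V" "\<psi> q = x" using ch(3,4,9) xM unfolding q_def homeomorphism_def by blast+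
  define A where "A = \<psi>' q"
  have dA: "(\<psi> has_derivative A) (at q)" using d(2)[OF q(2)] by (simp add: A_def)
  have linA: "linear A" by (rule has_derivative_linear[OF dA])
  have injA: "inj A"
  proof -
    have "((\<lambda>z. \<phi> (\<psi> z)) has_derivative (\<lambda>h. \<phi>' x (A h))) (at q)"
      by (rule has_derivative_compose[OF dA]) (use d(1)[OF ch(3)] q in simp)
    moreover have "((\<lambda>z. \<phi> (\<psi> z)) has_derivative (\<lambda>h. h)) (at q)"
      by (rule has_derivative_transform_within_open[OF has_derivative_ident ch(2) q(2)])
        (use ch(4) in \<open>auto simp: homeomorphism_def\<close>)
    ultimately have "(\<lambda>h. \<phi>' x (A h)) = (\<lambda>h. h)" by (rule has_derivative_unique)
    then show ?thesis by (metis injI)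
  qed
  \<comment> \<open>Straight lines in the chart are curves in the focal submanifold.\<close>
  have tang: "H x (A w) = real l *\<^sub>R A w \<and> A w \<bullet> x = 0" if w: "w \<in> W" for w
  proof -
    let ?p = "\<lambda>t::real. q + t *\<^sub>R w"
    have cp: "continuous_on UNIV ?p" by (intro continuous_intros)
    have oS: "open (?p -` V)" using ch(2) by (rule open_vimage[OF _ cp])
    have onM: "\<psi> (?p t) \<in> sphere_level F 1" if t: "t \<in> ?p -` V" for t
    proof -
      have "?p t \<in> W \<inter> V" using t w q ch(7) by (auto intro!: subspace_add subspace_scale)
      then obtain z where "z \<in> sphere_level F 1 \<inter> U" "?p t = \<phi> z" using ch(9) by blast
      then show ?thesis using ch(4) by (auto simp: homeomorphism_def)
    qed
    have 0: "0 \<in> ?p -` V" using q by simp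
    have pd: "(?p has_derivative (\<lambda>t. t *\<^sub>R w)) (at 0)" by (auto intro!: derivative_eq_intros)
    have dp: "((\<lambda>t. \<psi> (?p t)) has_derivative (\<lambda>t. A (t *\<^sub>R w))) (at 0)"
      using has_derivative_compose[OF pd, of \<psi> A] dA by simp
    have dG': "((\<lambda>t. G (\<psi> (?p t))) has_derivative (\<lambda>t. H x (A (t *\<^sub>R w)))) (at 0)"
      using has_derivative_compose[OF dp dG] q by simp
    have dl: "((\<lambda>t. G (\<psi> (?p t))) has_derivative (\<lambda>t. real l *\<^sub>R A (t *\<^sub>R w))) (at 0)"
      by (rule has_derivative_transform_within_open[OF has_derivative_scaleR_right[OF dp] oS 0])
        (use onM grad_focal in \<open>auto simp: sphere_level_def\<close>)
    have 1: "H x (A w) = real l *\<^sub>R A w"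
      using fun_cong[OF has_derivative_unique[OF dG' dl], of 1] by simp
    have di: "((\<lambda>t. \<psi> (?p t) \<bullet> \<psi> (?p t)) has_derivative (\<lambda>t. \<psi> (?p 0) \<bullet> A (t *\<^sub>R w) + A (t *\<^sub>R w) \<bullet> \<psi> (?p 0))) (at 0)"
      by (rule has_derivative_inner[OF dp dp])
    have dc: "((\<lambda>t. \<psi> (?p t) \<bullet> \<psi> (?p t)) has_derivative (\<lambda>t. 0)) (at 0)"
      by (rule has_derivative_transform_within_open[OF has_derivative_const[of 1] oS 0])
        (use onM in \<open>auto simp: sphere_level_def norm_eq_1\<close>)
    have "x \<bullet> A w + A w \<bullet> x = 0"
      using fun_cong[OF has_derivative_unique[OF di dc], of 1] q by simp
    then show ?thesis using 1 by (simp add: inner_commute)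
  qed
  define T where "T = A ` W"
  have sT: "subspace T" unfolding T_def by (rule linear_subspace_image[OF linA ch(7)])
  have dT: "dim T = d"
    unfolding T_def using dim_image_eq[OF linA, of W] injA ch(8) by (simp add: inj_on_subset)
  have TT: "T \<subseteq> sphere_tangent x" using tang by (auto simp: T_def sphere_tangent_def)
  obtain B1 B2 where B: "orthonormal_basis T B1" "orthonormal_basis (sphere_tangent x) (B1 \<union> B2)" "B1 \<inter> B2 = {}"
    by (rule onb_extend[OF sT subspace_sphere_tangent TT])
  have fB: "finite B1" "finite B2" using onb_finite[OF B(2)] by auto
  note tB = onb_tangent_vector[OF B(2)]
  have k1: "real l - H x b \<bullet> b = 0" if b: "b \<in> B1" for b
  proof -
    have "b \<in> T" using B(1) b by (auto simp: orthonormal_basis_def)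
    then have "H x b = real l *\<^sub>R b" using tang by (auto simp: T_def)
    then show ?thesis using tB(1)[of b] b by (simp add: norm_eq_1)
  qed
  have "card (B1 \<union> B2) = n" by (rule onb_card_trace(1)[OF x(1) B(2)])
  then have cards: "real (card B2) = real n - real d"
    using onb_card[OF B(1)] dT card_Un_disjoint[OF fB B(3)] by simp
  have "(real l)\<^sup>2 * codim_const = (\<Sum>b\<in>B1 \<union> B2. real l - H x b \<bullet> b)" by (rule focal_trace[OF x B(2), symmetric])
  also have "\<dots> = (\<Sum>b\<in>B1. real l - H x b \<bullet> b) + (\<Sum>b\<in>B2. real l - H x b \<bullet> b)" using fB B(3) by (simp add: sum.union_disjoint)
  also have "\<dots> = (\<Sum>b\<in>B2. real l - H x b \<bullet> b)" using k1 by simp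
  also have "\<dots> \<le> (\<Sum>b\<in>B2. (real l)\<^sup>2)" by (intro sum_mono focal_hessian_bounds(2)[OF x] tB) auto
  also have "\<dots> = (real l)\<^sup>2 * (real n - real d)" using cards by simp
  finally show ?thesis using l by simp
qed

end

section \<open>From profiles to solutions on the sphere\<close>

text \<open>A connected subset has a connected finite image, so it lies in a single fibre.\<close>

lemma components_of_finite_fibration:
  fixes f :: "'a::topological_space \<Rightarrow> real"
  assumes c: "continuous_on X f" and Z: "finite Z" "f ` X \<subseteq> Z"
    and fib: "\<And>t. t \<in> Z \<Longrightarrow> connected {x \<in> X. f x = t} \<and> {x \<in> X. f x = t} \<noteq> {}"
  shows "components X = (\<lambda>t. {x \<in> X. f x = t}) ` Z"
proof -
  have one: "\<exists>t\<in>Z. C \<subseteq> {x \<in> X. f x = t}" if C: "connected C" "C \<subseteq> X" "C \<noteq> {}" for C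
  proof -
    have "connected (f ` C)" by (rule connected_continuous_image[OF continuous_on_subset[OF c C(2)] C(1)])
    moreover have "finite (f ` C)" using Z C(2) by (meson finite_subset image_mono)
    ultimately obtain t where t: "f ` C = {t}" using C(3) connected_finite_iff_sing by blast
    then have "t \<in> Z" "\<forall>x\<in>C. f x = t" using Z(2) C(2) by blast+
    then show ?thesis using C(2) by blast
  qed
  show ?thesis
  proof (intro equalityI subsetI)
    fix C assume C: "C \<in> components X"
    have C': "connected C" "C \<subseteq> X" "C \<noteq> {}"
      by (rule in_components_connected[OF C] in_components_subset[OF C] in_components_nonempty[OF C])+
    obtain t where t: "t \<in> Z" "C \<subseteq> {x \<in> X. f x = t}" using one[OF C'] by blast
    then have "{x \<in> X. f x = t} = C"
      using C fib[OF t(1)] unfolding in_components_maximal by blast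
    then show "C \<in> (\<lambda>t. {x \<in> X. f x = t}) ` Z" using t(1) by blast
  next
    fix C assume "C \<in> (\<lambda>t. {x \<in> X. f x = t}) ` Z"
    then obtain t where t: "t \<in> Z" "C = {x \<in> X. f x = t}" by blast
    have "D = C" if D: "D \<noteq> {}" "C \<subseteq> D" "D \<subseteq> X" "connected D" for D
    proof -
      obtain t' where t': "D \<subseteq> {x \<in> X. f x = t'}" using one[OF D(4,3,1)] by blast
      obtain x where "x \<in> C" using fib[OF t(1)] t(2) by blast
      then have "t' = t" using t t' D(2) by blast
      then show ?thesis using t' t(2) D(2) by blast
    qed
    then show "C \<in> components X"
      unfolding in_components_maximal using fib[OF t(1)] t(2) by blast
  qed
qed

text \<open>The critical exponent decreases with the dimension, and for \<open>\<alpha> \<le> 1\<close> the condition holds anyway.\<close>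

lemma subcritical_of_critical_exponent:
  assumes p: "1 < p" "ereal p < critical_exponent n d" and \<alpha>: "\<alpha> > 0" "2 * \<alpha> \<le> real n - real d"
  shows "p * (\<alpha> - 1) < \<alpha> + 1"
proof (cases "\<alpha> \<le> 1")
  case True
  then have "p * (\<alpha> - 1) \<le> 0" using p by (intro mult_nonneg_nonpos) auto
  then show ?thesis using \<alpha> by linarith
next
  case False
  define N where "N = real n - real d"
  have N: "N > 2" "2 * \<alpha> \<le> N" using False \<alpha> by (auto simp: N_def)
  then have "p < (N + 2) / (N - 2)" using p(2) by (simp add: critical_exponent_def N_def)
  then have "p * (N - 2) < N + 2" using N by (simp add: pos_less_divide_eq)
  then have "p * (N - 2) * (\<alpha> - 1) < (N + 2) * (\<alpha> - 1)" using False by (intro mult_strict_right_mono) auto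
  also have "\<dots> \<le> (\<alpha> + 1) * (N - 2)" using N by (simp add: algebra_simps)
  finally have "(p * (\<alpha> - 1)) * (N - 2) < (\<alpha> + 1) * (N - 2)" by (simp add: algebra_simps)
  then show ?thesis using N by simp
qed

context cartan_muenzner_data
begin

lemma comp_C2:
  assumes w: "\<And>t. (w has_real_derivative w1 t) (at t)" "\<And>t. (w1 has_real_derivative w2 t) (at t)"
    and c: "continuous_on UNIV w2"
  shows "Ck_open 2 U (\<lambda>x. w (F x))"
proof -
  have d1: "((\<lambda>y. w (F y)) has_derivative (\<lambda>h. w1 (F x) * (G x \<bullet> h))) (at x)" for x
    using has_derivative_compose[OF dF, of w "\<lambda>h. w1 (F x) * h" x] w(1)[of "F x"] by (simp add: has_field_derivative_def)
  have d1': "((\<lambda>y. w1 (F y)) has_derivative (\<lambda>h. w2 (F x) * (G x \<bullet> h))) (at x)" for x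
    using has_derivative_compose[OF dF, of w1 "\<lambda>h. w2 (F x) * h" x] w(2)[of "F x"] by (simp add: has_field_derivative_def)
  have d2: "((\<lambda>x. w1 (F x) * (G x \<bullet> v)) has_derivative (\<lambda>h. w1 (F x) * (H x h \<bullet> v) + w2 (F x) * (G x \<bullet> h) * (G x \<bullet> v))) (at x)" for x v
    by (rule has_derivative_mult[OF d1' has_derivative_inner_left[OF dG]])
  have cF: "continuous_on U F" by (rule F_continuous)
  have cw1: "continuous_on UNIV w1" by (rule DERIV_continuous_on[OF has_field_derivative_at_within[OF w(2)]])
  have "continuous_on U (\<lambda>x. w1 (F x) * (H x h \<bullet> v) + w2 (F x) * (G x \<bullet> h) * (G x \<bullet> v))" for h v
    by (intro continuous_intros continuous_on_compose2[OF c cF] continuous_on_compose2[OF cw1 cF]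
        G_continuous polynomial_continuous[OF polynomial_H]) auto
  then have "Ck_open (Suc 0) U (\<lambda>x. w1 (F x) * (G x \<bullet> v))" for v
    unfolding Ck_open.simps
    by (intro exI[of _ "\<lambda>x h. w1 (F x) * (H x h \<bullet> v) + w2 (F x) * (G x \<bullet> h) * (G x \<bullet> v)"] conjI ballI allI d2)
  then show ?thesis
    unfolding numeral_2_eq_2 Ck_open.simps(2)[of "Suc 0"]
    by (intro exI[of _ "\<lambda>x h. w1 (F x) * (G x \<bullet> h)"] conjI ballI allI d1)
qed

lemma levels_disjnt: "pairwise disjnt (sphere_level F ` Y)"
proof (rule pairwiseI)
  fix A B assume "A \<in> sphere_level F ` Y" "B \<in> sphere_level F ` Y" "A \<noteq> B"
  then obtain t t' where t: "A = sphere_level F t" "B = sphere_level F t'" "t \<noteq> t'" by blast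
  then show "disjnt A B" by (simp add: disjnt_def sphere_level_def) blast
qed

text \<open>For \<open>u = W ((1 - F) / 2)\<close> the equation on the sphere becomes the equation for the profile \<open>W\<close>. Zeros and critical
  points of \<open>W\<close> correspond to levels of \<open>F\<close>, and the gradient of \<open>F\<close> itself contributes the focal submanifolds.\<close>

theorem nodal_solution:
  fixes k :: nat
  assumes t0: "-1 < t0" "t0 < 1" "sphere_level F t0 \<noteq> {}" "connected (sphere_level F t0)"
    and lam: "lam > 0"
    and jac: "bi_subcritical_jacobi (codim_const / 2) (cartan_muenzner_data.codim_const l n (- c) / 2) (lam / (real l)\<^sup>2) p"
  shows "\<exists>u. yamabe_type_solution lam p u \<and> nodal u \<and>
    at_least k (components (sphere_level u 0)) \<and>
    (\<forall>C\<in>components (sphere_level u 0). isoparametric_hypersurface C \<and> diffeomorphic C (sphere_level F t0)) \<and>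
    (\<exists>\<H>. finite \<H> \<and> at_least (k - 1) \<H> \<and>
      (\<forall>C\<in>\<H>. isoparametric_hypersurface C \<and> diffeomorphic C (sphere_level F t0)) \<and>
      pairwise disjnt (insert (sphere_level F 1) (insert (sphere_level F (-1)) \<H>)) \<and>
      sphere_critical_set u = sphere_level F 1 \<union> sphere_level F (-1) \<union> \<Union>\<H>) \<and>
    (\<forall>x\<in>sphere_level F 1. real k \<le> \<bar>u x\<bar>)"
proof -
  interpret N: cartan_muenzner_data "\<lambda>x. - F x" "\<lambda>x. - G x" "\<lambda>x h. - H x h" l n "- c" by (rule negate)
  define \<alpha> \<beta> \<mu> where "\<alpha> = codim_const / 2" and "\<beta> = N.codim_const / 2" and "\<mu> = lam / (real l)\<^sup>2"
  interpret J: bi_subcritical_jacobi \<alpha> \<beta> \<mu> p using jac by (simp add: \<alpha>_def \<beta>_def \<mu>_def)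
  obtain W W1 W2 :: "real \<Rightarrow> real" where
    dW: "\<And>s. (W has_real_derivative W1 s) (at s)" "\<And>s. (W1 has_real_derivative W2 s) (at s)"
    and cW: "continuous_on UNIV W2"
    and ode: "\<And>s. s \<in> {0..1} \<Longrightarrow> s * (1 - s) * W2 s + (\<alpha> * (1 - s) - \<beta> * s) * W1 s + \<mu> * nonlin p (W s) = 0"
    and W0: "W 0 \<ge> real k" "W 0 > 0"
    and fW: "finite {s \<in> {0..1}. W s = 0}" and zW: "\<And>s. s \<in> {0..1} \<Longrightarrow> W s = 0 \<Longrightarrow> s \<in> {0<..<1}"
    and lW: "at_least (Suc k) {s \<in> {0<..<1}. W s = 0}"
    and fW1: "finite {s \<in> {0..1}. W1 s = 0}" and zW1: "\<And>s. s \<in> {0..1} \<Longrightarrow> W1 s = 0 \<Longrightarrow> s \<in> {0<..<1}"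
    and lW1: "at_least k {s \<in> {0<..<1}. W1 s = 0}"
    and neg: "\<exists>s\<in>{0<..<1}. W s < 0"
    by (rule J.nodal_profile[of k]) (rule that, assumption+)
  define \<sigma> :: "real \<Rightarrow> real" where "\<sigma> t = (1 - t) / 2" for t
  define w w1 w2 where "w t = W (\<sigma> t)" and "w1 t = - W1 (\<sigma> t) / 2" and "w2 t = W2 (\<sigma> t) / 4" for t
  have d\<sigma>: "(\<sigma> has_real_derivative - 1/2) (at t)" for t
    unfolding \<sigma>_def[abs_def] by (auto intro!: derivative_eq_intros)
  have dw: "(w has_real_derivative w1 t) (at t)" for t
    using DERIV_chain[OF dW(1) d\<sigma>[of t]] by (simp add: w_def[abs_def] w1_def o_def)
  have dw1: "(w1 has_real_derivative w2 t) (at t)" for t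
    using DERIV_cdivide[OF DERIV_minus[OF DERIV_chain[OF dW(2) d\<sigma>[of t]]], of 2]
    by (simp add: w1_def[abs_def] w2_def o_def)
  have cw2: "continuous_on UNIV w2"
    unfolding w2_def[abs_def] \<sigma>_def
    by (intro continuous_intros continuous_on_compose2[OF cW]) auto
  define u where "u x = w (F x)" for x
  have \<sigma>_in: "\<sigma> t \<in> {0..1} \<longleftrightarrow> t \<in> {-1..1}" "\<sigma> t \<in> {0<..<1} \<longleftrightarrow> t \<in> {-1<..<1}" for t
    by (auto simp: \<sigma>_def)
  have inj: "inj \<sigma>" by (auto simp: inj_def \<sigma>_def)
  have \<sigma>_inv: "\<sigma> (1 - 2 * s) = s" for s by (simp add: \<sigma>_def)
  have sol: "yamabe_type_solution lam p u"
    unfolding yamabe_type_solution_def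
  proof (intro conjI ballI)
    show "Ck_on 2 unit_sphere u"
      unfolding Ck_on_def u_def[abs_def]
      using comp_C2[OF dw dw1 cw2, of UNIV] by (intro ballI exI[of _ UNIV] exI[of _ "\<lambda>x. w (F x)"]) auto
    fix x :: 'a assume "x \<in> unit_sphere"
    then have x: "norm x = 1" by simp
    let ?t = "F x" and ?s = "\<sigma> (F x)"
    have s: "?s \<in> {0..1}" using F_range[OF x] \<sigma>_in by blast
    have lp: "(real l)\<^sup>2 > 0" using l by simp
    define m where "m = real l * (real n + real l - 1)"
    have ab: "(real l)\<^sup>2 * \<alpha> = (m - c) / 2" "(real l)\<^sup>2 * \<beta> = (m + c) / 2"
      using lp by (simp_all add: \<alpha>_def \<beta>_def codim_const_def N.codim_const_def m_def)
    have t: "?t = 1 - 2 * ?s" by (simp add: \<sigma>_def field_simps)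
    have "sphere_laplacian u x = w2 ?t * ((real l)\<^sup>2 * (1 - ?t\<^sup>2)) + w1 ?t * (c - m * ?t)"
      unfolding u_def[abs_def] m_def using sphere_laplacian_comp[OF x dw dw1] by simp
    also have "\<dots> = (real l)\<^sup>2 * (?s * (1 - ?s) * W2 ?s) + (((real l)\<^sup>2 * \<alpha>) * (1 - ?s) - ((real l)\<^sup>2 * \<beta>) * ?s) * W1 ?s"
    proof -
      have k1: "1 - (1 - 2 * s)\<^sup>2 = 4 * (s * (1 - s))" for s :: real by (simp add: power2_eq_square algebra_simps)
      have k2: "- (c - m * (1 - 2 * s)) / 2 = (m - c) / 2 * (1 - s) - (m + c) / 2 * s" for s
        by (simp add: field_simps)
      have k3: "- a / 2 * b = (- b / 2) * a" for a b :: real by simp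
      have e1: "1 - ?t\<^sup>2 = 4 * (?s * (1 - ?s))" using k1[of ?s] unfolding t[symmetric] .
      have e2: "- (c - m * ?t) / 2 = (m - c) / 2 * (1 - ?s) - (m + c) / 2 * ?s"
        using k2[of ?s] unfolding t[symmetric] .
      have e3: "w1 ?t * (c - m * ?t) = (- (c - m * ?t) / 2) * W1 ?s"
        unfolding w1_def by (rule k3)
      show ?thesis unfolding ab e1 e3 e2 by (simp add: w2_def)
    qed
    also have "\<dots> = (real l)\<^sup>2 * (?s * (1 - ?s) * W2 ?s + (\<alpha> * (1 - ?s) - \<beta> * ?s) * W1 ?s)"
      by (simp add: algebra_simps)
    also have "?s * (1 - ?s) * W2 ?s + (\<alpha> * (1 - ?s) - \<beta> * ?s) * W1 ?s = - (\<mu> * nonlin p (W ?s))"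
      using ode[OF s] by linarith
    also have "(real l)\<^sup>2 * - (\<mu> * nonlin p (W ?s)) = - (lam * nonlin p (u x))"
      using lp by (simp add: \<mu>_def u_def w_def)
    finally show "- sphere_laplacian u x + lam * u x = lam * (\<bar>u x\<bar> powr (p - 1) * u x)"
      by (simp add: nonlin_def algebra_simps)
  qed
  have level_ne: "sphere_level F t \<noteq> {}" if "t \<in> {-1..1}" for t by (rule level_nonempty[OF t0(1-3) that])
  have level_iso: "isoparametric_hypersurface (sphere_level F t)" "diffeomorphic (sphere_level F t) (sphere_level F t0)"
    if "t \<in> {-1<..<1}" for t
    using level_isoparametric[OF t0(1,2) _ _ t0(3,4), of t] levels_diffeomorphic[of t t0] t0 that by auto
  have level_inj: "inj_on (sphere_level F) {-1..1}"
  proof (rule inj_onI)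
    fix t t' :: real assume t: "t \<in> {-1..1}" "t' \<in> {-1..1}" "sphere_level F t = sphere_level F t'"
    obtain x where "x \<in> sphere_level F t" using level_ne[OF t(1)] by blast
    then show "t = t'" using t(3) by (auto simp: sphere_level_def)
  qed
  define Z Z1 where "Z = {t \<in> {-1..1}. w t = 0}" and "Z1 = {t \<in> {-1..1}. w1 t = 0}"
  have Z: "finite Z" "Z \<subseteq> {-1<..<1}" "at_least k Z" and Z1: "finite Z1" "Z1 \<subseteq> {-1<..<1}" "at_least (k - 1) Z1"
  proof -
    have gen: "finite {t \<in> {-1..1}. P (\<sigma> t)}" "{t \<in> {-1..1}. P (\<sigma> t)} \<subseteq> {-1<..<1}" "at_least j {t \<in> {-1..1}. P (\<sigma> t)}"
      if P: "finite {s \<in> {0..1}. P s}" "\<And>s. s \<in> {0..1} \<Longrightarrow> P s \<Longrightarrow> s \<in> {0<..<1}" "at_least i {s \<in> {0<..<1}. P s}" "j \<le> i" for P i j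
    proof -
      have "\<sigma> ` {t \<in> {-1..1}. P (\<sigma> t)} \<subseteq> {s \<in> {0..1}. P s}" using \<sigma>_in(1) by blast
      then have "finite (\<sigma> ` {t \<in> {-1..1}. P (\<sigma> t)})" using P(1) by (rule finite_subset)
      then show "finite {t \<in> {-1..1}. P (\<sigma> t)}" by (rule finite_imageD) (use inj in \<open>auto intro: inj_on_subset\<close>)
      show "{t \<in> {-1..1}. P (\<sigma> t)} \<subseteq> {-1<..<1}" using P(2) \<sigma>_in by blast
      have "at_least i ((\<lambda>s. 1 - 2 * s) ` {s \<in> {0<..<1}. P s})"
        by (rule at_least_inj_image[OF P(3)]) (auto simp: inj_on_def)
      then show "at_least j {t \<in> {-1..1}. P (\<sigma> t)}"
        by (rule at_least_mono[OF _ P(4)]) (auto simp: \<sigma>_inv)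
    qed
    have "Z = {t \<in> {-1..1}. W (\<sigma> t) = 0}" "Z1 = {t \<in> {-1..1}. W1 (\<sigma> t) = 0}"
      by (auto simp: Z_def Z1_def w_def w1_def)
    then show "finite Z" "Z \<subseteq> {-1<..<1}" "at_least k Z" "finite Z1" "Z1 \<subseteq> {-1<..<1}" "at_least (k - 1) Z1"
      using gen[of "\<lambda>s. W s = 0" "Suc k" k, OF fW zW lW] gen[of "\<lambda>s. W1 s = 0" k "k - 1", OF fW1 zW1 lW1] by simp_all
  qed
  have Zsub: "Z \<subseteq> {-1..1}" "Z1 \<subseteq> {-1..1}" by (auto simp: Z_def Z1_def)
  have fib: "{x \<in> sphere_level u 0. F x = t} = sphere_level F t" if "t \<in> Z" for t
    using that by (auto simp: sphere_level_def u_def Z_def)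
  have comps: "components (sphere_level u 0) = sphere_level F ` Z"
  proof -
    have "components (sphere_level u 0) = (\<lambda>t. {x \<in> sphere_level u 0. F x = t}) ` Z"
    proof (rule components_of_finite_fibration[OF F_continuous Z(1)])
      show "F ` sphere_level u 0 \<subseteq> Z" using F_range by (auto simp: sphere_level_def u_def Z_def)
      fix t assume t: "t \<in> Z"
      have "isoparametric_hypersurface (sphere_level F t)" by (rule level_iso) (use t Z(2) in blast)
      moreover have "sphere_level F t \<noteq> {}" by (rule level_ne) (use t Zsub in blast)
      ultimately show "connected {x \<in> sphere_level u 0. F x = t} \<and> {x \<in> sphere_level u 0. F x = t} \<noteq> {}"
        unfolding fib[OF t] isoparametric_hypersurface_def by blast
    qed
    also have "\<dots> = sphere_level F ` Z" by (rule image_cong[OF refl fib])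
    finally show ?thesis .
  qed
  have crit: "sphere_critical_set u = sphere_level F 1 \<union> sphere_level F (-1) \<union> \<Union>(sphere_level F ` Z1)"
  proof -
    have "sphere_gradient u x = 0 \<longleftrightarrow> F x = 1 \<or> F x = -1 \<or> F x \<in> Z1" if x: "norm x = 1" for x
      unfolding u_def[abs_def] sphere_gradient_comp[OF x dw]
      using tangrad_zero_iff[OF x] F_range[OF x] by (auto simp: Z1_def)
    then show ?thesis by (auto simp: sphere_critical_set_def sphere_level_def)
  qed
  have disj: "pairwise disjnt (insert (sphere_level F 1) (insert (sphere_level F (-1)) (sphere_level F ` Z1)))"
    using levels_disjnt[of "insert 1 (insert (-1) Z1)"] by simp
  have nod: "nodal u"
    unfolding nodal_def
  proof
    obtain x where "x \<in> sphere_level F 1" using level_ne[of 1] by auto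
    then show "\<exists>x\<in>unit_sphere. 0 < u x" using W0 by (auto simp: sphere_level_def u_def w_def \<sigma>_def intro!: bexI[of _ x])
    obtain s where s: "s \<in> {0<..<1}" "W s < 0" using neg by blast
    then obtain y where "y \<in> sphere_level F (1 - 2 * s)" using level_ne[of "1 - 2 * s"] by auto
    then show "\<exists>x\<in>unit_sphere. u x < 0" using s by (auto simp: sphere_level_def u_def w_def \<sigma>_inv intro!: bexI[of _ y])
  qed
  have big: "\<forall>x\<in>sphere_level F 1. real k \<le> \<bar>u x\<bar>"
    using W0 by (auto simp: sphere_level_def u_def w_def \<sigma>_def)
  have inst: "\<forall>C\<in>sphere_level F ` Y. isoparametric_hypersurface C \<and> diffeomorphic C (sphere_level F t0)"
    if "Y \<subseteq> {-1<..<1}" for Y using level_iso that by blast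
  have cnt: "at_least i (sphere_level F ` Y)" if "at_least i Y" "Y \<subseteq> {-1..1}" for i Y
    by (rule at_least_inj_image[OF that(1) inj_on_subset[OF level_inj that(2)]])
  show ?thesis
  proof (intro exI[of _ u] conjI)
    show "at_least k (components (sphere_level u 0))" unfolding comps by (rule cnt[OF Z(3) Zsub(1)])
    show "\<forall>C\<in>components (sphere_level u 0). isoparametric_hypersurface C \<and> diffeomorphic C (sphere_level F t0)"
      unfolding comps by (rule inst[OF Z(2)])
    show "\<exists>\<H>. finite \<H> \<and> at_least (k - 1) \<H> \<and>
      (\<forall>C\<in>\<H>. isoparametric_hypersurface C \<and> diffeomorphic C (sphere_level F t0)) \<and>
      pairwise disjnt (insert (sphere_level F 1) (insert (sphere_level F (-1)) \<H>)) \<and>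
      sphere_critical_set u = sphere_level F 1 \<union> sphere_level F (-1) \<union> \<Union>\<H>"
      by (rule exI[of _ "sphere_level F ` Z1"]) (intro conjI disj crit inst[OF Z1(2)] cnt[OF Z1(3) Zsub(2)] finite_imageI Z1(1))
  qed (rule sol nod big)+
qed

end

theorem theorem1p1:
  fixes S M_minus M_plus :: "'a::euclidean_space set"
    and n n_minus n_plus :: nat
    and lam p :: real
  assumes "DIM('a) = n + 1"
    and "n \<ge> 3"
    and "isoparametric_hypersurface S"
    and "focal_submanifolds S M_minus M_plus"
    and "smooth_submanifold n_minus M_minus"
    and "smooth_submanifold n_plus M_plus"
    and "n_minus \<le> n_plus"
    and "lam > 0"
    and "1 < p"
    and "ereal p < critical_exponent n n_minus"
  shows "\<exists>u :: nat \<Rightarrow> 'a \<Rightarrow> real.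
    (\<forall>k.
       yamabe_type_solution lam p (u k) \<and>
       nodal (u k) \<and>
       at_least k (components (sphere_level (u k) 0)) \<and>
       (\<forall>C \<in> components (sphere_level (u k) 0).
          isoparametric_hypersurface C \<and> diffeomorphic C S) \<and>
       (\<exists>\<H>. finite \<H> \<and> at_least (k - 1) \<H> \<and>
          (\<forall>C\<in>\<H>. isoparametric_hypersurface C \<and> diffeomorphic C S) \<and>
          pairwise disjnt (insert M_minus (insert M_plus \<H>)) \<and>
          sphere_critical_set (u k) = M_minus \<union> M_plus \<union> \<Union>\<H>)) \<and>
    ((\<forall>x\<in>M_minus. filterlim (\<lambda>k. \<bar>u k x\<bar>) at_top sequentially) \<or>
     (\<forall>x\<in>M_plus. filterlim (\<lambda>k. \<bar>u k x\<bar>) at_top sequentially))"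
proof -
  obtain F l where cm: "cartan_muenzner F l" and reg: "regular_level_set F S"
    and M: "M_minus = sphere_level F 1 \<and> M_plus = sphere_level F (-1) \<or>
      M_minus = sphere_level F (-1) \<and> M_plus = sphere_level F 1"
    using assms(4) unfolding focal_submanifolds_def by blast
  obtain G H c where data: "cartan_muenzner_data F G H l n c"
    using cartan_muenzner_imp_data[OF cm assms(1)] by blast
  interpret C: cartan_muenzner_data F G H l n c by (rule data)
  interpret N: cartan_muenzner_data "\<lambda>x. - F x" "\<lambda>x. - G x" "\<lambda>x h. - H x h" l n "- c" by (rule C.negate)
  obtain t0 where S: "S = sphere_level F t0" "S \<noteq> {}" "S \<inter> sphere_critical_set F = {}"
    using reg unfolding regular_level_set_def by blast
  have conn: "connected S" using assms(3) by (simp add: isoparametric_hypersurface_def)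
  obtain y where y: "y \<in> S" using S(2) by blast
  then have y1: "norm y = 1" "F y = t0" using S(1) by (auto simp: sphere_level_def)
  have "y \<notin> sphere_critical_set F" using y S(3) by blast
  then have "C.tangrad y \<noteq> 0" using y1 C.sphere_gradient_F by (auto simp: sphere_critical_set_def)
  then have "t0 \<noteq> 1" "t0 \<noteq> -1" using C.tangrad_zero_iff[OF y1(1)] y1(2) by auto
  then have t0: "-1 < t0" "t0 < 1" using C.F_range[OF y1(1)] y1(2) by auto
  have ne: "sphere_level F t0 \<noteq> {}" using S by simp
  have focal_ne: "sphere_level F 1 \<noteq> {}" "sphere_level F (-1) \<noteq> {}"
    by (rule C.level_nonempty[OF t0 ne]; simp)+
  have neg_level: "sphere_level (\<lambda>x. - F x) 1 = sphere_level F (-1)"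
    by (auto simp: sphere_level_def)
  obtain d1 d2 where d: "smooth_submanifold d1 (sphere_level F 1)" "smooth_submanifold d2 (sphere_level F (-1))"
    "n_minus \<le> d1" "n_minus \<le> d2"
    using M assms(5-7) by blast
  define \<alpha> \<beta> \<mu> where "\<alpha> = C.codim_const / 2" and "\<beta> = N.codim_const / 2" and "\<mu> = lam / (real l)\<^sup>2"
  have \<alpha>: "1 / 2 \<le> \<alpha>" "2 * \<alpha> \<le> real n - real n_minus"
    using C.codim_const_ge_1[OF y1(1)] t0 y1(2) C.codim_const_le[OF d(1) focal_ne(1)] d(3) by (auto simp: \<alpha>_def)
  have \<beta>: "1 / 2 \<le> \<beta>" "2 * \<beta> \<le> real n - real n_minus"
    using N.codim_const_ge_1[OF y1(1)] t0 y1(2) N.codim_const_le[unfolded neg_level, OF d(2) focal_ne(2)] d(4)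
    by (auto simp: \<beta>_def)
  have \<mu>: "\<mu> > 0" using assms(8) C.l by (simp add: \<mu>_def)
  have sub: "p * (\<alpha> - 1) < \<alpha> + 1" "p * (\<beta> - 1) < \<beta> + 1"
    using subcritical_of_critical_exponent[OF assms(9,10)] \<alpha> \<beta> by auto
  have "bi_subcritical_jacobi \<alpha> \<beta> \<mu> p"
    by unfold_locales (use \<alpha> \<beta> \<mu> sub assms(9) in auto)
  note sols = C.nodal_solution[OF t0 ne conn[unfolded S(1)] assms(8) this[unfolded \<alpha>_def \<beta>_def \<mu>_def], folded S(1)]
  \<comment> \<open>Either focal submanifold may be the one on which \<open>F = 1\<close>.\<close>
  have sym: "sphere_level F 1 \<union> sphere_level F (-1) = M_minus \<union> M_plus"
    "insert (sphere_level F 1) (insert (sphere_level F (-1)) \<H>) = insert M_minus (insert M_plus \<H>)" for \<H>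
    using M by auto
  define Q where "Q k v \<longleftrightarrow> yamabe_type_solution lam p v \<and> nodal v \<and>
    at_least k (components (sphere_level v 0)) \<and>
    (\<forall>C\<in>components (sphere_level v 0). isoparametric_hypersurface C \<and> diffeomorphic C S) \<and>
    (\<exists>\<H>. finite \<H> \<and> at_least (k - 1) \<H> \<and>
      (\<forall>C\<in>\<H>. isoparametric_hypersurface C \<and> diffeomorphic C S) \<and>
      pairwise disjnt (insert M_minus (insert M_plus \<H>)) \<and>
      sphere_critical_set v = M_minus \<union> M_plus \<union> \<Union>\<H>)" for k :: nat and v :: "'a \<Rightarrow> real"
  have "\<exists>v. Q k v \<and> (\<forall>x\<in>sphere_level F 1. real k \<le> \<bar>v x\<bar>)" for k
    unfolding Q_def using sols[of k, unfolded sym] by (simp only: conj_assoc)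
  then obtain u where u: "\<And>k. Q k (u k)" "\<And>k x. x \<in> sphere_level F 1 \<Longrightarrow> real k \<le> \<bar>u k x\<bar>"
    by metis
  have lim: "filterlim (\<lambda>k. \<bar>u k x\<bar>) at_top sequentially" if "x \<in> sphere_level F 1" for x
    by (rule filterlim_at_top_mono[OF filterlim_real_sequentially]) (use u that in auto)
  have lims: "(\<forall>x\<in>M_minus. filterlim (\<lambda>k. \<bar>u k x\<bar>) at_top sequentially) \<or>
    (\<forall>x\<in>M_plus. filterlim (\<lambda>k. \<bar>u k x\<bar>) at_top sequentially)"
    using M lim by blast
  show ?thesis
    by (rule exI[of _ u], rule conjI, rule allI, rule u(1)[unfolded Q_def], rule lims)
qed

end
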